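(* Let $q\ge 0$, let $\zeta=(\zeta_t,t\ge0)$ be a subordinator with drift $c\ge 0$ and Lévy measure $\Pi$, $\xi=-\zeta$, and let $I_{\mathbf{e}_q}:=\int_0^{\mathbf{e}_q}e^{\xi_s}\,\mathrm{d}s=\int_0^{\mathbf{e}_q}e^{-\zeta_s}\,\mathrm{d}s$, where $\mathbf{e}_q$ is an exponential random variable of parameter $q$ independent of $\zeta$ ($\mathbf{e}_0=\infty$). The random variable $I_{\mathbf{e}_q}$ has a density, denoted by $k$, and it solves $$(1-cx)k(x)=\int_x^\infty\overline{\Pi}(\log(y/x))\,k(y)\,\mathrm{d}y+q\int_x^\infty k(y)\,\mathrm{d}y,\qquad x\in(0,1/c).$$ Conversely, if a density on $(0,1/c)$ satisfies this equation, then it is the density of $I_{\mathbf{e}_q}$.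
   Context: A subordinator $\zeta$ is a Lévy process, issued from $0$, with non-decreasing paths; its Laplace exponent is $$\phi(\lambda)=-\log\mathbb{E}[e^{-\lambda\zeta_1}]=c\lambda+\int_{(0,\infty)}(1-e^{-\lambda x})\,\Pi(\mathrm{d}x),\qquad\lambda\ge0,$$ with drift $c\ge0$ and Lévy measure $\Pi$ satisfying $\int_{(0,\infty)}(1\wedge x)\Pi(\mathrm{d}x)<\infty$. Notation: $\overline{\Pi}(x)=\Pi(x,\infty)$ for $x>0$. Conventions: $1/c=\infty$ if $c=0$; a density on $(0,1/c)$ is a probability density, taken to be zero outside $(0,1/c)$; the density $k$ of $I_{\mathbf{e}_q}$ solving the equation means that $k$ is a suitable version of the density. Standing assumption: when $q=0$, the process $\xi=-\zeta$ drifts to $-\infty$ (so that $I_{\mathbf{e}_0}=\int_0^\infty e^{-\zeta_s}\,\mathrm{d}s$ is almost surely finite).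
   Formalization: The existence of the density is claimed only outside the case q = 0 and Π = 0, where ζ_t = ct, the variable I equals the constant 1/c and has no density; the converse is stated without this restriction. *)

theory Defs
  imports "HOL-Probability.Probability"
begin

definition levy_process :: "'a measure \<Rightarrow> (real \<Rightarrow> 'a \<Rightarrow> real) \<Rightarrow> bool" where
  "levy_process M X \<longleftrightarrow>
     prob_space M \<and>
     (\<forall>t\<ge>0. X t \<in> borel_measurable M) \<and>
     (\<forall>\<omega>\<in>space M. X 0 \<omega> = 0) \<and>
     (\<forall>\<omega>\<in>space M. \<forall>t\<ge>0. ((\<lambda>s. X s \<omega>) \<longlongrightarrow> X t \<omega>) (at_right t)) \<and>
     (\<forall>\<omega>\<in>space M. \<forall>t>0. \<exists>l. ((\<lambda>s. X s \<omega>) \<longlongrightarrow> l) (at_left t)) \<and>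
     (\<forall>n (ts :: nat \<Rightarrow> real). 0 \<le> ts 0 \<and> (\<forall>i<n. ts i \<le> ts (Suc i)) \<longrightarrow>
        prob_space.indep_vars M (\<lambda>_. borel) (\<lambda>i \<omega>. X (ts (Suc i)) \<omega> - X (ts i) \<omega>) {..<n}) \<and>
     (\<forall>s\<ge>0. \<forall>t\<ge>0. distr M borel (\<lambda>\<omega>. X (s + t) \<omega> - X s \<omega>) = distr M borel (X t))"

definition subordinator :: "'a measure \<Rightarrow> (real \<Rightarrow> 'a \<Rightarrow> real) \<Rightarrow> bool" where
  "subordinator M \<zeta> \<longleftrightarrow>
     levy_process M \<zeta> \<and> (\<forall>\<omega>\<in>space M. mono_on {0..} (\<lambda>t. \<zeta> t \<omega>))"

definition laplace_exponent :: "'a measure \<Rightarrow> (real \<Rightarrow> 'a \<Rightarrow> real) \<Rightarrow> real \<Rightarrow> real" where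
  "laplace_exponent M \<zeta> r = - ln (\<integral>\<omega>. exp (- r * \<zeta> 1 \<omega>) \<partial>M)"

text \<open>A measure on the open half-line is represented as a Borel measure on the reals that does not
  charge the non-positive numbers.\<close>

definition subordinator_levy_measure :: "real measure \<Rightarrow> bool" where
  "subordinator_levy_measure \<nu> \<longleftrightarrow>
     sets \<nu> = sets borel \<and> emeasure \<nu> {..0} = 0 \<and> (\<integral>\<^sup>+x. ennreal (min 1 x) \<partial>\<nu>) < \<infinity>"

definition subordinator_with ::
  "'a measure \<Rightarrow> (real \<Rightarrow> 'a \<Rightarrow> real) \<Rightarrow> real \<Rightarrow> real measure \<Rightarrow> bool" where
  "subordinator_with M \<zeta> c \<nu> \<longleftrightarrow>
     subordinator M \<zeta> \<and> 0 \<le> c \<and> subordinator_levy_measure \<nu> \<and>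
     (\<forall>r\<ge>0. laplace_exponent M \<zeta> r
        = c * r + (LINT x:{0<..}|\<nu>. 1 - exp (- r * x)))"

definition levy_tail :: "real measure \<Rightarrow> real \<Rightarrow> ennreal" where
  "levy_tail \<nu> x = emeasure \<nu> {x<..}"

definition drifts_to_minus_infinity :: "'a measure \<Rightarrow> (real \<Rightarrow> 'a \<Rightarrow> real) \<Rightarrow> bool" where
  "drifts_to_minus_infinity M \<xi> \<longleftrightarrow> (AE \<omega> in M. filterlim (\<lambda>t. \<xi> t \<omega>) at_bot at_top)"

definition exponential_time :: "'a measure \<Rightarrow> real \<Rightarrow> ('a \<Rightarrow> ereal) \<Rightarrow> bool" where
  "exponential_time M q T \<longleftrightarrow>
     T \<in> borel_measurable M \<and>
     (if q = 0 then (\<forall>\<omega>\<in>space M. T \<omega> = \<infinity>)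
      else (\<forall>\<omega>\<in>space M. \<bar>T \<omega>\<bar> \<noteq> \<infinity>) \<and>
           distributed M lborel (\<lambda>\<omega>. real_of_ereal (T \<omega>)) (\<lambda>x. ennreal (exponential_density q x)))"

definition independent_of_process ::
  "'a measure \<Rightarrow> ('a \<Rightarrow> ereal) \<Rightarrow> (real \<Rightarrow> 'a \<Rightarrow> real) \<Rightarrow> bool" where
  "independent_of_process M T X \<longleftrightarrow>
     prob_space.indep_set M
       {T -` A \<inter> space M | A. A \<in> sets borel}
       {(\<lambda>\<omega>. \<lambda>t\<in>{0..}. X t \<omega>) -` B \<inter> space M | B. B \<in> sets (PiM {0..} (\<lambda>_. borel))}"

text \<open>The value is the junk value 0 on paths whose integral diverges; this is a null event whenever
  the functional is almost surely finite. For an infinite horizon and a pure drift, with negative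
  slope -c, the functional is the constant 1/c and has no density; an existence statement for
  densities has to exclude that case.\<close>

definition exponential_functional ::
  "(real \<Rightarrow> 'a \<Rightarrow> real) \<Rightarrow> ('a \<Rightarrow> ereal) \<Rightarrow> 'a \<Rightarrow> real" where
  "exponential_functional \<xi> T \<omega> = (LINT s:{s. 0 \<le> s \<and> ereal s < T \<omega>}|lborel. exp (\<xi> s \<omega>))"

text \<open>The interval from 0 to 1/c, where 1/c is infinite for c = 0.\<close>

definition support_interval :: "real \<Rightarrow> real set" where
  "support_interval c = (if c = 0 then {0<..} else {0<..<1 / c})"

definition prob_density_on :: "real set \<Rightarrow> (real \<Rightarrow> real) \<Rightarrow> bool" where
  "prob_density_on S k \<longleftrightarrow>
     k \<in> borel_measurable borel \<and> (\<forall>x. 0 \<le> k x) \<and> (\<forall>x. x \<notin> S \<longrightarrow> k x = 0) \<and>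
     (\<integral>\<^sup>+x. ennreal (k x) \<partial>lborel) = 1"

text \<open>All integrands are non-negative, so the equation is stated in the extended non-negative reals;
  in particular the first integral is required to be finite at every x. The factor 1 - c x is
  positive on the interval.\<close>

definition solves_density_equation ::
  "real \<Rightarrow> real \<Rightarrow> real measure \<Rightarrow> (real \<Rightarrow> real) \<Rightarrow> bool" where
  "solves_density_equation q c \<nu> k \<longleftrightarrow>
     (\<forall>x\<in>support_interval c.
        ennreal ((1 - c * x) * k x)
          = (\<integral>\<^sup>+y\<in>{x<..}. (levy_tail \<nu> (ln (y / x)) * ennreal (k y)) \<partial>lborel)
            + ennreal q * (\<integral>\<^sup>+y\<in>{x<..}. ennreal (k y) \<partial>lborel))"

end

theory Submission
  imports Defs
begin

text \<open>Write \<open>I\<close> for the exponential functional, \<open>\<phi>\<close> for the Laplace exponent and \<open>\<Pi>(x)\<close> for the tail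
\<open>levy_tail \<nu> x\<close>. Everything rests on the moments. Expanding the power of the integral and using
stationary independent increments gives the recursion
\<open>E I^(n+1) = (n+1) / (q + \<phi>(n+1)) * E I^n\<close>, hence
\<open>E I^n = n! / ((q + \<phi> 1) \<dots> (q + \<phi> n))\<close> (\<open>nn_integral_exponential_functional_power\<close>). Since
\<open>q + \<phi> n \<ge> q + \<phi> 1 > 0\<close>, these moments are at most \<open>n! / a ^ n\<close> with \<open>a = q + \<phi> 1\<close>, and such
moments determine a law on the half-line (\<open>moments_determine_measure\<close>).

For a finite measure \<open>\<mu>\<close> on the half-line let \<open>R\<close> be the right-hand side of the equation with
\<open>\<mu>(dy)\<close> in place of \<open>k(y) dy\<close>. Since \<open>\<Pi>(log(y/x))\<close> is the mass of the \<open>s\<close> with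
\<open>y exp(-s) < x\<close>, Tonelli's theorem turns the integral of \<open>x ^ n R(x)\<close> into
\<open>(q + \<phi>(n+1) - c(n+1)) / (n+1)\<close> times the moment of \<open>\<mu>\<close> of order \<open>n+1\<close>. So the measure
\<open>c x \<mu>(dx) + R(x) dx\<close> has as its \<open>n\<close>-th moment \<open>(q + \<phi>(n+1)) / (n+1)\<close> times the moment of \<open>\<mu>\<close>
of order \<open>n+1\<close>: the factor of the recursion for \<open>I\<close>.

Converse: a density that solves the equation is a fixed point of this map, so its moments satisfy the
recursion and it is the density of \<open>I\<close> (\<open>moments_of_solution\<close>).

Existence: for the law \<open>\<mu>\<close> of \<open>I\<close> the measure \<open>c x \<mu>(dx) + R(x) dx\<close> has the moments of \<open>\<mu>\<close> and
therefore equals \<open>\<mu>\<close> (\<open>law_balance\<close>). Thus the singular part of \<open>\<mu>\<close> can only be an atom at \<open>1/c\<close>,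
which the decay of the moments excludes (\<open>no_atom_at_reciprocal_drift\<close>), and \<open>(1 - c x) k(x) = R(x)\<close>
holds almost everywhere for a density \<open>k\<close>. Dividing by \<open>1 - c x\<close> defines the version that solves the
equation at every point, provided that \<open>R\<close> is finite at every point and not only almost everywhere.
This is \<open>density_rhs_finite\<close>: the kernel \<open>\<Pi>(log(y/x))\<close> may have any integrable singularity on the
diagonal, but the part near the diagonal has small total mass, so an absorption argument bounds the
\<open>\<mu>\<close>-mass of a short interval \<open>(x, x + h]\<close> by a multiple of \<open>h\<close>, and a density bounded in this sense
integrates the singularity.\<close>

section \<open>Measures on the half-line determined by their moments\<close>

text \<open>Expanding the exponential compares its integral with a geometric series of ratio \<open>b / a\<close>.\<close>
lemma nn_integral_exp_le_of_moments:
  fixes N :: "real measure"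
  assumes [measurable_cong]: "sets N = sets borel" and pos: "AE x in N. 0 \<le> x"
    and mom: "\<And>n. (\<integral>\<^sup>+x. ennreal (x ^ n) \<partial>N) \<le> ennreal (fact n / a ^ n)"
    and b: "0 \<le> b" "b < a"
  shows "(\<integral>\<^sup>+x. ennreal (exp (b * x)) \<partial>N) < \<infinity>"
proof -
  have "(\<integral>\<^sup>+x. ennreal (exp (b * x)) \<partial>N) = (\<integral>\<^sup>+x. (\<Sum>n. ennreal (b ^ n / fact n) * ennreal (x ^ n)) \<partial>N)"
  proof (rule nn_integral_cong_AE, use pos in eventually_elim)
    fix x :: real assume x: "0 \<le> x"
    have "(\<lambda>n. (b * x) ^ n /\<^sub>R fact n) sums exp (b * x)" by (rule exp_converges)
    then have "(\<Sum>n. ennreal ((b * x) ^ n /\<^sub>R fact n)) = ennreal (exp (b * x))"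
      using x b by (intro suminf_ennreal_eq) auto
    also have "(\<lambda>n. ennreal ((b * x) ^ n /\<^sub>R fact n)) = (\<lambda>n. ennreal (b ^ n / fact n) * ennreal (x ^ n))"
      using x b by (auto simp: ennreal_mult[symmetric] power_mult_distrib divide_inverse mult_ac)
    finally show "ennreal (exp (b * x)) = (\<Sum>n. ennreal (b ^ n / fact n) * ennreal (x ^ n))" by simp
  qed
  also have "\<dots> = (\<Sum>n. ennreal (b ^ n / fact n) * (\<integral>\<^sup>+x. ennreal (x ^ n) \<partial>N))"
    by (subst nn_integral_suminf) (auto simp: nn_integral_cmult)
  also have "\<dots> \<le> (\<Sum>n. ennreal ((b / a) ^ n))"
  proof (intro suminf_le summableI)
    fix n
    have "ennreal (b ^ n / fact n) * (\<integral>\<^sup>+x. ennreal (x ^ n) \<partial>N) \<le> ennreal (b ^ n / fact n) * ennreal (fact n / a ^ n)"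
      by (intro mult_left_mono mom) simp
    also have "\<dots> = ennreal ((b / a) ^ n)"
      using b by (subst ennreal_mult[symmetric]) (auto simp: power_divide)
    finally show "ennreal (b ^ n / fact n) * (\<integral>\<^sup>+x. ennreal (x ^ n) \<partial>N) \<le> ennreal ((b / a) ^ n)" .
  qed
  also have "\<dots> = ennreal (\<Sum>n. (b / a) ^ n)"
    using b by (intro suminf_ennreal2 summable_geometric) auto
  also have "\<dots> < \<infinity>" by simp
  finally show ?thesis .
qed

text \<open>The polynomial factor is absorbed by a slightly larger exponential rate, still below \<open>a\<close>.\<close>
lemma integrable_power_mult_exp_of_moments:
  fixes N :: "real measure"
  assumes [measurable_cong]: "sets N = sets borel" and pos: "AE x in N. 0 \<le> x"
    and mom: "\<And>n. (\<integral>\<^sup>+x. ennreal (x ^ n) \<partial>N) \<le> ennreal (fact n / a ^ n)"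
    and b: "0 \<le> b" "b < a"
  shows "integrable N (\<lambda>x. x ^ j * exp (b * x))"
proof (rule integrableI_bounded)
  define d where "d = (a - b) / 2"
  have d: "0 < d" "b + d < a" using b by (auto simp: d_def field_simps)
  have "(\<integral>\<^sup>+x. ennreal (norm (x ^ j * exp (b * x))) \<partial>N)
     \<le> (\<integral>\<^sup>+x. ennreal (fact j / d ^ j) * ennreal (exp ((b + d) * x)) \<partial>N)"
  proof (rule nn_integral_mono_AE, use pos in eventually_elim)
    fix x :: real assume x: "0 \<le> x"
    have "(d * x) ^ j / fact j \<le> exp (d * x)"
      using d x sums_le[OF _ sums_single[of j "\<lambda>n. (d*x)^n /\<^sub>R fact n"] exp_converges[of "d * x"]]
      by (auto simp: divide_inverse mult.commute)
    then have "x ^ j \<le> fact j / d ^ j * exp (d * x)"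
      using d by (simp add: field_simps power_mult_distrib)
    then have "x ^ j * exp (b * x) \<le> fact j / d ^ j * exp (d * x) * exp (b * x)"
      by (intro mult_right_mono) auto
    then show "ennreal (norm (x ^ j * exp (b * x))) \<le> ennreal (fact j / d ^ j) * ennreal (exp ((b + d) * x))"
      using x d by (subst ennreal_mult[symmetric]) (auto intro!: ennreal_leI simp: exp_add distrib_left mult_ac)
  qed
  also have "\<dots> = ennreal (fact j / d ^ j) * (\<integral>\<^sup>+x. ennreal (exp ((b + d) * x)) \<partial>N)"
    by (rule nn_integral_cmult) measurable
  also have "\<dots> < \<infinity>"
    using nn_integral_exp_le_of_moments[OF assms(1-3), of "b + d"] b d
    by (auto simp: ennreal_mult_less_top)
  finally show "(\<integral>\<^sup>+x. ennreal (norm (x ^ j * exp (b * x))) \<partial>N) < \<infinity>" .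
qed measurable

text \<open>The Fourier transforms of \<open>x ^ m N(dx)\<close> at a frequency \<open>t\<close>, for all \<open>m\<close> together, determine
those at every frequency within distance \<open>a\<close> of \<open>t\<close>. The partial sums are dominated by
\<open>x ^ j exp(\<bar>h\<bar> x)\<close>.\<close>
lemma fourier_taylor_of_moments:
  fixes N :: "real measure"
  assumes [measurable_cong]: "sets N = sets borel" and pos: "AE x in N. 0 \<le> x"
    and mom: "\<And>n. (\<integral>\<^sup>+x. ennreal (x ^ n) \<partial>N) \<le> ennreal (fact n / a ^ n)"
    and h: "\<bar>h\<bar> < a"
  shows "(\<lambda>n. (\<i> * of_real h) ^ n / fact n * (\<integral>x. of_real (x ^ (j + n)) * iexp (t * x) \<partial>N))
     sums (\<integral>x. of_real (x ^ j) * iexp ((t + h) * x) \<partial>N)"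
proof -
  have int: "integrable N (\<lambda>x. x ^ j * exp (\<bar>h\<bar> * x))" for j
    using integrable_power_mult_exp_of_moments[OF assms(1-3)] h by auto
  have int0: "integrable N (\<lambda>x. complex_of_real (x ^ m) * iexp (t * x))" for m
  proof (rule Bochner_Integration.integrable_bound[OF int[of m]])
    show "AE x in N. norm (complex_of_real (x ^ m) * iexp (t * x)) \<le> norm (x ^ m * exp (\<bar>h\<bar> * x))"
      using pos by eventually_elim (auto simp: norm_mult norm_power mult_le_cancel_left1)
  qed measurable
  have "(\<lambda>K. \<integral>x. (\<Sum>n<K. (\<i> * of_real h) ^ n / fact n * (of_real (x ^ (j + n)) * iexp (t * x))) \<partial>N)
     \<longlonglongrightarrow> (\<integral>x. of_real (x ^ j) * iexp ((t + h) * x) \<partial>N)"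
  proof (rule integral_dominated_convergence[OF _ _ int[of j]])
    show "AE x in N. (\<lambda>K. \<Sum>n<K. (\<i> * of_real h) ^ n / fact n * (of_real (x ^ (j + n)) * iexp (t * x)))
         \<longlonglongrightarrow> of_real (x ^ j) * iexp ((t + h) * x)"
    proof (rule AE_I2)
      fix x
      have "(\<lambda>n. (\<i> * of_real (h * x)) ^ n /\<^sub>R fact n) sums iexp (h * x)"
        using exp_converges[of "\<i> * of_real (h * x)"] by simp
      then have "(\<lambda>n. of_real (x ^ j) * iexp (t * x) * ((\<i> * of_real (h * x)) ^ n /\<^sub>R fact n)) 
         sums (of_real (x ^ j) * iexp (t * x) * iexp (h * x))"
        by (rule sums_mult)
      also have "of_real (x ^ j) * iexp (t * x) * iexp (h * x) = of_real (x ^ j) * iexp ((t + h) * x)"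
        by (simp add: exp_add[symmetric] algebra_simps)
      also have "(\<lambda>n. of_real (x ^ j) * iexp (t * x) * ((\<i> * of_real (h * x)) ^ n /\<^sub>R fact n))
         = (\<lambda>n. (\<i> * of_real h) ^ n / fact n * (of_real (x ^ (j + n)) * iexp (t * x)))"
        by (auto simp: power_mult_distrib power_add scaleR_conv_of_real divide_inverse mult_ac)
      finally show "(\<lambda>K. \<Sum>n<K. (\<i> * of_real h) ^ n / fact n * (of_real (x ^ (j + n)) * iexp (t * x)))
         \<longlonglongrightarrow> of_real (x ^ j) * iexp ((t + h) * x)"
        unfolding sums_def .
    qed
    fix K
    show "AE x in N. norm (\<Sum>n<K. (\<i> * of_real h) ^ n / fact n * (of_real (x ^ (j + n)) * iexp (t * x)))
         \<le> x ^ j * exp (\<bar>h\<bar> * x)"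
      using pos
    proof eventually_elim
      fix x :: real assume x: "0 \<le> x"
      have "norm (\<Sum>n<K. (\<i> * of_real h) ^ n / fact n * (of_real (x ^ (j + n)) * iexp (t * x)))
        \<le> (\<Sum>n<K. norm ((\<i> * of_real h) ^ n / fact n * (of_real (x ^ (j + n)) * iexp (t * x))))"
        by (rule norm_sum)
      also have "\<dots> = (\<Sum>n<K. x ^ j * ((\<bar>h\<bar> * x) ^ n /\<^sub>R fact n))"
        using x by (intro sum.cong) (auto simp: norm_mult norm_divide norm_power power_mult_distrib power_add divide_inverse abs_mult norm_inverse)
      also have "\<dots> = x ^ j * (\<Sum>n<K. (\<bar>h\<bar> * x) ^ n /\<^sub>R fact n)"
        by (simp add: sum_distrib_left)
      also have "\<dots> \<le> x ^ j * exp (\<bar>h\<bar> * x)"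
      proof (rule mult_left_mono)
        have s: "(\<lambda>n. (\<bar>h\<bar> * x) ^ n /\<^sub>R fact n) sums exp (\<bar>h\<bar> * x)" by (rule exp_converges)
        show "(\<Sum>n<K. (\<bar>h\<bar> * x) ^ n /\<^sub>R fact n) \<le> exp (\<bar>h\<bar> * x)"
          unfolding sums_unique[OF s] using x by (intro sum_le_suminf sums_summable[OF s]) auto
      qed (use x in auto)
      finally show "norm (\<Sum>n<K. (\<i> * of_real h) ^ n / fact n * (of_real (x ^ (j + n)) * iexp (t * x)))
         \<le> x ^ j * exp (\<bar>h\<bar> * x)" .
    qed
  qed measurable
  then show ?thesis
    unfolding sums_def using int0 by (subst (asm) Bochner_Integration.integral_sum) (auto simp del: of_real_power)
qed

text \<open>At frequency 0 the weighted Fourier transforms of both measures are their moments. Steps of length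
less than \<open>a\<close> carry the equality from 0 to any frequency, in the manner of an analytic continuation
along the real line; it is essential that each step transports the equality for all weights
\<open>x ^ j\<close> at once.\<close>
theorem moments_determine_measure:
  fixes M1 M2 :: "real measure"
  assumes M1: "prob_space M1" "sets M1 = sets borel" "AE x in M1. 0 \<le> x"
    and M2: "prob_space M2" "sets M2 = sets borel" "AE x in M2. 0 \<le> x"
    and a: "0 < a"
    and mom: "\<And>n. (\<integral>\<^sup>+x. ennreal (x ^ n) \<partial>M1) \<le> ennreal (fact n / a ^ n)"
    and eq: "\<And>n. (\<integral>\<^sup>+x. ennreal (x ^ n) \<partial>M1) = (\<integral>\<^sup>+x. ennreal (x ^ n) \<partial>M2)"
  shows "M1 = M2"
proof -
  note [measurable_cong] = M1(2) M2(2)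
  have mom2: "\<And>n. (\<integral>\<^sup>+x. ennreal (x ^ n) \<partial>M2) \<le> ennreal (fact n / a ^ n)"
    using mom eq by simp
  define P where "P t \<longleftrightarrow> (\<forall>j. (\<integral>x. of_real (x ^ j) * iexp (t * x) \<partial>M1) = (\<integral>x. of_real (x ^ j) * iexp (t * x) \<partial>M2))" for t
  have P0: "P 0"
  proof -
    have "(\<integral>x. x ^ j \<partial>M1) = (\<integral>x. x ^ j \<partial>M2)" for j
      using M1(3) M2(3) by (subst (1 2) integral_eq_nn_integral) (auto simp: eq)
    then show ?thesis by (auto simp: P_def simp del: of_real_power)
  qed
  have step: "P (t + h)" if "P t" "\<bar>h\<bar> < a" for t h
    unfolding P_def
  proof
    fix j
    from fourier_taylor_of_moments[OF M1(2,3) mom that(2), of j t] 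
      fourier_taylor_of_moments[OF M2(2,3) mom2 that(2), of j t] that(1)
    show "(\<integral>x. of_real (x ^ j) * iexp ((t + h) * x) \<partial>M1) = (\<integral>x. of_real (x ^ j) * iexp ((t + h) * x) \<partial>M2)"
      unfolding P_def by (auto dest: sums_unique2)
  qed
  have "P t" for t
  proof -
    obtain n :: nat where n: "\<bar>t\<bar> / a < real n" "n > 0"
      using reals_Archimedean2[of "\<bar>t\<bar> / a"] a by (metis divide_nonneg_pos abs_ge_zero of_nat_0_less_iff order_le_less_trans)
    have "P (real k * (t / real n))" for k
    proof (induction k)
      case (Suc k)
      have "P (real k * (t / real n) + t / real n)"
        using n a by (intro step Suc) (auto simp: field_simps abs_mult)
      then show ?case by (simp add: algebra_simps add_divide_distrib)
    qed (simp add: P0)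
    from this[of n] show ?thesis using n by simp
  qed
  then have "char M1 = char M2"
    unfolding char_def P_def by (intro ext) (metis (no_types, lifting) mult_1 of_real_1 power_0 Bochner_Integration.integral_cong)
  moreover have "real_distribution M1" "real_distribution M2"
    using M1 M2 by (auto simp: real_distribution_def real_distribution_axioms_def)
  ultimately show ?thesis by (intro Levy_uniqueness)
qed

section \<open>Moments of the right-hand side of the equation\<close>

text \<open>It allows the balance of \<open>c x \<mu>(dx)\<close> and \<open>R(x) dx\<close> to be read as an equality of two measures.\<close>
lemma exists_sum_measure:
  assumes [simp]: "sets B = sets A"
  shows "\<exists>C. sets C = sets A \<and> (\<forall>f\<in>borel_measurable A. (\<integral>\<^sup>+x. f x \<partial>C) = (\<integral>\<^sup>+x. f x \<partial>A) + (\<integral>\<^sup>+x. f x \<partial>B))"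
proof -
  have [simp]: "space B = space A" by (rule sets_eq_imp_space_eq) simp
  define C where "C = measure_of (space A) (sets A) (\<lambda>X. emeasure A X + emeasure B X)"
  have [simp]: "sets C = sets A" "space C = space A" by (auto simp: C_def)
  note [measurable_cong] = this(1) assms
  have em: "emeasure C X = emeasure A X + emeasure B X" if "X \<in> sets A" for X
    unfolding C_def
  proof (rule emeasure_measure_of_sigma)
    show "countably_additive (sets A) (\<lambda>X. emeasure A X + emeasure B X)"
    proof (rule countably_additiveI)
      fix X :: "nat \<Rightarrow> _" assume X: "range X \<subseteq> sets A" "disjoint_family X" "(\<Union>i. X i) \<in> sets A"
      then show "(\<Sum>i. emeasure A (X i) + emeasure B (X i)) = emeasure A (\<Union>i. X i) + emeasure B (\<Union>i. X i)"
        by (subst suminf_add[symmetric]) (auto simp: suminf_emeasure)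
    qed
  qed (use that in \<open>auto simp: positive_def sets.sigma_algebra_axioms\<close>)
  have "(\<integral>\<^sup>+x. f x \<partial>C) = (\<integral>\<^sup>+x. f x \<partial>A) + (\<integral>\<^sup>+x. f x \<partial>B)" if "f \<in> borel_measurable A" for f
    using that
  proof (induction rule: borel_measurable_induct)
    case (cong f g)
    then have "(\<integral>\<^sup>+x. f x \<partial>N) = (\<integral>\<^sup>+x. g x \<partial>N)" if "space N = space A" for N
      using that by (intro nn_integral_cong) auto
    from this[of A] this[of B] this[of C] cong show ?case by simp
  next
    case (set X) then show ?case by (simp add: em)
  next
    case (mult u c) 
    note [measurable] = mult(2)
    show ?case using mult(4) by (simp add: nn_integral_cmult distrib_left)
  next
    case (add u v)
    show ?case using add by (simp add: nn_integral_add add_ac)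
  next
    case (seq U)
    have m: "U i \<in> borel_measurable N" if "sets N = sets A" for N i
      using seq(1) that by (simp cong: measurable_cong_sets)
    have *: "(\<integral>\<^sup>+x. (SUP i. U i) x \<partial>N) = (SUP i. \<integral>\<^sup>+x. U i x \<partial>N)" if "sets N = sets A" for N
      using nn_integral_monotone_convergence_SUP[OF \<open>incseq U\<close> m[OF that]] by (simp add: image_comp)
    show ?case
      unfolding *[OF refl] *[OF assms] *[OF \<open>sets C = sets A\<close>] seq.IH
      using \<open>incseq U\<close>
      by (intro ennreal_SUP_add) (auto simp: incseq_def le_fun_def intro!: nn_integral_mono)
  qed
  then show ?thesis by (intro exI[of _ C]) simp
qed

lemma sigma_finite_subordinator_levy_measure:
  assumes "subordinator_levy_measure \<nu>"
  shows "sigma_finite_measure \<nu>"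
proof
  have [measurable_cong]: "sets \<nu> = sets borel" and sp: "space \<nu> = UNIV"
    using assms sets_eq_imp_space_eq[of \<nu> borel] by (auto simp: subordinator_levy_measure_def)
  have fin: "(\<integral>\<^sup>+x. ennreal (min 1 x) \<partial>\<nu>) < \<infinity>" and neg: "emeasure \<nu> {..0} = 0"
    using assms by (auto simp: subordinator_levy_measure_def)
  define A where "A = insert {..0::real} (range (\<lambda>n. {1 / real (Suc n)..}))"
  have "emeasure \<nu> {1 / real (Suc n)..} < \<infinity>" for n
  proof -
    have "ennreal (1 / Suc n) * emeasure \<nu> {1 / real (Suc n)..} = (\<integral>\<^sup>+x. ennreal (1 / Suc n) * indicator {1 / real (Suc n)..} x \<partial>\<nu>)"
      by (simp add: nn_integral_cmult_indicator)
    also have "\<dots> \<le> (\<integral>\<^sup>+x. ennreal (min 1 x) \<partial>\<nu>)"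
      by (intro nn_integral_mono) (auto simp: indicator_def intro!: ennreal_leI)
    finally show ?thesis
      using fin by (auto simp: ennreal_mult_less_top less_top[symmetric] top_unique ennreal_mult_eq_top_iff)
  qed
  moreover have "\<Union>A = UNIV"
  proof -
    have "x \<in> \<Union>A" for x :: real
    proof (cases "x \<le> 0")
      case False
      then obtain n where "1 / real (Suc n) < x" using nat_approx_posE[of x] by auto
      then show ?thesis by (auto simp: A_def intro!: bexI[of _ "{1 / real (Suc n)..}"] less_imp_le)
    qed (auto simp: A_def)
    then show ?thesis by auto
  qed
  ultimately show "\<exists>A. countable A \<and> A \<subseteq> sets \<nu> \<and> \<Union>A = space \<nu> \<and> (\<forall>a\<in>A. emeasure \<nu> a \<noteq> \<infinity>)"
    using neg by (intro exI[of _ A]) (auto simp: A_def sp less_top)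
qed

lemma nn_integral_indicator_less_eq_emeasure:
  fixes x :: real
  assumes "sets N = sets borel"
  shows "(\<integral>\<^sup>+y. indicator {p. fst p < snd p} (x, y) \<partial>N) = emeasure N {x<..}"
proof -
  have "(\<lambda>y. indicator {p. fst p < snd p} (x, y) :: ennreal) = indicator {x<..}"
    by (auto simp: indicator_def)
  then show ?thesis using assms by simp
qed

lemma borel_measurable_levy_tail[measurable]:
  assumes "subordinator_levy_measure \<nu>"
  shows "levy_tail \<nu> \<in> borel_measurable borel"
proof -
  have [measurable_cong]: "sets \<nu> = sets borel"
    using assms by (auto simp: subordinator_levy_measure_def)
  interpret sigma_finite_measure \<nu> by (rule sigma_finite_subordinator_levy_measure) fact
  have "levy_tail \<nu> = (\<lambda>x. \<integral>\<^sup>+s. indicator {p. fst p < snd p} (x, s) \<partial>\<nu>)"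
    unfolding levy_tail_def using assms
    by (subst nn_integral_indicator_less_eq_emeasure) (auto simp: subordinator_levy_measure_def)
  also have "\<dots> \<in> borel_measurable borel" by measurable
  finally show ?thesis .
qed

text \<open>For \<open>\<mu> = k(y) dy\<close> this is the right-hand side of the density equation. Allowing an arbitrary measure
makes it available for the law of the functional before that law is known to have a density.\<close>
definition density_rhs :: "real \<Rightarrow> real measure \<Rightarrow> real measure \<Rightarrow> real \<Rightarrow> ennreal" where
  "density_rhs q \<nu> \<mu> x =
     (\<integral>\<^sup>+y\<in>{x<..}. levy_tail \<nu> (ln (y / x)) \<partial>\<mu>) + ennreal q * emeasure \<mu> {x<..}"

lemma borel_measurable_density_rhs[measurable]:
  assumes \<nu>: "subordinator_levy_measure \<nu>" and \<mu>: "finite_measure \<mu>" "sets \<mu> = sets borel"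
  shows "density_rhs q \<nu> \<mu> \<in> borel_measurable borel"
proof -
  interpret finite_measure \<mu> by fact
  note [measurable] = borel_measurable_levy_tail[OF \<nu>] and [measurable_cong] = \<mu>(2)
  have "density_rhs q \<nu> \<mu> = (\<lambda>x. (\<integral>\<^sup>+y. levy_tail \<nu> (ln (y / x)) * indicator {p. fst p < snd p} (x, y) \<partial>\<mu>)
     + ennreal q * (\<integral>\<^sup>+y. indicator {p. fst p < snd p} (x, y) \<partial>\<mu>))"
    unfolding density_rhs_def nn_integral_indicator_less_eq_emeasure[OF \<mu>(2)]
    by (auto intro!: ext nn_integral_cong arg_cong2[where f="(+)"] simp: indicator_def)
  also have "\<dots> \<in> borel_measurable borel" by measurable
  finally show ?thesis .
qed

lemma nn_integral_power_interval:
  fixes a b :: real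
  assumes "0 \<le> a" "a \<le> b"
  shows "(\<integral>\<^sup>+x\<in>{a<..<b}. ennreal (x ^ n) \<partial>lborel) = ennreal ((b ^ Suc n - a ^ Suc n) / real (Suc n))"
proof -
  have "(\<integral>\<^sup>+x\<in>{a<..<b}. ennreal (x ^ n) \<partial>lborel) = (\<integral>\<^sup>+x. ennreal (x ^ n) * indicator {a..b} x \<partial>lborel)"
    by (rule nn_integral_cong_AE)
      (use AE_lborel_singleton[of a] AE_lborel_singleton[of b] in eventually_elim, auto simp: indicator_def)
  also have "\<dots> = ennreal (b ^ Suc n / Suc n - a ^ Suc n / Suc n)"
  proof (rule nn_integral_FTC_Icc)
    fix x assume "x \<in> {a..b}"
    show "((\<lambda>x. x ^ Suc n / real (Suc n)) has_field_derivative x ^ n) (at x)"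
      by (auto intro!: derivative_eq_intros simp del: power_Suc)
  qed (use assms in auto)
  finally show ?thesis by (simp only: diff_divide_distrib)
qed

text \<open>The computation that links the equation to the Laplace exponent. For \<open>0 < x < y\<close> the inequality
\<open>s > ln (y / x)\<close> means \<open>y exp(-s) < x\<close>, so after exchanging integrals the innermost one is that of
\<open>x ^ n\<close> over \<open>(y exp(-s), y)\<close>, which equals \<open>y ^ (n+1) (1 - exp(-(n+1) s)) / (n+1)\<close>.\<close>
lemma nn_integral_power_density_rhs:
  assumes \<nu>: "subordinator_levy_measure \<nu>" and \<mu>: "finite_measure \<mu>" "sets \<mu> = sets borel"
    and pos: "AE y in \<mu>. 0 \<le> y"
    and q: "0 \<le> q"
  shows "(\<integral>\<^sup>+x\<in>{0<..}. ennreal (x ^ n) * density_rhs q \<nu> \<mu> x \<partial>lborel)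
    = ennreal (1 / real (Suc n)) * ((\<integral>\<^sup>+s. ennreal (1 - exp (- real (Suc n) * s)) \<partial>\<nu>) + ennreal q) * (\<integral>\<^sup>+y. ennreal (y ^ Suc n) \<partial>\<mu>)"
proof -
  interpret finite_measure \<mu> by fact
  interpret nu: sigma_finite_measure \<nu> by (rule sigma_finite_subordinator_levy_measure) fact
  interpret P: pair_sigma_finite \<mu> lborel ..
  interpret Q: pair_sigma_finite \<nu> lborel ..
  note [measurable] = borel_measurable_levy_tail[OF \<nu>] borel_measurable_density_rhs[OF \<nu> \<mu>] and [measurable_cong] = \<mu>(2)
  have [measurable_cong]: "sets \<nu> = sets borel" and neg: "emeasure \<nu> {..0} = 0"
    using \<nu> by (auto simp: subordinator_levy_measure_def)
  have nupos: "AE s in \<nu>. 0 < s"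
    using neg by (intro AE_I[of _ _ "{..0}"]) auto
  let ?E = "\<integral>\<^sup>+s. ennreal (1 - exp (- real (Suc n) * s)) \<partial>\<nu>"
  have tail: "levy_tail \<nu> l = (\<integral>\<^sup>+s. indicator {l<..} s \<partial>\<nu>)" for l
    by (simp add: levy_tail_def)
  have emI: "emeasure \<mu> {x<..} = (\<integral>\<^sup>+y. indicator {x<..} y \<partial>\<mu>)" for x
    by simp
  have rhs: "density_rhs q \<nu> \<mu> x = (\<integral>\<^sup>+y. (levy_tail \<nu> (ln (y / x)) + ennreal q) * indicator {p. fst p < snd p} (x, y) \<partial>\<mu>)" for x
  proof -
    have "(\<integral>\<^sup>+y. (levy_tail \<nu> (ln (y / x)) + ennreal q) * indicator {p. fst p < snd p} (x, y) \<partial>\<mu>)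
       = (\<integral>\<^sup>+y. levy_tail \<nu> (ln (y / x)) * indicator {x<..} y + ennreal q * indicator {x<..} y \<partial>\<mu>)"
      by (intro nn_integral_cong) (auto simp: indicator_def)
    then show ?thesis
      unfolding density_rhs_def emI by (simp add: nn_integral_add nn_integral_cmult)
  qed
  have inner: "(\<integral>\<^sup>+x. ennreal (x ^ n) * levy_tail \<nu> (ln (y / x)) * indicator {0<..<y} x \<partial>lborel)
     = ennreal (1 / real (Suc n)) * ?E * ennreal (y ^ Suc n)" if y: "0 \<le> y" for y
  proof -
    have "(\<integral>\<^sup>+x. ennreal (x ^ n) * levy_tail \<nu> (ln (y / x)) * indicator {0<..<y} x \<partial>lborel)
      = (\<integral>\<^sup>+x. (\<integral>\<^sup>+s. ennreal (x ^ n) * indicator {p. y * exp (- snd p) < fst p} (x, s) * indicator {0<..<y} x \<partial>\<nu>) \<partial>lborel)"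
    proof (rule nn_integral_cong)
      fix x :: real
      show "ennreal (x ^ n) * levy_tail \<nu> (ln (y / x)) * indicator {0<..<y} x
        = (\<integral>\<^sup>+s. ennreal (x ^ n) * indicator {p. y * exp (- snd p) < fst p} (x, s) * indicator {0<..<y} x \<partial>\<nu>)"
      proof (cases "x \<in> {0<..<y}")
        case True
        have "(s > ln (y / x)) = (y * exp (- s) < x)" for s
        proof -
          have "(s > ln (y / x)) = (exp s > y / x)"
            using True by (metis exp_ln exp_less_cancel_iff divide_pos_pos greaterThanLessThan_iff order.strict_trans)
          then show ?thesis using True by (simp add: exp_minus field_simps)
        qed
        then show ?thesis using True unfolding tail
          by (subst nn_integral_cmult[symmetric]) (auto intro!: nn_integral_cong simp: indicator_def)
      qed auto
    qed
    also have "\<dots> = (\<integral>\<^sup>+s. (\<integral>\<^sup>+x. ennreal (x ^ n) * indicator {p. y * exp (- snd p) < fst p} (x, s) * indicator {0<..<y} x \<partial>lborel) \<partial>\<nu>)"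
      by (rule Q.Fubini') measurable
    also have "\<dots> = (\<integral>\<^sup>+s. ennreal (1 / real (Suc n)) * ennreal (y ^ Suc n) * ennreal (1 - exp (- real (Suc n) * s)) \<partial>\<nu>)"
    proof (rule nn_integral_cong_AE, use nupos in eventually_elim)
      fix s :: real assume s: "0 < s"
      have "(\<integral>\<^sup>+x. ennreal (x ^ n) * indicator {p. y * exp (- snd p) < fst p} (x, s) * indicator {0<..<y} x \<partial>lborel)
        = (\<integral>\<^sup>+x\<in>{y * exp (- s)<..<y}. ennreal (x ^ n) \<partial>lborel)"
        using order_le_less_trans[OF mult_nonneg_nonneg[OF y exp_ge_zero]]
        by (intro nn_integral_cong) (auto simp: indicator_def)
      also have "\<dots> = ennreal ((y ^ Suc n - (y * exp (- s)) ^ Suc n) / real (Suc n))"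
        using y s by (intro nn_integral_power_interval) (auto simp: mult_left_le)
      also have "(y * exp (- s)) ^ Suc n = y ^ Suc n * exp (- real (Suc n) * s)"
        by (simp only: power_mult_distrib exp_of_nat_mult[symmetric] mult_minus_left mult_minus_right)
      also have "(y ^ Suc n - y ^ Suc n * exp (- real (Suc n) * s)) / real (Suc n) = 1 / real (Suc n) * y ^ Suc n * (1 - exp (- real (Suc n) * s))"
        by (simp add: field_simps del: power_Suc)
      also have "ennreal \<dots> = ennreal (1 / real (Suc n)) * ennreal (y ^ Suc n) * ennreal (1 - exp (- real (Suc n) * s))"
      proof -
        have "0 \<le> 1 - exp (- real (Suc n) * s)" using s by (simp add: mult_le_0_iff)
        then show ?thesis
          using y by (simp only: ennreal_mult mult_nonneg_nonneg zero_le_power divide_nonneg_nonneg zero_le_one of_nat_0_le_iff)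
      qed
      finally show "(\<integral>\<^sup>+x. ennreal (x ^ n) * indicator {p. y * exp (- snd p) < fst p} (x, s) * indicator {0<..<y} x \<partial>lborel)
         = ennreal (1 / real (Suc n)) * ennreal (y ^ Suc n) * ennreal (1 - exp (- real (Suc n) * s))" .
    qed
    also have "\<dots> = ennreal (1 / real (Suc n)) * ?E * ennreal (y ^ Suc n)"
      by (subst nn_integral_cmult) (simp_all add: mult_ac del: power_Suc)
    finally show ?thesis .
  qed
  have inner_q: "(\<integral>\<^sup>+x. ennreal (x ^ n) * indicator {0<..<y} x \<partial>lborel) = ennreal (1 / real (Suc n)) * ennreal (y ^ Suc n)"
    if y: "0 \<le> y" for y
    using nn_integral_power_interval[of 0 y n] y by (simp add: ennreal_mult[symmetric])
  have "(\<integral>\<^sup>+x\<in>{0<..}. ennreal (x ^ n) * density_rhs q \<nu> \<mu> x \<partial>lborel)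
    = (\<integral>\<^sup>+x. (\<integral>\<^sup>+y. ennreal (x ^ n) * (levy_tail \<nu> (ln (y / x)) + ennreal q) * indicator {p. fst p < snd p} (x, y) * indicator {0<..} x \<partial>\<mu>) \<partial>lborel)"
    unfolding rhs
    by (intro nn_integral_cong, subst nn_integral_cmult[symmetric], measurable, subst nn_integral_multc[symmetric], measurable)
      (simp add: mult_ac)
  also have "\<dots> = (\<integral>\<^sup>+y. (\<integral>\<^sup>+x. ennreal (x ^ n) * (levy_tail \<nu> (ln (y / x)) + ennreal q) * indicator {p. fst p < snd p} (x, y) * indicator {0<..} x \<partial>lborel) \<partial>\<mu>)"
    by (rule P.Fubini') measurable
  also have "\<dots> = (\<integral>\<^sup>+y. (ennreal (1 / real (Suc n)) * (?E + ennreal q)) * ennreal (y ^ Suc n) \<partial>\<mu>)"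
  proof (rule nn_integral_cong_AE, use pos in eventually_elim)
    fix y :: real assume y: "0 \<le> y"
    have "(\<integral>\<^sup>+x. ennreal (x ^ n) * (levy_tail \<nu> (ln (y / x)) + ennreal q) * indicator {p. fst p < snd p} (x, y) * indicator {0<..} x \<partial>lborel)
      = (\<integral>\<^sup>+x. ennreal (x ^ n) * levy_tail \<nu> (ln (y / x)) * indicator {0<..<y} x + ennreal q * (ennreal (x ^ n) * indicator {0<..<y} x) \<partial>lborel)"
      by (intro nn_integral_cong) (auto simp: indicator_def distrib_left mult_ac)
    also have "\<dots> = ennreal (1 / real (Suc n)) * ?E * ennreal (y ^ Suc n) + ennreal q * (ennreal (1 / real (Suc n)) * ennreal (y ^ Suc n))"
      by (subst nn_integral_add, measurable, subst nn_integral_cmult, measurable) (simp only: inner[OF y] inner_q[OF y])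
    finally show "(\<integral>\<^sup>+x. ennreal (x ^ n) * (levy_tail \<nu> (ln (y / x)) + ennreal q) * indicator {p. fst p < snd p} (x, y) * indicator {0<..} x \<partial>lborel)
      = (ennreal (1 / real (Suc n)) * (?E + ennreal q)) * ennreal (y ^ Suc n)"
      by (simp add: distrib_left distrib_right mult_ac del: power_Suc)
  qed
  also have "\<dots> = ennreal (1 / real (Suc n)) * (?E + ennreal q) * (\<integral>\<^sup>+y. ennreal (y ^ Suc n) \<partial>\<mu>)"
    by (rule nn_integral_cmult) measurable
  finally show ?thesis .
qed

section \<open>Finiteness of the right-hand side at every point\<close>

lemma levy_tail_antimono: "a \<le> b \<Longrightarrow> sets \<nu> = sets borel \<Longrightarrow> levy_tail \<nu> b \<le> levy_tail \<nu> a"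
  unfolding levy_tail_def by (intro emeasure_mono) auto

lemma nn_integral_min_levy_measure_finite:
  assumes \<nu>: "subordinator_levy_measure \<nu>" and a: "0 \<le> a" and b: "0 \<le> b"
  shows "(\<integral>\<^sup>+s. ennreal (min a (s * b)) \<partial>\<nu>) < \<infinity>"
proof -
  have [measurable_cong]: "sets \<nu> = sets borel" and fin: "(\<integral>\<^sup>+x. ennreal (min 1 x) \<partial>\<nu>) < \<infinity>"
    using \<nu> by (auto simp: subordinator_levy_measure_def)
  have "(\<integral>\<^sup>+s. ennreal (min a (s * b)) \<partial>\<nu>) \<le> (\<integral>\<^sup>+s. ennreal (max a b) * ennreal (min 1 s) \<partial>\<nu>)"
  proof (rule nn_integral_mono)
    fix s :: real
    show "ennreal (min a (s * b)) \<le> ennreal (max a b) * ennreal (min 1 s)"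
    proof (cases "0 \<le> s")
      case True
      have "min a (s * b) \<le> max a b * min 1 s"
      proof (cases "s \<le> 1")
        case s1: True
        have "min a (s * b) \<le> b * s" by (simp add: mult.commute)
        also have "\<dots> \<le> max a b * min 1 s" using True s1 by (auto intro!: mult_right_mono)
        finally show ?thesis .
      qed auto
      then show ?thesis using True a by (simp add: ennreal_mult[symmetric] ennreal_leI)
    next
      case False
      then have "s * b \<le> 0" using b by (auto simp: mult_le_0_iff)
      then have "min a (s * b) \<le> 0" by auto
      then show ?thesis by (simp add: ennreal_neg)
    qed
  qed
  also have "\<dots> = ennreal (max a b) * (\<integral>\<^sup>+s. ennreal (min 1 s) \<partial>\<nu>)"
    by (rule nn_integral_cmult) measurable
  also have "\<dots> < \<infinity>" using fin by (simp add: ennreal_mult_less_top)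
  finally show ?thesis .
qed

lemma AE_levy_measure_pos:
  assumes \<nu>: "subordinator_levy_measure \<nu>"
  shows "AE s in \<nu>. 0 < s"
  using \<nu> unfolding subordinator_levy_measure_def by (intro AE_I[of _ _ "{..0}"]) auto

text \<open>Writing the tail as an integral against \<open>\<nu>\<close> reduces the integral of a singular decreasing kernel
against \<open>\<mu>\<close> to the masses that \<open>\<mu>\<close> gives to intervals starting at \<open>z\<close>.\<close>
lemma nn_integral_levy_tail_scaled:
  assumes \<nu>: "subordinator_levy_measure \<nu>" and b: "0 < b" and \<mu>: "finite_measure \<mu>" "sets \<mu> = sets borel"
  shows "(\<integral>\<^sup>+y\<in>{z<..<z + d}. levy_tail \<nu> ((y - z) / b) \<partial>\<mu>) = (\<integral>\<^sup>+s. emeasure \<mu> {z<..<z + min d (s * b)} \<partial>\<nu>)"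
proof -
  interpret nu: sigma_finite_measure \<nu> by (rule sigma_finite_subordinator_levy_measure) fact
  interpret finite_measure \<mu> by fact
  interpret P: pair_sigma_finite \<nu> \<mu> ..
  have [measurable_cong]: "sets \<nu> = sets borel" "sets \<mu> = sets borel"
    using \<nu> \<mu> by (auto simp: subordinator_levy_measure_def)
  have "(\<integral>\<^sup>+y\<in>{z<..<z + d}. levy_tail \<nu> ((y - z) / b) \<partial>\<mu>)
     = (\<integral>\<^sup>+y. (\<integral>\<^sup>+s. indicator {z<..<z + d} y * indicator {p. fst p < z + snd p * b} (y, s) \<partial>\<nu>) \<partial>\<mu>)"
  proof (rule nn_integral_cong)
    fix y
    have "levy_tail \<nu> ((y - z) / b) = (\<integral>\<^sup>+s. indicator {p. fst p < z + snd p * b} (y, s) \<partial>\<nu>)"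
    proof -
      have "(\<lambda>s. indicator {p. fst p < z + snd p * b} (y, s) :: ennreal) = indicator {(y - z) / b<..}"
        using b by (auto simp: indicator_def fun_eq_iff field_simps)
      then show ?thesis unfolding levy_tail_def by simp
    qed
    then show "levy_tail \<nu> ((y - z) / b) * indicator {z<..<z + d} y
      = (\<integral>\<^sup>+s. indicator {z<..<z + d} y * indicator {p. fst p < z + snd p * b} (y, s) \<partial>\<nu>)"
      by (subst nn_integral_cmult) (auto simp: mult.commute)
  qed
  also have "\<dots> = (\<integral>\<^sup>+s. (\<integral>\<^sup>+y. indicator {z<..<z + d} y * indicator {p. fst p < z + snd p * b} (y, s) \<partial>\<mu>) \<partial>\<nu>)"
    by (rule P.Fubini') measurable
  also have "\<dots> = (\<integral>\<^sup>+s. (\<integral>\<^sup>+y. indicator {z<..<z + min d (s * b)} y \<partial>\<mu>) \<partial>\<nu>)"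
    by (intro nn_integral_cong) (auto simp: indicator_def)
  also have "\<dots> = (\<integral>\<^sup>+s. emeasure \<mu> {z<..<z + min d (s * b)} \<partial>\<nu>)"
    by (intro nn_integral_cong nn_integral_indicator) simp
  finally show ?thesis .
qed

lemma diff_div_le_ln_div:
  fixes y z b :: real
  assumes "0 < z" "z \<le> y" "y \<le> b"
  shows "(y - z) / b \<le> ln (y / z)"
proof -
  have "(y - z) / b \<le> (y - z) / y"
    using assms by (intro divide_left_mono) auto
  also have "\<dots> = 1 - z / y" using assms by (simp add: field_simps)
  also have "\<dots> \<le> - ln (z / y)" using ln_le_minus_one[of "z / y"] assms by simp
  also have "\<dots> = ln (y / z)" using assms by (simp add: ln_div)
  finally show ?thesis .
qed

text \<open>To the right of \<open>z\<close> and below \<open>b\<close> the kernel is dominated by a function of the difference \<open>y - z\<close>,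
so that near the diagonal the right-hand side is controlled by a convolution; the part at distance at
least \<open>d\<close> is controlled by a constant.\<close>
lemma density_rhs_le:
  assumes \<nu>: "subordinator_levy_measure \<nu>" and \<mu>: "prob_space \<mu>" "sets \<mu> = sets borel"
    and z: "0 < z" "0 < d" "z + d \<le> b"
  shows "density_rhs q \<nu> \<mu> z \<le> (\<integral>\<^sup>+y\<in>{z<..<z + d}. levy_tail \<nu> ((y - z) / b) \<partial>\<mu>) + (levy_tail \<nu> (d / b) + ennreal q)"
proof -
  interpret prob_space \<mu> by fact
  have [measurable_cong]: "sets \<mu> = sets borel" by fact
  have sn: "sets \<nu> = sets borel" using \<nu> by (auto simp: subordinator_levy_measure_def)
  note [measurable] = borel_measurable_levy_tail[OF \<nu>]
  have "(\<integral>\<^sup>+y\<in>{z<..}. levy_tail \<nu> (ln (y / z)) \<partial>\<mu>)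
    \<le> (\<integral>\<^sup>+y. levy_tail \<nu> ((y - z) / b) * indicator {z<..<z + d} y + levy_tail \<nu> (d / b) \<partial>\<mu>)"
  proof (rule nn_integral_mono)
    fix y
    show "levy_tail \<nu> (ln (y / z)) * indicator {z<..} y \<le> levy_tail \<nu> ((y - z) / b) * indicator {z<..<z + d} y + levy_tail \<nu> (d / b)"
    proof (cases "y < z + d")
      case True
      then show ?thesis
        using levy_tail_antimono[OF diff_div_le_ln_div sn, of z y b] z
        by (auto simp: indicator_def add_increasing2)
    next
      case False
      have "d / b \<le> ln ((z + d) / z)" using diff_div_le_ln_div[of z "z + d" b] z by simp
      also have "\<dots> \<le> ln (y / z)" using False z by (simp add: divide_right_mono)
      finally show ?thesis
        using False z levy_tail_antimono[OF _ sn, of "d / b" "ln (y / z)"] by (auto simp: indicator_def)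
    qed
  qed
  also have "\<dots> = (\<integral>\<^sup>+y\<in>{z<..<z + d}. levy_tail \<nu> ((y - z) / b) \<partial>\<mu>) + levy_tail \<nu> (d / b)"
    by (subst nn_integral_add) (auto simp: emeasure_space_1)
  moreover have "ennreal q * emeasure \<mu> {z<..} \<le> ennreal q"
    using mult_left_mono[OF emeasure_le_1, of "ennreal q"] by simp
  ultimately show ?thesis
    unfolding density_rhs_def by (subst add.assoc[symmetric]) (intro add_mono; simp)
qed

lemma nn_integral_levy_tail_interval:
  assumes \<nu>: "subordinator_levy_measure \<nu>" and b: "0 < b" and d: "0 \<le> d"
  shows "(\<integral>\<^sup>+w\<in>{0<..<d}. levy_tail \<nu> (w / b) \<partial>lborel) = (\<integral>\<^sup>+s. ennreal (min d (s * b)) \<partial>\<nu>)"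
proof -
  interpret nu: sigma_finite_measure \<nu> by (rule sigma_finite_subordinator_levy_measure) fact
  \<comment> \<open>Lebesgue measure cut off to \<open>(0, d)\<close>, to have a finite measure\<close>
  define U where "U = density lborel (indicator {0<..<d} :: real \<Rightarrow> ennreal)"
  have U: "finite_measure U" "sets U = sets borel"
    using d by (auto simp: U_def emeasure_density emeasure_lborel_Ioo intro!: finite_measureI)
  note [measurable] = borel_measurable_levy_tail[OF \<nu>]
  have "(\<integral>\<^sup>+w\<in>{0<..<d}. levy_tail \<nu> (w / b) \<partial>lborel) = (\<integral>\<^sup>+w\<in>{0<..<0 + d}. levy_tail \<nu> ((w - 0) / b) \<partial>U)"
    unfolding U_def by (subst nn_integral_density) (auto intro!: nn_integral_cong simp: indicator_def)
  also have "\<dots> = (\<integral>\<^sup>+s. emeasure U {0<..<0 + min d (s * b)} \<partial>\<nu>)"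
    by (rule nn_integral_levy_tail_scaled) fact+
  also have "\<dots> = (\<integral>\<^sup>+s. ennreal (min d (s * b)) \<partial>\<nu>)"
  proof (rule nn_integral_cong_AE, use AE_levy_measure_pos[OF \<nu>] in eventually_elim)
    fix s :: real assume s: "0 < s"
    have "emeasure U {0<..<0 + min d (s * b)} = (\<integral>\<^sup>+x. indicator {0<..<min d (s * b)} x \<partial>lborel)"
    proof -
      have "(\<lambda>x. indicator {0<..<d} x * indicator {0<..<0 + min d (s * b)} x :: ennreal) = indicator {0<..<min d (s * b)}"
        by (auto simp: indicator_def)
      then show ?thesis unfolding U_def by (subst emeasure_density) auto
    qed
    also have "\<dots> = ennreal (min d (s * b))" using s b d by (simp add: emeasure_lborel_Ioo)
    finally show "emeasure U {0<..<0 + min d (s * b)} = ennreal (min d (s * b))" .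
  qed
  finally show ?thesis .
qed

lemma nn_integral_min_levy_measure_tendsto_0:
  assumes \<nu>: "subordinator_levy_measure \<nu>" and b: "0 < b"
  shows "(\<lambda>n. \<integral>\<^sup>+s. ennreal (min (1 / real (Suc n)) (s * b)) \<partial>\<nu>) \<longlonglongrightarrow> 0"
proof -
  have [measurable_cong]: "sets \<nu> = sets borel" using \<nu> by (auto simp: subordinator_levy_measure_def)
  have "(\<lambda>n. \<integral>\<^sup>+s. ennreal (min (1 / real (Suc n)) (s * b)) \<partial>\<nu>) \<longlonglongrightarrow> (\<integral>\<^sup>+s. 0 \<partial>\<nu>)"
  proof (rule nn_integral_dominated_convergence[where w="\<lambda>s. ennreal (min 1 (s * b))"])
    show "(\<integral>\<^sup>+s. ennreal (min 1 (s * b)) \<partial>\<nu>) < \<infinity>"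
      using nn_integral_min_levy_measure_finite[OF \<nu>, of 1 b] b by simp
    show "AE s in \<nu>. ennreal (min (1 / real (Suc n)) (s * b)) \<le> ennreal (min 1 (s * b))" for n
      by (intro AE_I2 ennreal_leI) (auto simp: min_le_iff_disj le_divide_eq)
    show "AE s in \<nu>. (\<lambda>n. ennreal (min (1 / real (Suc n)) (s * b))) \<longlonglongrightarrow> 0"
      using AE_levy_measure_pos[OF \<nu>]
    proof eventually_elim
      fix s :: real assume s: "0 < s"
      have "(\<lambda>n. min (1 / real (Suc n)) (s * b)) \<longlonglongrightarrow> min 0 (s * b)"
        by (intro tendsto_min tendsto_const) (use LIMSEQ_inverse_real_of_nat in \<open>simp add: inverse_eq_divide\<close>)
      then have "(\<lambda>n. min (1 / real (Suc n)) (s * b)) \<longlonglongrightarrow> 0" using s b by (simp add: min_def)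
      then show "(\<lambda>n. ennreal (min (1 / real (Suc n)) (s * b))) \<longlonglongrightarrow> 0"
        using tendsto_ennrealI by fastforce
    qed
  qed auto
  then show ?thesis by simp
qed

text \<open>Averaging over a window of length \<open>h\<close> commutes with the convolution, so an inequality between a
density and its convolution passes to the masses of windows of length \<open>h\<close>. Unlike the density these
masses are known to be bounded (by 1), which is what the absorption argument starts from.\<close>
lemma nn_integral_window_density_rhs_le:
  assumes \<nu>: "subordinator_levy_measure \<nu>" 
    and k[measurable]: "k \<in> borel_measurable borel" and \<mu>: "prob_space \<mu>" "\<mu> = density lborel k"
    and z: "0 < z" "0 < h" "0 < d" "z + h + d \<le> b"
  shows "(\<integral>\<^sup>+u\<in>{z<..z + h}. density_rhs q \<nu> \<mu> u \<partial>lborel)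
    \<le> (\<integral>\<^sup>+w\<in>{0<..<d}. (levy_tail \<nu> (w / b) * emeasure \<mu> {z + w<..z + w + h}) \<partial>lborel)
       + ennreal h * (levy_tail \<nu> (d / b) + ennreal q)"
proof -
  interpret prob_space \<mu> by fact
  have sm[measurable_cong]: "sets \<mu> = sets borel" by (simp add: \<mu>)
  note [measurable] = borel_measurable_levy_tail[OF \<nu>] borel_measurable_density_rhs[OF \<nu> finite_measure_axioms sm]
  let ?t = "\<lambda>w. levy_tail \<nu> (w / b)"
  have conv: "(\<integral>\<^sup>+y\<in>{u<..<u + d}. ?t (y - u) \<partial>\<mu>) = (\<integral>\<^sup>+w\<in>{0<..<d}. (?t w * k (u + w)) \<partial>lborel)" for u
  proof -
    have "(\<integral>\<^sup>+y\<in>{u<..<u + d}. ?t (y - u) \<partial>\<mu>) = (\<integral>\<^sup>+y. k y * (?t (y - u) * indicator {u<..<u + d} y) \<partial>lborel)"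
      unfolding \<mu> by (rule nn_integral_density) measurable
    also have "\<dots> = (\<integral>\<^sup>+w. k (u + 1 * w) * (?t (u + 1 * w - u) * indicator {u<..<u + d} (u + 1 * w)) \<partial>lborel)"
      by (subst nn_integral_real_affine[where c=1 and t=u]) (simp_all)
    also have "\<dots> = (\<integral>\<^sup>+w\<in>{0<..<d}. (?t w * k (u + w)) \<partial>lborel)"
      by (intro nn_integral_cong) (auto simp: indicator_def mult_ac)
    finally show ?thesis .
  qed
  have "(\<integral>\<^sup>+u\<in>{z<..z + h}. density_rhs q \<nu> \<mu> u \<partial>lborel)
    \<le> (\<integral>\<^sup>+u. (\<integral>\<^sup>+w. ?t w * indicator {0<..<d} w * (k (u + w) * indicator {z<..z + h} u) \<partial>lborel)
         + (?t d + ennreal q) * indicator {z<..z + h} u \<partial>lborel)"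
  proof (rule nn_integral_mono)
    fix u
    show "density_rhs q \<nu> \<mu> u * indicator {z<..z + h} u
      \<le> (\<integral>\<^sup>+w. ?t w * indicator {0<..<d} w * (k (u + w) * indicator {z<..z + h} u) \<partial>lborel)
         + (?t d + ennreal q) * indicator {z<..z + h} u"
    proof (cases "u \<in> {z<..z + h}")
      case True
      then show ?thesis
        using density_rhs_le[OF \<nu> \<mu>(1) sm, of u d b q, unfolded conv] z by (simp add: mult_ac)
    qed simp
  qed
  also have "\<dots> = (\<integral>\<^sup>+u. (\<integral>\<^sup>+w. ?t w * indicator {0<..<d} w * (k (u + w) * indicator {z<..z + h} u) \<partial>lborel) \<partial>lborel)
      + (?t d + ennreal q) * ennreal h"
    using z by (subst nn_integral_add) (auto simp: nn_integral_cmult)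
  also have "(\<integral>\<^sup>+u. (\<integral>\<^sup>+w. ?t w * indicator {0<..<d} w * (k (u + w) * indicator {z<..z + h} u) \<partial>lborel) \<partial>lborel)
     = (\<integral>\<^sup>+w. (\<integral>\<^sup>+u. ?t w * indicator {0<..<d} w * (k (u + w) * indicator {z<..z + h} u) \<partial>lborel) \<partial>lborel)"
    by (rule lborel_pair.Fubini') measurable
  also have "\<dots> = (\<integral>\<^sup>+w\<in>{0<..<d}. (?t w * emeasure \<mu> {z + w<..z + w + h}) \<partial>lborel)"
  proof (rule nn_integral_cong)
    fix w
    have "emeasure \<mu> {z + w<..z + w + h} = (\<integral>\<^sup>+y. k y * indicator {z + w<..z + w + h} y \<partial>lborel)"
      unfolding \<mu> by (rule emeasure_density) auto
    also have "\<dots> = (\<integral>\<^sup>+u. k (w + 1 * u) * indicator {z + w<..z + w + h} (w + 1 * u) \<partial>lborel)"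
      by (subst nn_integral_real_affine[where c=1 and t=w]) (simp_all)
    also have "\<dots> = (\<integral>\<^sup>+u. k (u + w) * indicator {z<..z + h} u \<partial>lborel)"
      by (intro nn_integral_cong) (auto simp: indicator_def add_ac)
    finally show "(\<integral>\<^sup>+u. ?t w * indicator {0<..<d} w * (k (u + w) * indicator {z<..z + h} u) \<partial>lborel)
      = ?t w * emeasure \<mu> {z + w<..z + w + h} * indicator {0<..<d} w"
      by (subst nn_integral_cmult) (auto simp: mult_ac)
  qed
  finally show ?thesis by (simp add: mult.commute)
qed

text \<open>Absorption. Let \<open>L z\<close> be the mass of the window \<open>(z, z + h]\<close> and \<open>\<Phi>\<close> the supremum of
\<open>(x + d1 - z) * L z\<close> for \<open>z\<close> in \<open>[x, x + d1)\<close>, which is at most \<open>d1\<close>. The estimate of \<open>L z\<close> by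
windows to its right loses room at the right end of the interval. Choosing for each \<open>z\<close> the
cut-off \<open>d\<close> as half of the distance from \<open>z\<close> to that end costs a factor 2 in the weight, which the
small mass of the kernel near the diagonal compensates. The far part is at most a multiple of \<open>h\<close>,
because \<open>d\<close> times the kernel at \<open>d\<close> is bounded by the integral of the decreasing kernel up to \<open>d\<close>.
Hence \<open>\<Phi> \<le> \<Phi> / 2 + h K\<close> with \<open>K\<close> independent of \<open>h\<close>, and the finiteness of \<open>\<Phi>\<close> allows \<open>\<Phi> / 2\<close> to be absorbed.\<close>
lemma window_mass_bounded_by_length:
  assumes \<nu>: "subordinator_levy_measure \<nu>" and q: "0 \<le> q"
    and k[measurable]: "k \<in> borel_measurable borel" and \<mu>: "prob_space \<mu>" "\<mu> = density lborel k"
    and x: "0 < x" "x < b"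
    and le: "AE u in lborel. x < u \<longrightarrow> u < b \<longrightarrow> k u \<le> ennreal C * density_rhs q \<nu> \<mu> u"
    and C: "0 < C"
  shows "\<exists>B h0. 0 < h0 \<and> (\<forall>h. 0 < h \<and> h \<le> h0 \<longrightarrow> emeasure \<mu> {x<..x + h} \<le> ennreal (B * h))"
proof -
  interpret prob_space \<mu> by fact
  have sm[measurable_cong]: "sets \<mu> = sets borel" by (simp add: \<mu>)
  have sn: "sets \<nu> = sets borel" using \<nu> by (auto simp: subordinator_levy_measure_def)
  note [measurable] = borel_measurable_levy_tail[OF \<nu>] borel_measurable_density_rhs[OF \<nu> finite_measure_axioms sm]
  have b: "0 < b" using x by simp
  define t where "t w = levy_tail \<nu> (w / b)" for w
  have [measurable]: "t \<in> borel_measurable borel" unfolding t_def by measurable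
  define P where "P d = (\<integral>\<^sup>+w\<in>{0<..<d}. t w \<partial>lborel)" for d
  have P_mono: "P d \<le> P d'" if "d \<le> d'" for d d'
    unfolding P_def using that by (intro nn_integral_mono) (auto simp: indicator_def)
  have t_le: "ennreal d * t d \<le> P d" if "0 < d" for d
  proof -
    have "ennreal d * t d = (\<integral>\<^sup>+w\<in>{0<..<d}. t d \<partial>lborel)"
      using that by (simp add: nn_integral_cmult mult.commute)
    also have "\<dots> \<le> P d"
      unfolding P_def t_def using b sn
      by (intro nn_integral_mono) (auto simp: indicator_def divide_right_mono intro!: levy_tail_antimono)
    finally show ?thesis .
  qed
  obtain d0 where d0: "0 < d0" "ennreal C * (2 * P d0) \<le> 1 / 2"
  proof -
    have "(\<lambda>n. ennreal C * (2 * P (1 / real (Suc n)))) \<longlonglongrightarrow> ennreal C * (2 * 0)"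
      unfolding P_def t_def using nn_integral_min_levy_measure_tendsto_0[OF \<nu> b]
      by (intro ennreal_tendsto_cmult) (simp_all add: nn_integral_levy_tail_interval[OF \<nu> b])
    then have "eventually (\<lambda>n. ennreal C * (2 * P (1 / real (Suc n))) < 1 / 2) sequentially"
      by (rule order_tendstoD) (simp add: ennreal_zero_less_divide)
    then obtain n where "ennreal C * (2 * P (1 / real (Suc n))) < 1 / 2"
      by (auto simp: eventually_sequentially)
    then show ?thesis by (intro that[of "1 / real (Suc n)"]) auto
  qed
  define d1 where "d1 = min (2 * d0) ((b - x) / 2)"
  define h0 where "h0 = (b - x) / 2"
  have d1: "0 < d1" "d1 \<le> 2 * d0" "0 < h0" "x + d1 + h0 \<le> b"
    using d0 x by (auto simp: d1_def h0_def min_def field_simps)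
  \<comment> \<open>\<open>1 / 2\<close> bounds \<open>C * 2 * P d0\<close>, which majorises the tail term; \<open>C * d1 * q\<close> comes from the killing term\<close>
  define K where "K = 1 / 2 + C * d1 * q"
  have K: "0 \<le> K" using C d1 q by (simp add: K_def)
  have window: "emeasure \<mu> {x<..x + h} \<le> ennreal (2 * K / d1 * h)" if h: "0 < h" "h \<le> h0" for h
  proof -
    let ?L = "\<lambda>z. emeasure \<mu> {z<..z + h}"
    define \<Phi> where "\<Phi> = (SUP z\<in>{x..<x + d1}. ennreal (x + d1 - z) * ?L z)"
    have \<Phi>_ge: "ennreal (x + d1 - z) * ?L z \<le> \<Phi>" if "z \<in> {x..<x + d1}" for z
      unfolding \<Phi>_def by (rule SUP_upper) fact
    have "\<Phi> \<le> ennreal d1"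
      unfolding \<Phi>_def
    proof (rule SUP_least)
      fix z assume "z \<in> {x..<x + d1}"
      then have "ennreal (x + d1 - z) * ?L z \<le> ennreal d1 * 1"
        by (intro mult_mono emeasure_le_1 ennreal_leI) auto
      then show "ennreal (x + d1 - z) * ?L z \<le> ennreal d1" by simp
    qed
    then have \<Phi>_fin: "\<Phi> < \<infinity>" by (simp add: le_less_trans)
    have "\<Phi> \<le> \<Phi> / 2 + ennreal (h * K)"
      unfolding \<Phi>_def
    proof (rule SUP_least, fold \<Phi>_def)
      fix z assume z: "z \<in> {x..<x + d1}"
      \<comment> \<open>half of the room left to the right of \<open>z\<close>: every \<open>z + w\<close> with \<open>w < d\<close> keeps at least half of the weight of \<open>z\<close>\<close>
      define d where "d = (x + d1 - z) / 2"
      have d: "0 < d" "d \<le> d0" "z + h + d \<le> b" "x + d1 - z = 2 * d" "2 * d \<le> d1"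
        using z d1 h by (auto simp: d_def field_simps)
      have "?L z = (\<integral>\<^sup>+u\<in>{z<..z + h}. k u \<partial>lborel)"
        unfolding \<mu> by (rule emeasure_density) auto
      also have "\<dots> \<le> (\<integral>\<^sup>+u. ennreal C * (density_rhs q \<nu> \<mu> u * indicator {z<..z + h} u) \<partial>lborel)"
        by (rule nn_integral_mono_AE, use le in eventually_elim) (use z d in \<open>auto simp: indicator_def\<close>)
      also have "\<dots> = ennreal C * (\<integral>\<^sup>+u\<in>{z<..z + h}. density_rhs q \<nu> \<mu> u \<partial>lborel)"
        by (rule nn_integral_cmult) measurable
      also have "\<dots> \<le> ennreal C * ((\<integral>\<^sup>+w\<in>{0<..<d}. (t w * ?L (z + w)) \<partial>lborel) + ennreal h * (t d + ennreal q))"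
        unfolding t_def using z x d h
        by (intro mult_left_mono nn_integral_window_density_rhs_le[OF \<nu> k \<mu>]) auto
      finally have "ennreal (2 * d) * ?L z \<le> ennreal (2 * d) * (ennreal C * ((\<integral>\<^sup>+w\<in>{0<..<d}. (t w * ?L (z + w)) \<partial>lborel) + ennreal h * (t d + ennreal q)))"
        by (intro mult_left_mono) auto
      also have "\<dots> = ennreal C * ((\<integral>\<^sup>+w. ennreal (2 * d) * ((t w * ?L (z + w)) * indicator {0<..<d} w) \<partial>lborel)
           + ennreal h * (2 * (ennreal d * t d) + ennreal (2 * d) * ennreal q))"
      proof -
        have m: "(\<lambda>w. ?L (z + w)) \<in> borel_measurable borel"
        proof -
          have "?L (z + w) = (\<integral>\<^sup>+y. indicator {p. z + fst p < snd p \<and> snd p \<le> z + fst p + h} (w, y) \<partial>\<mu>)" for w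
          proof -
            have "(\<lambda>y. indicator {p. z + fst p < snd p \<and> snd p \<le> z + fst p + h} (w, y) :: ennreal) = indicator {z + w<..z + w + h}"
              by (auto simp: indicator_def)
            then show ?thesis by simp
          qed
          then have "(\<lambda>w. ?L (z + w)) = (\<lambda>w. \<integral>\<^sup>+y. indicator {p. z + fst p < snd p \<and> snd p \<le> z + fst p + h} (w, y) \<partial>\<mu>)"
            by (rule ext)
          also have "\<dots> \<in> borel_measurable borel" by measurable
          finally show ?thesis .
        qed
        show ?thesis
          using m d by (subst nn_integral_cmult) (auto simp: distrib_left ennreal_mult mult_ac)
      qed
      finally have bound: "ennreal (2 * d) * ?L z \<le> ennreal C * ((\<integral>\<^sup>+w. ennreal (2 * d) * ((t w * ?L (z + w)) * indicator {0<..<d} w) \<partial>lborel)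
           + ennreal h * (2 * (ennreal d * t d) + ennreal (2 * d) * ennreal q))" .
      have "(\<integral>\<^sup>+w. ennreal (2 * d) * ((t w * ?L (z + w)) * indicator {0<..<d} w) \<partial>lborel)
          \<le> (\<integral>\<^sup>+w. 2 * \<Phi> * (t w * indicator {0<..<d} w) \<partial>lborel)"
      proof (rule nn_integral_mono)
        fix w
        show "ennreal (2 * d) * ((t w * ?L (z + w)) * indicator {0<..<d} w) \<le> 2 * \<Phi> * (t w * indicator {0<..<d} w)"
        proof (cases "w \<in> {0<..<d}")
          case True
          have "ennreal (2 * d) * ?L (z + w) \<le> ennreal (2 * (x + d1 - (z + w))) * ?L (z + w)"
            using True d by (intro mult_right_mono ennreal_leI) auto
          also have "\<dots> = 2 * (ennreal (x + d1 - (z + w)) * ?L (z + w))"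
            using True d by (subst ennreal_mult) (auto simp: mult.assoc)
          also have "\<dots> \<le> 2 * \<Phi>" using True z d by (intro mult_left_mono \<Phi>_ge) auto
          finally have "t w * (ennreal (2 * d) * ?L (z + w)) \<le> t w * (2 * \<Phi>)" by (intro mult_left_mono) auto
          then show ?thesis using True by (simp add: mult_ac)
        qed simp
      qed
      also have "\<dots> = 2 * \<Phi> * P d" unfolding P_def by (rule nn_integral_cmult) measurable
      also have "\<dots> \<le> 2 * \<Phi> * P d0" using P_mono[OF d(2)] by (rule mult_left_mono) simp
      finally have near: "(\<integral>\<^sup>+w. ennreal (2 * d) * ((t w * ?L (z + w)) * indicator {0<..<d} w) \<partial>lborel) \<le> 2 * \<Phi> * P d0" .
      have far: "2 * (ennreal d * t d) \<le> 2 * P d0"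
        using order.trans[OF t_le[OF d(1)] P_mono[OF d(2)]] by (rule mult_left_mono) simp
      have "ennreal (2 * d) \<le> ennreal d1" using d by (intro ennreal_leI)
      then have "ennreal C * ((\<integral>\<^sup>+w. ennreal (2 * d) * ((t w * ?L (z + w)) * indicator {0<..<d} w) \<partial>lborel)
           + ennreal h * (2 * (ennreal d * t d) + ennreal (2 * d) * ennreal q))
        \<le> ennreal C * (2 * \<Phi> * P d0 + ennreal h * (2 * P d0 + ennreal d1 * ennreal q))"
        by (intro mult_left_mono add_mono mult_right_mono near far) auto
      with bound have "ennreal (2 * d) * ?L z \<le> ennreal C * (2 * \<Phi> * P d0 + ennreal h * (2 * P d0 + ennreal d1 * ennreal q))"
        by (rule order.trans)
      also have "\<dots> = (ennreal C * (2 * P d0)) * \<Phi> + ennreal h * (ennreal C * (2 * P d0) + ennreal (C * d1 * q))"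
        using C d1 q by (simp add: distrib_left ennreal_mult mult_ac)
      also have "\<dots> \<le> 1 / 2 * \<Phi> + ennreal h * (1 / 2 + ennreal (C * d1 * q))"
        using d0 by (intro add_mono mult_right_mono mult_left_mono) auto
      finally have "ennreal (2 * d) * ?L z \<le> 1 / 2 * \<Phi> + ennreal h * (1 / 2 + ennreal (C * d1 * q))" .
      moreover have "1 / 2 + ennreal (C * d1 * q) = ennreal K"
        using C d1 q unfolding K_def
        by (subst ennreal_plus) (auto simp: divide_ennreal[symmetric, of 1 2, simplified])
      moreover have "ennreal h * ennreal K = ennreal (h * K)" using h K by (simp add: ennreal_mult)
      moreover have "1 / 2 * \<Phi> = \<Phi> / 2" by (simp add: ennreal_divide_times)
      ultimately show "ennreal (x + d1 - z) * ?L z \<le> \<Phi> / 2 + ennreal (h * K)" using d by simp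
    qed
    obtain f where f: "\<Phi> = ennreal f" "0 \<le> f" using \<Phi>_fin by (cases \<Phi>) auto
    have "\<Phi> / 2 = ennreal (f / 2)" using f divide_ennreal[of f 2] by simp
    with \<open>\<Phi> \<le> \<Phi> / 2 + ennreal (h * K)\<close> have "ennreal f \<le> ennreal (f / 2 + h * K)"
      using f h K by (simp add: ennreal_plus[symmetric] del: ennreal_plus)
    then have "f \<le> f / 2 + h * K" using f h K by (subst (asm) ennreal_le_iff) auto
    then have f_le: "f \<le> 2 * K * h" by (simp add: field_simps)
    have "ennreal d1 * ?L x \<le> \<Phi>" using \<Phi>_ge[of x] d1 by simp
    then have "d1 * measure \<mu> {x<..x + h} \<le> f"
      using f d1 by (simp add: emeasure_eq_measure ennreal_mult[symmetric])
    then have "measure \<mu> {x<..x + h} \<le> 2 * K / d1 * h"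
      using f_le d1 by (simp add: field_simps)
    then show ?thesis by (simp add: emeasure_eq_measure ennreal_leI)
  qed
  then show ?thesis using d1 by (intro exI[of _ "2 * K / d1"] exI[of _ h0]) auto
qed

lemma levy_tail_finite:
  assumes \<nu>: "subordinator_levy_measure \<nu>" and a: "0 < a"
  shows "levy_tail \<nu> a < \<infinity>"
proof -
  have [measurable_cong]: "sets \<nu> = sets borel" using \<nu> by (auto simp: subordinator_levy_measure_def)
  have "ennreal a * levy_tail \<nu> a = (\<integral>\<^sup>+s. ennreal a * indicator {a<..} s \<partial>\<nu>)"
    by (simp add: levy_tail_def nn_integral_cmult_indicator)
  also have "\<dots> \<le> (\<integral>\<^sup>+s. ennreal (min a (s * 1)) \<partial>\<nu>)"
    by (intro nn_integral_mono) (auto simp: indicator_def)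
  also have "\<dots> < \<infinity>" using a by (intro nn_integral_min_levy_measure_finite[OF \<nu>]) auto
  finally show ?thesis using a by (auto simp: ennreal_mult_less_top less_top[symmetric] ennreal_mult_eq_top_iff)
qed

text \<open>Once windows to the right of \<open>x\<close> have mass at most a multiple of their length, the singular part of
the right-hand side is at most a multiple of the integral of \<open>min d (s * b)\<close> against \<open>\<nu>\<close>, which is
finite by the integrability of the Levy measure.\<close>
lemma density_rhs_finite:
  assumes \<nu>: "subordinator_levy_measure \<nu>" and q: "0 \<le> q"
    and k[measurable]: "k \<in> borel_measurable borel" and \<mu>: "prob_space \<mu>" "\<mu> = density lborel k"
    and x: "0 < x" "x < b"
    and le: "AE u in lborel. x < u \<longrightarrow> u < b \<longrightarrow> k u \<le> ennreal C * density_rhs q \<nu> \<mu> u"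
    and C: "0 < C"
  shows "density_rhs q \<nu> \<mu> x < \<infinity>"
proof -
  interpret prob_space \<mu> by fact
  have sm[measurable_cong]: "sets \<mu> = sets borel" by (simp add: \<mu>)
  obtain B h0 where h0: "0 < h0" and B: "\<And>h. 0 < h \<Longrightarrow> h \<le> h0 \<Longrightarrow> emeasure \<mu> {x<..x + h} \<le> ennreal (B * h)"
    using window_mass_bounded_by_length[OF assms] by blast
  have sn[measurable_cong]: "sets \<nu> = sets borel" using \<nu> by (auto simp: subordinator_levy_measure_def)
  define d where "d = min h0 (b - x)"
  have d: "0 < d" "d \<le> h0" "x + d \<le> b" using h0 x by (auto simp: d_def)
  have b: "0 < b" using x by simp
  have "density_rhs q \<nu> \<mu> x \<le> (\<integral>\<^sup>+s. emeasure \<mu> {x<..<x + min d (s * b)} \<partial>\<nu>) + (levy_tail \<nu> (d / b) + ennreal q)"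
    using density_rhs_le[OF \<nu> \<mu>(1) sm x(1) d(1,3), of q]
    unfolding nn_integral_levy_tail_scaled[OF \<nu> b finite_measure_axioms sm] .
  moreover have "(\<integral>\<^sup>+s. emeasure \<mu> {x<..<x + min d (s * b)} \<partial>\<nu>) \<le> (\<integral>\<^sup>+s. ennreal \<bar>B\<bar> * ennreal (min d (s * b)) \<partial>\<nu>)"
  proof (rule nn_integral_mono_AE, use AE_levy_measure_pos[OF \<nu>] in eventually_elim)
    fix s :: real assume s: "0 < s"
    let ?h = "min d (s * b)"
    have h: "0 < ?h" "?h \<le> h0" using s d b by auto
    have "emeasure \<mu> {x<..<x + ?h} \<le> emeasure \<mu> {x<..x + ?h}" by (intro emeasure_mono) auto
    also have "\<dots> \<le> ennreal (B * ?h)" by (rule B[OF h])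
    also have "\<dots> \<le> ennreal (\<bar>B\<bar> * ?h)" using h by (intro ennreal_leI mult_right_mono) auto
    finally show "emeasure \<mu> {x<..<x + ?h} \<le> ennreal \<bar>B\<bar> * ennreal ?h" using h by (simp add: ennreal_mult)
  qed
  moreover have "(\<integral>\<^sup>+s. ennreal \<bar>B\<bar> * ennreal (min d (s * b)) \<partial>\<nu>) = ennreal \<bar>B\<bar> * (\<integral>\<^sup>+s. ennreal (min d (s * b)) \<partial>\<nu>)"
    by (rule nn_integral_cmult) measurable
  moreover have "ennreal \<bar>B\<bar> * (\<integral>\<^sup>+s. ennreal (min d (s * b)) \<partial>\<nu>) + (levy_tail \<nu> (d / b) + ennreal q) < \<infinity>"
    using nn_integral_min_levy_measure_finite[OF \<nu>, of d b] d b levy_tail_finite[OF \<nu>, of "d / b"]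
    by (simp add: ennreal_mult_less_top)
  ultimately show ?thesis by (metis add_right_mono order.trans le_less_trans)
qed

section \<open>Iterated integrals, additive functions and harmonic decrements\<close>

text \<open>This is the identity \<open>d(F ^ (n+1)) = (n+1) F ^ n dF\<close> for \<open>F s\<close> the integral of \<open>f\<close> up to \<open>s\<close>, for
merely measurable and possibly infinite \<open>F\<close>. In the product of \<open>F ^ (n+1)\<close> with one
more integral, the part where the new variable precedes the old ones and the part where it follows
them are again of the required form, by the definition of \<open>F\<close> and by induction.\<close>
lemma nn_integral_power_Suc_eq_iterated:
  fixes f :: "real \<Rightarrow> ennreal"
  assumes [measurable]: "f \<in> borel_measurable borel"
  shows "(\<integral>\<^sup>+s. f s \<partial>lborel) ^ Suc n = of_nat (Suc n) * (\<integral>\<^sup>+s. f s * (\<integral>\<^sup>+u\<in>{..s}. f u \<partial>lborel) ^ n \<partial>lborel)"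
  using assms
proof (induction n arbitrary: f)
  case 0 then show ?case by simp
next
  case (Suc n)
  note [measurable] = Suc.prems
  define F where "F s = (\<integral>\<^sup>+u\<in>{..s}. f u \<partial>lborel)" for s
  have F_alt: "F s = (\<integral>\<^sup>+u. f u * indicator {p. snd p \<le> fst p} (s, u) \<partial>lborel)" for s
    unfolding F_def by (intro nn_integral_cong) (auto simp: indicator_def)
  have [measurable]: "F \<in> borel_measurable borel"
    unfolding F_alt by measurable
  have IH: "F r ^ Suc n = of_nat (Suc n) * (\<integral>\<^sup>+s. f s * F s ^ n * indicator {p. snd p < fst p} (r, s) \<partial>lborel)" for r
  proof -
    have "F r ^ Suc n = of_nat (Suc n) * (\<integral>\<^sup>+s. (f s * indicator {..r} s) * (\<integral>\<^sup>+u\<in>{..s}. (f u * indicator {..r} u) \<partial>lborel) ^ n \<partial>lborel)"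
      unfolding F_def by (rule Suc.IH) measurable
    also have "(\<integral>\<^sup>+s. (f s * indicator {..r} s) * (\<integral>\<^sup>+u\<in>{..s}. (f u * indicator {..r} u) \<partial>lborel) ^ n \<partial>lborel)
       = (\<integral>\<^sup>+s. f s * F s ^ n * indicator {p. snd p < fst p} (r, s) \<partial>lborel)"
    proof (rule nn_integral_cong_AE, use AE_lborel_singleton[of r] in eventually_elim)
      fix s assume "s \<noteq> r"
      show "(f s * indicator {..r} s) * (\<integral>\<^sup>+u\<in>{..s}. (f u * indicator {..r} u) \<partial>lborel) ^ n
        = f s * F s ^ n * indicator {p. snd p < fst p} (r, s)"
      proof (cases "s < r")
        case True
        have "(\<integral>\<^sup>+u\<in>{..s}. (f u * indicator {..r} u) \<partial>lborel) = F s"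
          unfolding F_def using True by (intro nn_integral_cong) (auto simp: indicator_def)
        then show ?thesis using True by (simp add: indicator_def)
      qed (use \<open>s \<noteq> r\<close> in \<open>auto simp: indicator_def\<close>)
    qed
    finally show ?thesis .
  qed
  have "(\<integral>\<^sup>+s. f s \<partial>lborel) ^ Suc (Suc n) = (\<integral>\<^sup>+s. f s \<partial>lborel) ^ Suc n * (\<integral>\<^sup>+s. f s \<partial>lborel)"
    by (simp add: mult_ac)
  also have "\<dots> = of_nat (Suc n) * ((\<integral>\<^sup>+s. f s * F s ^ n \<partial>lborel) * (\<integral>\<^sup>+s. f s \<partial>lborel))"
    unfolding Suc.IH[OF Suc.prems] F_def[symmetric] by (simp add: mult.assoc)
  also have "(\<integral>\<^sup>+s. f s * F s ^ n \<partial>lborel) * (\<integral>\<^sup>+r. f r \<partial>lborel) = (\<integral>\<^sup>+s. (\<integral>\<^sup>+r. f s * F s ^ n * f r \<partial>lborel) \<partial>lborel)"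
    by (simp add: nn_integral_cmult nn_integral_multc)
  also have "\<dots> = (\<integral>\<^sup>+s. (\<integral>\<^sup>+r. f s * F s ^ n * (f r * indicator {p. snd p \<le> fst p} (s, r))
       + f s * F s ^ n * f r * indicator {p. snd p < fst p} (r, s) \<partial>lborel) \<partial>lborel)"
    by (intro nn_integral_cong) (auto simp: indicator_def)
  also have "\<dots> = (\<integral>\<^sup>+s. f s * F s ^ n * F s \<partial>lborel)
       + (\<integral>\<^sup>+s. (\<integral>\<^sup>+r. f s * F s ^ n * f r * indicator {p. snd p < fst p} (r, s) \<partial>lborel) \<partial>lborel)"
    unfolding F_alt by (simp add: nn_integral_add nn_integral_cmult)
  also have "(\<integral>\<^sup>+s. (\<integral>\<^sup>+r. f s * F s ^ n * f r * indicator {p. snd p < fst p} (r, s) \<partial>lborel) \<partial>lborel)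
      = (\<integral>\<^sup>+r. (\<integral>\<^sup>+s. f s * F s ^ n * f r * indicator {p. snd p < fst p} (r, s) \<partial>lborel) \<partial>lborel)"
    by (rule lborel_pair.Fubini') measurable
  also have "\<dots> = (\<integral>\<^sup>+r. f r * (\<integral>\<^sup>+s. f s * F s ^ n * indicator {p. snd p < fst p} (r, s) \<partial>lborel) \<partial>lborel)"
    by (intro nn_integral_cong, subst nn_integral_cmult[symmetric]) (auto simp: mult_ac)
  also have "of_nat (Suc n) * ((\<integral>\<^sup>+s. f s * F s ^ n * F s \<partial>lborel) + \<dots>)
     = of_nat (Suc n) * (\<integral>\<^sup>+s. f s * F s ^ Suc n \<partial>lborel)
       + (\<integral>\<^sup>+r. f r * (of_nat (Suc n) * (\<integral>\<^sup>+s. f s * F s ^ n * indicator {p. snd p < fst p} (r, s) \<partial>lborel)) \<partial>lborel)"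
    by (simp add: distrib_left nn_integral_cmult[symmetric] mult_ac del: of_nat_Suc)
  also have "\<dots> = of_nat (Suc (Suc n)) * (\<integral>\<^sup>+s. f s * F s ^ Suc n \<partial>lborel)"
    unfolding IH[symmetric] by (simp add: algebra_simps)
  finally show ?case unfolding F_def .
qed

text \<open>Monotonicity squeezes \<open>g t\<close> between the values at two neighbouring multiples of \<open>1 / n\<close>, where
additivity determines \<open>g\<close>.\<close>
lemma additive_mono_eq_linear:
  fixes g :: "real \<Rightarrow> real"
  assumes add: "\<And>s t. 0 \<le> s \<Longrightarrow> 0 \<le> t \<Longrightarrow> g (s + t) = g s + g t"
    and mono: "\<And>s t. 0 \<le> s \<Longrightarrow> s \<le> t \<Longrightarrow> g s \<le> g t"
    and t: "0 \<le> t"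
  shows "g t = t * g 1"
proof -
  have g0: "g 0 = 0" using add[of 0 0] by simp
  have mult: "g (real k * s) = real k * g s" if "0 \<le> s" for k s
    using that g0 by (induction k) (auto simp: distrib_right add)
  have g1: "0 \<le> g 1" using mono[of 0 1] g0 by simp
  have bound: "\<bar>g t - t * g 1\<bar> * real n \<le> g 1" if n: "0 < n" for n :: nat
  proof -
    define k where "k = nat \<lfloor>real n * t\<rfloor>"
    have k: "real k \<le> real n * t" "real n * t \<le> real (Suc k)" using t by (auto simp: k_def) linarith
    have gq: "g (real m / real n) = real m / real n * g 1" for m
      using mult[of 1 m] mult[of "real m / real n" n] n by (simp add: field_simps)
    have "real k / real n * g 1 \<le> g t"
      unfolding gq[symmetric] using k t n by (intro mono) (auto simp: field_simps)
    moreover have "g t \<le> real (Suc k) / real n * g 1"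
      unfolding gq[symmetric] using k t n by (intro mono) (auto simp: field_simps)
    ultimately have "real k / real n * g 1 \<le> g t" "g t \<le> real (Suc k) / real n * g 1" .
    then have "real k * g 1 \<le> g t * real n" "g t * real n \<le> real (Suc k) * g 1"
      using n by (auto simp: field_simps)
    moreover have "real k * g 1 \<le> real n * t * g 1" "real n * t * g 1 \<le> real (Suc k) * g 1"
      using k g1 by (auto intro: mult_right_mono)
    ultimately have "\<bar>g t * real n - t * g 1 * real n\<bar> \<le> g 1" by (auto simp: algebra_simps abs_le_iff)
    then show ?thesis by (simp add: left_diff_distrib[symmetric] abs_mult)
  qed
  show ?thesis
  proof (rule ccontr)
    assume "g t \<noteq> t * g 1"
    then have "0 < \<bar>g t - t * g 1\<bar>" by simp
    then obtain n where "g 1 < real n * \<bar>g t - t * g 1\<bar>" using reals_Archimedean3 by blast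
    moreover have "0 < n" using calculation g1 by (cases n) auto
    ultimately show False using bound[of n] by (simp add: mult.commute)
  qed
qed

lemma nn_integral_exp_shift:
  assumes l: "0 < (l::real)"
  shows "(\<integral>\<^sup>+t\<in>{u..}. ennreal (exp (- (t - u) * l)) \<partial>lborel) = ennreal (1 / l)"
proof -
  have "(\<integral>\<^sup>+t\<in>{u..}. ennreal (exp (- (t - u) * l)) \<partial>lborel) = ennreal (0 - (- (1 / l) * exp (- (u - u) * l)))"
  proof (rule nn_integral_FTC_atLeast[where F="\<lambda>t. - (1 / l) * exp (- (t - u) * l)"])
    show "((\<lambda>t. - (1 / l) * exp (- (t - u) * l)) has_real_derivative exp (- (x - u) * l)) (at x)" for x
      using l by (auto intro!: derivative_eq_intros)
    have "((\<lambda>t. exp (- (t - u) * l)) \<longlongrightarrow> 0) at_top"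
      using l by real_asymp
    from tendsto_mult_left[OF this, of "- (1 / l)"]
    show "((\<lambda>t. - (1 / l) * exp (- (t - u) * l)) \<longlongrightarrow> 0) at_top" by simp
  qed auto
  then show ?thesis by simp
qed

text \<open>A nonnegative sequence has only finite total decrease, while the harmonic series diverges.\<close>
lemma zero_of_harmonic_decrements:
  fixes a :: "nat \<Rightarrow> real"
  assumes a0: "\<And>n. 0 \<le> a n" and step: "\<And>n. t / real (Suc n) \<le> a n - a (Suc n)" and t: "0 \<le> t"
  shows "t = 0"
proof (rule ccontr)
  assume "t \<noteq> 0"
  have "(\<Sum>n<N. t / real (Suc n)) \<le> a 0" for N
  proof -
    have "(\<Sum>n<N. t / real (Suc n)) \<le> (\<Sum>n<N. a n - a (Suc n))" by (intro sum_mono step)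
    also have "\<dots> = a 0 - a N" by (rule sum_lessThan_telescope')
    finally show ?thesis using a0[of N] by simp
  qed
  then have "summable (\<lambda>n. t / real (Suc n))"
    using t by (intro summableI_nonneg_bounded) auto
  then have "summable (\<lambda>n. inverse t * (t / real (Suc n)))" by (rule summable_mult)
  then have "summable (\<lambda>n. inverse (real (Suc n)))" using \<open>t \<noteq> 0\<close> by (simp add: divide_inverse mult.assoc[symmetric])
  then have "summable (\<lambda>n. inverse (real n))" by (subst (asm) summable_Suc_iff)
  then show False using not_summable_harmonic[where 'a=real] by simp
qed

section \<open>The Laplace transform of a subordinator\<close>

locale subordinator_process =
  fixes M :: "'a measure" and \<zeta> :: "real \<Rightarrow> 'a \<Rightarrow> real" and c :: real and \<nu> :: "real measure"
  assumes subordinator_with: "subordinator_with M \<zeta> c \<nu>"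
begin

lemma levy_process: "levy_process M \<zeta>"
  using subordinator_with by (auto simp: subordinator_with_def subordinator_def)

sublocale prob_space M
  using levy_process by (simp add: levy_process_def)

lemma measurable_process[measurable]: "0 \<le> t \<Longrightarrow> \<zeta> t \<in> borel_measurable M"
  using levy_process by (simp add: levy_process_def)

lemma process_0: "\<omega> \<in> space M \<Longrightarrow> \<zeta> 0 \<omega> = 0"
  using levy_process by (simp add: levy_process_def)

lemma process_mono: "\<omega> \<in> space M \<Longrightarrow> 0 \<le> s \<Longrightarrow> s \<le> t \<Longrightarrow> \<zeta> s \<omega> \<le> \<zeta> t \<omega>"
  using subordinator_with by (auto simp: subordinator_with_def subordinator_def mono_on_def)

lemma process_nonneg: "\<omega> \<in> space M \<Longrightarrow> 0 \<le> t \<Longrightarrow> 0 \<le> \<zeta> t \<omega>"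
  using process_mono[of \<omega> 0 t] process_0 by auto

lemma right_continuous: "\<omega> \<in> space M \<Longrightarrow> 0 \<le> t \<Longrightarrow> ((\<lambda>s. \<zeta> s \<omega>) \<longlongrightarrow> \<zeta> t \<omega>) (at_right t)"
  using levy_process by (simp add: levy_process_def)

lemma indep_increments:
  "0 \<le> ts 0 \<Longrightarrow> (\<And>i. i < n \<Longrightarrow> ts i \<le> ts (Suc i)) \<Longrightarrow>
    indep_vars (\<lambda>_. borel) (\<lambda>i \<omega>. \<zeta> (ts (Suc i)) \<omega> - \<zeta> (ts i) \<omega>) {..<n}"
  using levy_process unfolding levy_process_def by blast

lemma distr_increment:
  "0 \<le> s \<Longrightarrow> 0 \<le> t \<Longrightarrow> distr M borel (\<lambda>\<omega>. \<zeta> (s + t) \<omega> - \<zeta> s \<omega>) = distr M borel (\<zeta> t)"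
  using levy_process by (simp add: levy_process_def)

lemma nn_integral_increment:
  assumes "0 \<le> s" "0 \<le> t" and [measurable]: "f \<in> borel_measurable borel"
  shows "(\<integral>\<^sup>+\<omega>. f (\<zeta> (s + t) \<omega> - \<zeta> s \<omega>) \<partial>M) = (\<integral>\<^sup>+\<omega>. f (\<zeta> t \<omega>) \<partial>M)"
proof -
  have "(\<integral>\<^sup>+\<omega>. f (\<zeta> (s + t) \<omega> - \<zeta> s \<omega>) \<partial>M) = (\<integral>\<^sup>+x. f x \<partial>distr M borel (\<lambda>\<omega>. \<zeta> (s + t) \<omega> - \<zeta> s \<omega>))"
    using assms by (subst nn_integral_distr) auto
  also have "\<dots> = (\<integral>\<^sup>+\<omega>. f (\<zeta> t \<omega>) \<partial>M)"
    using assms by (subst distr_increment) (auto simp: nn_integral_distr)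
  finally show ?thesis .
qed

abbreviation \<phi> :: "nat \<Rightarrow> real" where
  "\<phi> m \<equiv> laplace_exponent M \<zeta> (real m)"

text \<open>The list \<open>[(m1, d1), (m2, d2), \<dots>]\<close> prescribes consecutive increments over durations \<open>d1, d2, \<dots>\<close>
starting at time \<open>r\<close>, the \<open>i\<close>-th one weighted by \<open>exp (- mi * increment)\<close>. A list is used because
the moment computation prepends further increments by recursion.\<close>
fun increment_product :: "real \<Rightarrow> (nat \<times> real) list \<Rightarrow> 'a \<Rightarrow> ennreal" where
  "increment_product r [] \<omega> = 1"
| "increment_product r ((m, d) # xs) \<omega> =
     ennreal (exp (- real m * (\<zeta> (r + d) \<omega> - \<zeta> r \<omega>))) * increment_product (r + d) xs \<omega>"

lemma increment_product_eq_prod: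
  "increment_product r xs \<omega> = (\<Prod>i<length xs. ennreal (exp (- real (fst (xs ! i)) *
      (\<zeta> (r + sum_list (take (Suc i) (map snd xs))) \<omega> - \<zeta> (r + sum_list (take i (map snd xs))) \<omega>))))"
proof (induction xs arbitrary: r)
  case (Cons x xs)
  obtain m d where "x = (m, d)" by (cases x)
  then show ?case
    using Cons[of "r + d"] by (simp add: prod.lessThan_Suc_shift add.assoc del: prod.lessThan_Suc)
qed simp

lemma measurable_increment_product[measurable]:
  "0 \<le> r \<Longrightarrow> (\<forall>x\<in>set xs. 0 \<le> snd x) \<Longrightarrow> increment_product r xs \<in> borel_measurable M"
proof (induction xs arbitrary: r)
  case (Cons x xs)
  obtain m d where x: "x = (m, d)" by (cases x)
  have [measurable]: "increment_product (r + d) xs \<in> borel_measurable M"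
    using Cons x by (intro Cons) auto
  have [measurable]: "\<zeta> r \<in> borel_measurable M" "\<zeta> (r + d) \<in> borel_measurable M"
    using Cons.prems x by auto
  have "increment_product r (x # xs)
     = (\<lambda>\<omega>. ennreal (exp (- real m * (\<zeta> (r + d) \<omega> - \<zeta> r \<omega>))) * increment_product (r + d) xs \<omega>)"
    by (rule ext) (simp add: x)
  also have "\<dots> \<in> borel_measurable M" by measurable
  finally show ?case .
next
  case Nil
  have "increment_product r [] = (\<lambda>\<omega>. 1)" by (rule ext) simp
  then show ?case by simp
qed

lemma nn_integral_increment_product_eq_prod:
  assumes r: "0 \<le> r" and xs: "\<forall>x\<in>set xs. 0 \<le> snd x"
  shows "(\<integral>\<^sup>+\<omega>. increment_product r xs \<omega> \<partial>M)
     = (\<Prod>i<length xs. \<integral>\<^sup>+\<omega>. ennreal (exp (- real (fst (xs ! i)) * \<zeta> (snd (xs ! i)) \<omega>)) \<partial>M)"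
proof -
  define ts where "ts i = r + sum_list (take i (map snd xs))" for i
  have ts_Suc: "ts (Suc i) = ts i + snd (xs ! i)" if "i < length xs" for i
    using that by (simp add: ts_def take_Suc_conv_app_nth)
  have nn: "0 \<le> snd (xs ! i)" if "i < length xs" for i using xs that by auto
  have ts: "0 \<le> ts i" if "i \<le> length xs" for i
    using that by (induction i) (use r nn ts_Suc in \<open>auto simp: ts_def[of 0]\<close>)
  have "indep_vars (\<lambda>_. borel) (\<lambda>i \<omega>. \<zeta> (ts (Suc i)) \<omega> - \<zeta> (ts i) \<omega>) {..<length xs}"
    using ts[of 0] nn ts_Suc by (intro indep_increments) auto
  then have "indep_vars (\<lambda>_. borel) (\<lambda>i \<omega>. ennreal (exp (- real (fst (xs ! i)) * (\<zeta> (ts (Suc i)) \<omega> - \<zeta> (ts i) \<omega>)))) {..<length xs}"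
    by (rule indep_vars_compose2[where Y="\<lambda>i x. ennreal (exp (- real (fst (xs ! i)) * x))"]) auto
  then have "(\<integral>\<^sup>+\<omega>. (\<Prod>i<length xs. ennreal (exp (- real (fst (xs ! i)) * (\<zeta> (ts (Suc i)) \<omega> - \<zeta> (ts i) \<omega>)))) \<partial>M)
      = (\<Prod>i<length xs. \<integral>\<^sup>+\<omega>. ennreal (exp (- real (fst (xs ! i)) * (\<zeta> (ts (Suc i)) \<omega> - \<zeta> (ts i) \<omega>))) \<partial>M)"
    by (intro indep_vars_nn_integral) auto
  also have "\<dots> = (\<Prod>i<length xs. \<integral>\<^sup>+\<omega>. ennreal (exp (- real (fst (xs ! i)) * \<zeta> (snd (xs ! i)) \<omega>)) \<partial>M)"
    using ts nn by (intro prod.cong refl) (simp add: ts_Suc nn_integral_increment[where f="\<lambda>x. ennreal (exp (- (real _ * x)))"])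
  finally show ?thesis unfolding increment_product_eq_prod ts_def .
qed

text \<open>The Laplace exponent is defined from time 1. Additivity of \<open>- ln E[exp(- m \<zeta>_t)]\<close> in \<open>t\<close> comes from
stationary independent increments and its monotonicity from the monotone paths, so it is linear.\<close>
lemma nn_integral_exp_process:
  assumes t: "0 \<le> t"
  shows "(\<integral>\<^sup>+\<omega>. ennreal (exp (- real m * \<zeta> t \<omega>)) \<partial>M) = ennreal (exp (- t * \<phi> m))"
proof -
  define f where "f t = expectation (\<lambda>\<omega>. exp (- real m * \<zeta> t \<omega>))" for t
  have int: "integrable M (\<lambda>\<omega>. exp (- real m * \<zeta> t \<omega>))" if "0 \<le> t" for t
    using that process_nonneg by (intro integrable_const_bound[of _ 1]) auto
  have nn: "(\<integral>\<^sup>+\<omega>. ennreal (exp (- real m * \<zeta> t \<omega>)) \<partial>M) = ennreal (f t)" if "0 \<le> t" for t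
    unfolding f_def by (rule nn_integral_eq_integral[OF int[OF that]]) simp
  have f_pos: "0 < f t" if "0 \<le> t" for t
  proof -
    have "f t \<noteq> 0"
    proof
      assume "f t = 0"
      then have "AE \<omega> in M. exp (- real m * \<zeta> t \<omega>) = 0"
        unfolding f_def by (subst (asm) integral_nonneg_eq_0_iff_AE[OF int[OF that]]) auto
      then show False by (simp add: AE_False)
    qed
    moreover have "0 \<le> f t" unfolding f_def by simp
    ultimately show ?thesis by simp
  qed
  have f_mult: "f (s + t) = f s * f t" if "0 \<le> s" "0 \<le> t" for s t
  proof -
    have "ennreal (f (s + t)) = (\<integral>\<^sup>+\<omega>. increment_product 0 [(m, s), (m, t)] \<omega> \<partial>M)"
      unfolding nn[OF add_nonneg_nonneg[OF that], symmetric]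
      by (intro nn_integral_cong) (simp add: process_0 ennreal_mult[symmetric] exp_add[symmetric] algebra_simps)
    also have "\<dots> = ennreal (f s) * ennreal (f t)"
      using that by (subst nn_integral_increment_product_eq_prod) (auto simp: nn[simplified])
    finally show ?thesis using that f_pos by (simp add: ennreal_mult[symmetric] less_imp_le)
  qed
  have f_mono: "f t \<le> f s" if "0 \<le> s" "s \<le> t" for s t
    unfolding f_def using that process_mono by (intro integral_mono int) (auto intro!: mult_left_mono)
  have "- ln (f t) = t * - ln (f 1)"
  proof (rule additive_mono_eq_linear[where g="\<lambda>t. - ln (f t)"])
    fix s t :: real assume s: "0 \<le> s"
    show "- ln (f (s + t)) = - ln (f s) + - ln (f t)" if t: "0 \<le> t"
      using f_pos[OF s] f_pos[OF t] by (simp add: f_mult[OF s t] ln_mult)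
    show "- ln (f s) \<le> - ln (f t)" if t: "s \<le> t"
      using f_pos[OF s] f_pos[of t] f_mono[OF s t] s t by simp
  qed fact
  then have "ln (f t) = - t * \<phi> m" by (simp add: f_def laplace_exponent_def)
  then have "f t = exp (- t * \<phi> m)" using f_pos[OF t] by (metis exp_ln)
  then show ?thesis using nn[OF t] by simp
qed

fun laplace_product :: "(nat \<times> real) list \<Rightarrow> ennreal" where
  "laplace_product [] = 1"
| "laplace_product ((m, d) # xs) = ennreal (exp (- d * \<phi> m)) * laplace_product xs"

lemma nn_integral_increment_product:
  assumes r: "0 \<le> r" and xs: "\<forall>x\<in>set xs. 0 \<le> snd x"
  shows "(\<integral>\<^sup>+\<omega>. increment_product r xs \<omega> \<partial>M) = laplace_product xs"
proof -
  have "(\<Prod>i<length xs. \<integral>\<^sup>+\<omega>. ennreal (exp (- real (fst (xs ! i)) * \<zeta> (snd (xs ! i)) \<omega>)) \<partial>M) = laplace_product xs"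
    using xs
  proof (induction xs)
    case (Cons x xs)
    obtain m d where "x = (m, d)" by (cases x)
    then show ?case
      using Cons nn_integral_exp_process[of d m] by (simp add: prod.lessThan_Suc_shift del: prod.lessThan_Suc)
  qed simp
  then show ?thesis using nn_integral_increment_product_eq_prod[OF assms] by simp
qed

section \<open>Moments of the exponential functional\<close>

text \<open>The integrand of the exponential functional, set to 0 at negative times where nothing is known about
the paths.\<close>
definition discount :: "real \<Rightarrow> 'a \<Rightarrow> ennreal" where
  "discount s \<omega> = ennreal (exp (- \<zeta> s \<omega>)) * indicator {0..} s"

text \<open>Joint measurability in time and chance: by right-continuity the process at time \<open>s\<close> is the limit of
its values on the grid \<open>k / (N + 1)\<close>, taken at the first grid point strictly after \<open>s\<close>.\<close>
lemma measurable_discount[measurable]: "(\<lambda>(s, \<omega>). discount s \<omega>) \<in> borel_measurable (borel \<Otimes>\<^sub>M M)"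
proof -
  define F where "F N p = exp (- \<zeta> ((real (nat \<lfloor>real (Suc N) * fst p\<rfloor>) + 1) / real (Suc N)) (snd p)) * indicator {0..} (fst p)"
    for N :: nat and p :: "real \<times> 'a"
  define G where "G p = exp (- \<zeta> (fst p) (snd p)) * indicator {0..} (fst p)" for p :: "real \<times> 'a"
  have [measurable]: "F N \<in> borel_measurable (borel \<Otimes>\<^sub>M M)" for N
  proof -
    have "(\<lambda>p. \<zeta> ((real (nat \<lfloor>real (Suc N) * fst p\<rfloor>) + 1) / real (Suc N)) (snd p)) \<in> borel_measurable (borel \<Otimes>\<^sub>M M)"
    proof (rule measurable_compose_countable[where f="\<lambda>k p. \<zeta> ((real k + 1) / real (Suc N)) (snd p)"])
      fix k :: nat
      have [measurable]: "\<zeta> ((real k + 1) / real (Suc N)) \<in> borel_measurable M" by (rule measurable_process) simp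
      show "(\<lambda>p. \<zeta> ((real k + 1) / real (Suc N)) (snd p)) \<in> borel_measurable (borel \<Otimes>\<^sub>M M)" by measurable
    qed measurable
    then show ?thesis unfolding F_def by measurable
  qed
  have "G \<in> borel_measurable (borel \<Otimes>\<^sub>M M)"
  proof (rule borel_measurable_LIMSEQ_real[where u=F])
    fix p :: "real \<times> 'a" assume p: "p \<in> space (borel \<Otimes>\<^sub>M M)"
    then have \<omega>: "snd p \<in> space M" by (auto simp: space_pair_measure)
    show "(\<lambda>N. F N p) \<longlonglongrightarrow> G p"
    proof (cases "0 \<le> fst p")
      case s: True
      \<comment> \<open>the summand 1 makes the grid point strictly larger than the time, as convergence from the right demands\<close>
      define x where "x N = (real (nat \<lfloor>real (Suc N) * fst p\<rfloor>) + 1) / real (Suc N)" for N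
      have x_gt: "fst p < x N" and x_le: "x N \<le> fst p + 1 / real (Suc N)" for N
      proof -
        have "0 \<le> \<lfloor>real (Suc N) * fst p\<rfloor>" using s by simp
        then have "real (nat \<lfloor>real (Suc N) * fst p\<rfloor>) = of_int \<lfloor>real (Suc N) * fst p\<rfloor>" by simp
        then have "real (Suc N) * fst p < real (nat \<lfloor>real (Suc N) * fst p\<rfloor>) + 1"
          "real (nat \<lfloor>real (Suc N) * fst p\<rfloor>) \<le> real (Suc N) * fst p"
          by linarith+
        then show "fst p < x N" "x N \<le> fst p + 1 / real (Suc N)"
          unfolding x_def by (auto simp: field_simps simp del: of_nat_Suc)
      qed
      have "x \<longlonglongrightarrow> fst p"
      proof (rule tendsto_sandwich[of "\<lambda>_. fst p" x _ "\<lambda>N. fst p + 1 / real (Suc N)"])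
        show "(\<lambda>N. fst p + 1 / real (Suc N)) \<longlonglongrightarrow> fst p"
          using tendsto_add[OF tendsto_const LIMSEQ_inverse_real_of_nat, of "fst p"] by (simp add: inverse_eq_divide)
      qed (use x_gt x_le in \<open>auto intro!: always_eventually less_imp_le simp del: of_nat_Suc\<close>)
      then have "filterlim x (at_right (fst p)) sequentially"
        using x_gt by (intro tendsto_imp_filterlim_at_right) auto
      then have "(\<lambda>N. \<zeta> (x N) (snd p)) \<longlonglongrightarrow> \<zeta> (fst p) (snd p)"
        by (rule filterlim_compose[OF right_continuous[OF \<omega> s]])
      then show ?thesis unfolding F_def G_def x_def[symmetric] by (intro tendsto_intros)
    qed (simp add: F_def G_def)
  qed measurable
  then have "(\<lambda>p. ennreal (G p)) \<in> borel_measurable (borel \<Otimes>\<^sub>M M)" by measurable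
  also have "(\<lambda>p. ennreal (G p)) = (\<lambda>(s, \<omega>). discount s \<omega>)"
    by (auto simp: G_def discount_def fun_eq_iff indicator_def)
  finally show ?thesis .
qed

lemma measurable_discount_section[measurable]: "\<omega> \<in> space M \<Longrightarrow> (\<lambda>s. discount s \<omega>) \<in> borel_measurable borel"
  using measurable_compose[OF measurable_Pair2'[of \<omega> M borel] measurable_discount] by simp

definition partial_functional :: "real \<Rightarrow> 'a \<Rightarrow> ennreal" where
  "partial_functional t \<omega> = (\<integral>\<^sup>+s\<in>{..t}. discount s \<omega> \<partial>lborel)"

lemma partial_functional_alt: "partial_functional t \<omega> = (\<integral>\<^sup>+s. discount s \<omega> * indicator {p. snd p \<le> fst p} (t, s) \<partial>lborel)"
  unfolding partial_functional_def by (intro nn_integral_cong) (auto simp: indicator_def)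

lemma measurable_partial_functional_pair[measurable]: "(\<lambda>(s, \<omega>). partial_functional s \<omega>) \<in> borel_measurable (borel \<Otimes>\<^sub>M M)"
  unfolding partial_functional_alt by measurable

lemma measurable_partial_functional[measurable]: "partial_functional t \<in> borel_measurable M"
  using measurable_compose[OF measurable_Pair1'[of t borel M] measurable_partial_functional_pair] by simp

lemma partial_functional_power_Suc:
  assumes \<omega>[measurable]: "\<omega> \<in> space M"
  shows "partial_functional t \<omega> ^ Suc n = of_nat (Suc n) * (\<integral>\<^sup>+s\<in>{..t}. (discount s \<omega> * partial_functional s \<omega> ^ n) \<partial>lborel)"
proof -
  have "partial_functional t \<omega> ^ Suc n = of_nat (Suc n) * (\<integral>\<^sup>+s. (discount s \<omega> * indicator {..t} s) * (\<integral>\<^sup>+u\<in>{..s}. (discount u \<omega> * indicator {..t} u) \<partial>lborel) ^ n \<partial>lborel)"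
    unfolding partial_functional_def by (rule nn_integral_power_Suc_eq_iterated) measurable
  also have "(\<integral>\<^sup>+s. (discount s \<omega> * indicator {..t} s) * (\<integral>\<^sup>+u\<in>{..s}. (discount u \<omega> * indicator {..t} u) \<partial>lborel) ^ n \<partial>lborel)
     = (\<integral>\<^sup>+s\<in>{..t}. (discount s \<omega> * partial_functional s \<omega> ^ n) \<partial>lborel)"
  proof (rule nn_integral_cong)
    fix s
    show "(discount s \<omega> * indicator {..t} s) * (\<integral>\<^sup>+u\<in>{..s}. (discount u \<omega> * indicator {..t} u) \<partial>lborel) ^ n
      = (discount s \<omega> * partial_functional s \<omega> ^ n) * indicator {..t} s"
    proof (cases "s \<le> t")
      case True
      have "(\<integral>\<^sup>+u\<in>{..s}. (discount u \<omega> * indicator {..t} u) \<partial>lborel) = partial_functional s \<omega>"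
        unfolding partial_functional_def using True by (intro nn_integral_cong) (auto simp: indicator_def)
      then show ?thesis using True by simp
    qed simp
  qed
  finally show ?thesis .
qed

text \<open>This is \<open>E[A_t ^ n exp(- m \<zeta>_t)]\<close>, where \<open>A_t\<close> is the functional up to time \<open>t\<close>. The recursion
conditions on the position \<open>u\<close> of the last factor of \<open>A_t ^ n\<close>: up to \<open>u\<close> the discount of that
factor raises \<open>m\<close> by one, and after \<open>u\<close> the increment contributes \<open>exp (- (t - u) * \<phi> m)\<close>.\<close>
primrec joint_moment :: "nat \<Rightarrow> nat \<Rightarrow> real \<Rightarrow> ennreal" where
  "joint_moment 0 m t = ennreal (exp (- t * \<phi> m))"
| "joint_moment (Suc n) m t = of_nat (Suc n) *
     (\<integral>\<^sup>+u\<in>{0..t}. (joint_moment n (Suc m) u * ennreal (exp (- (t - u) * \<phi> m))) \<partial>lborel)"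

lemma measurable_joint_moment[measurable]: "joint_moment n m \<in> borel_measurable borel"
proof (induction n arbitrary: m)
  case 0
  have "joint_moment 0 m = (\<lambda>t. ennreal (exp (- t * \<phi> m)))" by (rule ext) simp
  then show ?case by simp
next
  case (Suc n)
  note [measurable] = Suc.IH
  have "joint_moment (Suc n) m = (\<lambda>t. of_nat (Suc n) *
     (\<integral>\<^sup>+u. (joint_moment n (Suc m) u * ennreal (exp (- (t - u) * \<phi> m)))
        * (indicator {0..} u * indicator {p. snd p \<le> fst p} (t, u)) \<partial>lborel))"
    unfolding joint_moment.simps
    by (intro ext arg_cong2[where f="(*)"] nn_integral_cong refl) (auto simp: indicator_def)
  also have "\<dots> \<in> borel_measurable borel" by measurable
  finally show ?case .
qed

text \<open>The expectation identity behind \<open>joint_moment\<close>. The statement carries a list of increments after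
\<open>r\<close> because the induction step splits off the increment from \<open>u\<close> to \<open>r\<close> and prepends it to that list;
in this way finitely many independent increments remain at the base of the induction. The event \<open>B\<close> is carried along in order to be specialised to the event
that the exponential time exceeds \<open>r\<close>.\<close>
lemma nn_integral_joint_moment:
  assumes B[measurable]: "B \<in> sets M"
    and indep: "\<And>xs. \<forall>x\<in>set xs. 0 \<le> snd x \<Longrightarrow>
      (\<integral>\<^sup>+\<omega>. indicator B \<omega> * increment_product 0 xs \<omega> \<partial>M) = emeasure M B * laplace_product xs"
    and r: "0 \<le> r" and xs: "\<forall>x\<in>set xs. 0 \<le> snd x"
  shows "(\<integral>\<^sup>+\<omega>. indicator B \<omega> * partial_functional r \<omega> ^ n * increment_product 0 [(m, r)] \<omega> * increment_product r xs \<omega> \<partial>M)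
     = emeasure M B * joint_moment n m r * laplace_product xs"
  using r xs
proof (induction n arbitrary: m r xs)
  case 0
  have "(\<integral>\<^sup>+\<omega>. indicator B \<omega> * partial_functional r \<omega> ^ 0 * increment_product 0 [(m, r)] \<omega> * increment_product r xs \<omega> \<partial>M)
    = (\<integral>\<^sup>+\<omega>. indicator B \<omega> * increment_product 0 ((m, r) # xs) \<omega> \<partial>M)"
    by (simp add: mult.assoc)
  also have "\<dots> = emeasure M B * laplace_product ((m, r) # xs)"
    using 0 by (intro indep) auto
  finally show ?case by (simp add: mult.assoc)
next
  case (Suc n)
  have [measurable]: "increment_product r xs \<in> borel_measurable M" "increment_product 0 [(m, r)] \<in> borel_measurable M"
    using Suc.prems by auto
  have split: "discount u \<omega> * increment_product 0 [(m, r)] \<omega> * increment_product r xs \<omega>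
     = increment_product 0 [(Suc m, u)] \<omega> * increment_product u ((m, r - u) # xs) \<omega>"
    if "u \<in> {0..r}" "\<omega> \<in> space M" for u \<omega>
  proof -
    have "exp (- \<zeta> u \<omega>) * exp (- (real m * (\<zeta> r \<omega> - \<zeta> 0 \<omega>))) =
      exp (- (real (Suc m) * (\<zeta> u \<omega> - \<zeta> 0 \<omega>))) * exp (- (real m * (\<zeta> r \<omega> - \<zeta> u \<omega>)))"
      using that by (simp add: exp_add[symmetric] process_0 algebra_simps)
    then show ?thesis
      using that by (simp add: discount_def ennreal_mult[symmetric] mult.assoc[symmetric] del: of_nat_Suc)
  qed
  let ?P = "\<lambda>\<omega>. indicator B \<omega> * increment_product 0 [(m, r)] \<omega> * increment_product r xs \<omega>"
  have "(\<integral>\<^sup>+\<omega>. indicator B \<omega> * partial_functional r \<omega> ^ Suc n * increment_product 0 [(m, r)] \<omega> * increment_product r xs \<omega> \<partial>M)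
     = (\<integral>\<^sup>+\<omega>. of_nat (Suc n) * (\<integral>\<^sup>+u. discount u \<omega> * partial_functional u \<omega> ^ n * indicator {..r} u * ?P \<omega> \<partial>lborel) \<partial>M)"
  proof (rule nn_integral_cong)
    fix \<omega> assume \<omega>[measurable]: "\<omega> \<in> space M"
    have [measurable]: "(\<lambda>s. partial_functional s \<omega>) \<in> borel_measurable borel"
      using measurable_compose[OF measurable_Pair2'[OF \<omega>, of borel] measurable_partial_functional_pair] by simp
    show "indicator B \<omega> * partial_functional r \<omega> ^ Suc n * increment_product 0 [(m, r)] \<omega> * increment_product r xs \<omega>
       = of_nat (Suc n) * (\<integral>\<^sup>+u. discount u \<omega> * partial_functional u \<omega> ^ n * indicator {..r} u * ?P \<omega> \<partial>lborel)"
      unfolding partial_functional_power_Suc[OF \<omega>]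
      by (subst nn_integral_multc) (simp_all only: mult_ac, measurable)
  qed
  also have "\<dots> = of_nat (Suc n) * (\<integral>\<^sup>+\<omega>. (\<integral>\<^sup>+u. discount u \<omega> * partial_functional u \<omega> ^ n * indicator {..r} u * ?P \<omega> \<partial>lborel) \<partial>M)"
    by (rule nn_integral_cmult) measurable
  also have "(\<integral>\<^sup>+\<omega>. (\<integral>\<^sup>+u. discount u \<omega> * partial_functional u \<omega> ^ n * indicator {..r} u * ?P \<omega> \<partial>lborel) \<partial>M)
     = (\<integral>\<^sup>+u. (\<integral>\<^sup>+\<omega>. discount u \<omega> * partial_functional u \<omega> ^ n * indicator {..r} u * ?P \<omega> \<partial>M) \<partial>lborel)"
  proof -
    interpret P: pair_sigma_finite lborel M ..
    show ?thesis by (rule P.Fubini') measurable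
  qed
  also have "\<dots> = (\<integral>\<^sup>+u. (emeasure M B * laplace_product xs) * ((joint_moment n (Suc m) u * ennreal (exp (- (r - u) * \<phi> m))) * indicator {0..r} u) \<partial>lborel)"
  proof (rule nn_integral_cong)
    fix u
    show "(\<integral>\<^sup>+\<omega>. discount u \<omega> * partial_functional u \<omega> ^ n * indicator {..r} u * ?P \<omega> \<partial>M)
      = (emeasure M B * laplace_product xs) * ((joint_moment n (Suc m) u * ennreal (exp (- (r - u) * \<phi> m))) * indicator {0..r} u)"
    proof (cases "u \<in> {0..r}")
      case True
      have "(\<integral>\<^sup>+\<omega>. discount u \<omega> * partial_functional u \<omega> ^ n * indicator {..r} u * ?P \<omega> \<partial>M)
        = (\<integral>\<^sup>+\<omega>. indicator B \<omega> * partial_functional u \<omega> ^ n * (discount u \<omega> * increment_product 0 [(m, r)] \<omega> * increment_product r xs \<omega>) \<partial>M)"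
        using True by (intro nn_integral_cong) (simp add: mult_ac del: increment_product.simps)
      also have "\<dots> = (\<integral>\<^sup>+\<omega>. indicator B \<omega> * partial_functional u \<omega> ^ n * increment_product 0 [(Suc m, u)] \<omega> * increment_product u ((m, r - u) # xs) \<omega> \<partial>M)"
        by (intro nn_integral_cong, subst split[OF True]) (simp_all only: mult.assoc)
      also have "\<dots> = emeasure M B * joint_moment n (Suc m) u * laplace_product ((m, r - u) # xs)"
        using True Suc.prems by (intro Suc.IH) auto
      finally show ?thesis using True by (simp add: mult_ac)
    qed (auto simp: discount_def indicator_def)
  qed
  also have "\<dots> = (emeasure M B * laplace_product xs) * (\<integral>\<^sup>+u. (joint_moment n (Suc m) u * ennreal (exp (- (r - u) * \<phi> m))) * indicator {0..r} u \<partial>lborel)"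
    by (rule nn_integral_cmult) measurable
  finally show ?case by (simp only: joint_moment.simps mult_ac)
qed

text \<open>An increment product is a measurable function of the path through finitely many coordinates, so the
independence of the time and the path applies to it.\<close>
lemma nn_integral_indep_increment_product:
  assumes T: "independent_of_process M T \<zeta>" and Tm[measurable]: "T \<in> borel_measurable M"
    and xs: "\<forall>x\<in>set xs. 0 \<le> snd x"
  shows "(\<integral>\<^sup>+\<omega>. indicator {\<omega>\<in>space M. ereal s < T \<omega>} \<omega> * increment_product 0 xs \<omega> \<partial>M)
     = emeasure M {\<omega>\<in>space M. ereal s < T \<omega>} * laplace_product xs"
proof -
  define path where "path \<omega> = (\<lambda>t\<in>{0..}. \<zeta> t \<omega>)" for \<omega>
  define N :: "(real \<Rightarrow> real) measure" where "N = PiM {0..} (\<lambda>_. borel)"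
  have path_m: "path \<in> measurable M N"
    unfolding path_def N_def by (intro measurable_restrict) auto
  have Int: "Int_stable {X -` A \<inter> space M | A. A \<in> sets K}" for X :: "'a \<Rightarrow> 'b" and K
  proof (rule Int_stableI)
    fix a b assume "a \<in> {X -` A \<inter> space M | A. A \<in> sets K}" "b \<in> {X -` A \<inter> space M | A. A \<in> sets K}"
    then obtain A B where "a = X -` A \<inter> space M" "b = X -` B \<inter> space M" "A \<in> sets K" "B \<in> sets K" by auto
    then show "a \<inter> b \<in> {X -` A \<inter> space M | A. A \<in> sets K}"
      by (intro CollectI exI[of _ "A \<inter> B"]) auto
  qed
  define g where "g p = (\<Prod>i<length xs. ennreal (exp (- real (fst (xs ! i)) *
      (p (sum_list (take (Suc i) (map snd xs))) - p (sum_list (take i (map snd xs)))))))" for p :: "real \<Rightarrow> real"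
  have nn: "0 \<le> sum_list (take i (map snd xs))" for i
    using xs by (intro sum_list_nonneg) (auto dest!: in_set_takeD)
  have [measurable]: "(\<lambda>p. p (sum_list (take i (map snd xs)))) \<in> borel_measurable N" for i
    unfolding N_def using nn by (intro measurable_component_singleton) auto
  have "g \<in> borel_measurable N"
    unfolding g_def by measurable
  then have g_path: "g \<circ> path \<in> borel_measurable M" and g_vimage: "path -` (g -` b) \<inter> space M \<in> {path -` B \<inter> space M | B. B \<in> sets N}"
    if "b \<in> sets borel" for b
    using path_m that by (auto intro!: exI[of _ "g -` b \<inter> space N"] measurable_sets dest: measurable_space)
  let ?i = "(\<lambda>t. indicator {ereal s<..} t :: ennreal)"
  have i_vimage: "T -` (?i -` a) \<inter> space M \<in> {T -` B \<inter> space M | B. B \<in> sets borel}"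
    if "a \<in> sets borel" for a
    using measurable_sets_borel[of ?i borel a] that by (intro CollectI exI[of _ "?i -` a"] conjI refl) simp_all
  have "indep_set {(?i \<circ> T) -` a \<inter> space M | a. a \<in> sets borel} {(g \<circ> path) -` b \<inter> space M | b. b \<in> sets borel}"
  proof (rule indep_setI)
    show "prob (x \<inter> y) = prob x * prob y"
      if "x \<in> {(?i \<circ> T) -` a \<inter> space M | a. a \<in> sets borel}" "y \<in> {(g \<circ> path) -` b \<inter> space M | b. b \<in> sets borel}" for x y
      using that i_vimage g_vimage
      by (intro indep_setD[OF T[unfolded independent_of_process_def path_def[symmetric, abs_def] N_def[symmetric]]])
        (auto simp: vimage_comp)
  qed (use g_path in \<open>auto intro!: measurable_sets[of _ M borel]\<close>)
  then have "indep_var borel (?i \<circ> T) borel (g \<circ> path)"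
    unfolding indep_var_eq using g_path[of "{}"] by (intro conjI indep_set_sigma_sets Int) auto
  then have "indep_vars (\<lambda>_. borel) (case_bool ((\<lambda>t. indicator {ereal s<..} t :: ennreal) \<circ> T) (g \<circ> path)) UNIV"
    unfolding indep_var_def by (rule back_subst[where P="\<lambda>b. indep_vars b _ _"]) (auto simp: fun_eq_iff split: bool.split)
  from indep_vars_nn_integral[OF _ this]
  have "(\<integral>\<^sup>+\<omega>. indicator {ereal s<..} (T \<omega>) * g (path \<omega>) \<partial>M) = (\<integral>\<^sup>+\<omega>. indicator {ereal s<..} (T \<omega>) \<partial>M) * (\<integral>\<^sup>+\<omega>. g (path \<omega>) \<partial>M)"
    by (simp add: UNIV_bool mult.commute comp_def)
  also have "(\<integral>\<^sup>+\<omega>. indicator {ereal s<..} (T \<omega>) \<partial>M) = (\<integral>\<^sup>+\<omega>. indicator {\<omega>\<in>space M. ereal s < T \<omega>} \<omega> \<partial>M)"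
    by (intro nn_integral_cong) (auto simp: indicator_def)
  also have "\<dots> = emeasure M {\<omega>\<in>space M. ereal s < T \<omega>}" by simp
  also have "(\<integral>\<^sup>+\<omega>. g (path \<omega>) \<partial>M) = (\<integral>\<^sup>+\<omega>. increment_product 0 xs \<omega> \<partial>M)"
    unfolding g_def path_def increment_product_eq_prod using nn by simp
  also have "\<dots> = laplace_product xs" by (rule nn_integral_increment_product) (use xs in auto)
  also have "(\<integral>\<^sup>+\<omega>. indicator {ereal s<..} (T \<omega>) * g (path \<omega>) \<partial>M)
     = (\<integral>\<^sup>+\<omega>. indicator {\<omega>\<in>space M. ereal s < T \<omega>} \<omega> * increment_product 0 xs \<omega> \<partial>M)"
    unfolding g_def path_def increment_product_eq_prod using nn
    by (intro nn_integral_cong) (simp add: indicator_def)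
  finally show ?thesis .
qed

lemma laplace_exponent_mono:
  assumes "m \<le> n" shows "\<phi> m \<le> \<phi> n"
proof -
  have "(\<integral>\<^sup>+\<omega>. ennreal (exp (- real n * \<zeta> 1 \<omega>)) \<partial>M) \<le> (\<integral>\<^sup>+\<omega>. ennreal (exp (- real m * \<zeta> 1 \<omega>)) \<partial>M)"
    using assms process_nonneg[of _ 1] by (intro nn_integral_mono) (auto intro!: mult_right_mono)
  then show ?thesis by (simp add: nn_integral_exp_process[of 1, simplified])
qed

lemma laplace_exponent_nonneg: "0 \<le> \<phi> m"
  using laplace_exponent_mono[of 0 m] by (simp add: laplace_exponent_def prob_space)

text \<open>If \<open>\<phi> 1\<close> vanished, \<open>E[exp(- \<zeta>_n)]\<close> would be 1 for every \<open>n\<close>, against dominated convergence to 0.\<close>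
lemma laplace_exponent_1_pos_of_drift:
  assumes "drifts_to_minus_infinity M (\<lambda>t \<omega>. - \<zeta> t \<omega>)"
  shows "0 < \<phi> 1"
proof (rule ccontr)
  assume "\<not> 0 < \<phi> 1"
  then have phi: "\<phi> 1 = 0" using laplace_exponent_nonneg[of 1] by simp
  have "(\<lambda>n. \<integral>\<omega>. exp (- \<zeta> (real n) \<omega>) \<partial>M) \<longlonglongrightarrow> (\<integral>\<omega>. 0 \<partial>M)"
  proof (rule integral_dominated_convergence[where w="\<lambda>_. 1"])
    show "AE \<omega> in M. (\<lambda>n. exp (- \<zeta> (real n) \<omega>)) \<longlonglongrightarrow> 0"
      using assms unfolding drifts_to_minus_infinity_def
    proof eventually_elim
      fix \<omega> assume "filterlim (\<lambda>t. - \<zeta> t \<omega>) at_bot at_top"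
      then have "filterlim (\<lambda>n. - \<zeta> (real n) \<omega>) at_bot sequentially"
        using filterlim_compose filterlim_real_sequentially by blast
      then show "(\<lambda>n. exp (- \<zeta> (real n) \<omega>)) \<longlonglongrightarrow> 0"
        using filterlim_compose[OF exp_at_bot] by blast
    qed
    show "AE \<omega> in M. norm (exp (- \<zeta> (real n) \<omega>)) \<le> 1" for n
      using process_nonneg[of _ "real n"] by (intro AE_I2) auto
  qed auto
  moreover have "(\<integral>\<omega>. exp (- \<zeta> (real n) \<omega>) \<partial>M) = 1" for n
    using nn_integral_exp_process[of "real n" 1] phi
    by (subst integral_eq_nn_integral) auto
  ultimately show False by (simp add: LIMSEQ_const_iff)
qed

text \<open>The closed form of the \<open>n\<close>-th moment of the functional killed at rate \<open>q\<close>.\<close>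
definition killed_moment :: "real \<Rightarrow> nat \<Rightarrow> real" where
  "killed_moment q n = fact n / (\<Prod>k=1..n. q + \<phi> k)"

text \<open>The recursion for \<open>joint_moment\<close> is a convolution in time, so the Laplace transform in time turns it
into multiplication by \<open>(n + 1) / (q + \<phi> m)\<close>.\<close>
lemma nn_integral_exp_joint_moment:
  assumes q: "0 < q + \<phi> m"
  shows "(\<integral>\<^sup>+t\<in>{0..}. (ennreal (exp (- t * q)) * joint_moment n m t) \<partial>lborel) = ennreal (fact n / (\<Prod>k=m..m+n. q + \<phi> k))"
  using q
proof (induction n arbitrary: m)
  case 0
  have "(\<integral>\<^sup>+t\<in>{0..}. (ennreal (exp (- t * q)) * joint_moment 0 m t) \<partial>lborel) = (\<integral>\<^sup>+t\<in>{0..}. ennreal (exp (- (t - 0) * (q + \<phi> m))) \<partial>lborel)"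
    by (intro nn_integral_cong) (simp add: ennreal_mult[symmetric] exp_add[symmetric] algebra_simps)
  then show ?case using nn_integral_exp_shift[OF 0, of 0] by simp
next
  case (Suc n)
  have pos: "0 < q + \<phi> k" if "m \<le> k" for k
    using laplace_exponent_mono[OF that] Suc.prems by simp
  let ?j = "joint_moment n (Suc m)"
  have "(\<integral>\<^sup>+t\<in>{0..}. (ennreal (exp (- t * q)) * joint_moment (Suc n) m t) \<partial>lborel)
     = of_nat (Suc n) * (\<integral>\<^sup>+t. (\<integral>\<^sup>+u. (ennreal (exp (- u * q)) * ?j u * indicator {0..} u) * (ennreal (exp (- (t - u) * (q + \<phi> m))) * indicator {p. snd p \<le> fst p} (t, u)) \<partial>lborel) \<partial>lborel)"
  proof (subst nn_integral_cmult[symmetric], measurable, rule nn_integral_cong)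
    fix t :: real
    have "ennreal (exp (- t * q)) * (?j u * ennreal (exp (- (t - u) * \<phi> m)) * indicator {0..t} u) * indicator {0..} t
       = ennreal (exp (- u * q)) * ?j u * indicator {0..} u * (ennreal (exp (- (t - u) * (q + \<phi> m))) * indicator {p. snd p \<le> fst p} (t, u))" for u
    proof (cases "0 \<le> u \<and> u \<le> t")
      case True
      have "exp (- t * q) * exp (- (t - u) * \<phi> m) = exp (- u * q) * exp (- (t - u) * (q + \<phi> m))"
        by (simp add: exp_add[symmetric] algebra_simps)
      then have "ennreal (exp (- t * q)) * ennreal (exp (- (t - u) * \<phi> m)) = ennreal (exp (- u * q)) * ennreal (exp (- (t - u) * (q + \<phi> m)))"
        by (simp only: ennreal_mult[symmetric] exp_ge_zero)
      then show ?thesis using True by (simp add: mult.assoc mult.left_commute[of _ "?j u"])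
    qed (auto simp: indicator_def)
    then have "(\<integral>\<^sup>+u. (ennreal (exp (- u * q)) * ?j u * indicator {0..} u) * (ennreal (exp (- (t - u) * (q + \<phi> m))) * indicator {p. snd p \<le> fst p} (t, u)) \<partial>lborel)
       = (\<integral>\<^sup>+u. ennreal (exp (- t * q)) * (?j u * ennreal (exp (- (t - u) * \<phi> m)) * indicator {0..t} u) * indicator {0..} t \<partial>lborel)"
      by simp
    also have "\<dots> = ennreal (exp (- t * q)) * (\<integral>\<^sup>+u. ?j u * ennreal (exp (- (t - u) * \<phi> m)) * indicator {0..t} u \<partial>lborel) * indicator {0..} t"
      by (subst nn_integral_multc, measurable, subst nn_integral_cmult, measurable)
    finally show "ennreal (exp (- t * q)) * joint_moment (Suc n) m t * indicator {0..} t = of_nat (Suc n) * 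
      (\<integral>\<^sup>+u. (ennreal (exp (- u * q)) * ?j u * indicator {0..} u) * (ennreal (exp (- (t - u) * (q + \<phi> m))) * indicator {p. snd p \<le> fst p} (t, u)) \<partial>lborel)"
      by (simp only: joint_moment.simps mult_ac)
  qed
  also have "(\<integral>\<^sup>+t. (\<integral>\<^sup>+u. (ennreal (exp (- u * q)) * ?j u * indicator {0..} u) * (ennreal (exp (- (t - u) * (q + \<phi> m))) * indicator {p. snd p \<le> fst p} (t, u)) \<partial>lborel) \<partial>lborel)
     = (\<integral>\<^sup>+u. (\<integral>\<^sup>+t. (ennreal (exp (- u * q)) * ?j u * indicator {0..} u) * (ennreal (exp (- (t - u) * (q + \<phi> m))) * indicator {p. snd p \<le> fst p} (t, u)) \<partial>lborel) \<partial>lborel)"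
    by (rule lborel_pair.Fubini') measurable
  also have "\<dots> = (\<integral>\<^sup>+u. (ennreal (exp (- u * q)) * ?j u * indicator {0..} u) * ennreal (1 / (q + \<phi> m)) \<partial>lborel)"
  proof (rule nn_integral_cong)
    fix u :: real
    have "(\<integral>\<^sup>+t. (ennreal (exp (- u * q)) * ?j u * indicator {0..} u) * (ennreal (exp (- (t - u) * (q + \<phi> m))) * indicator {p. snd p \<le> fst p} (t, u)) \<partial>lborel)
      = (ennreal (exp (- u * q)) * ?j u * indicator {0..} u) * (\<integral>\<^sup>+t. ennreal (exp (- (t - u) * (q + \<phi> m))) * indicator {p. snd p \<le> fst p} (t, u) \<partial>lborel)"
      by (rule nn_integral_cmult) measurable
    also have "(\<integral>\<^sup>+t. ennreal (exp (- (t - u) * (q + \<phi> m))) * indicator {p. snd p \<le> fst p} (t, u) \<partial>lborel)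
      = (\<integral>\<^sup>+t\<in>{u..}. ennreal (exp (- (t - u) * (q + \<phi> m))) \<partial>lborel)"
      by (intro nn_integral_cong) (auto simp: indicator_def)
    also have "\<dots> = ennreal (1 / (q + \<phi> m))" by (rule nn_integral_exp_shift) fact
    finally show "(\<integral>\<^sup>+t. (ennreal (exp (- u * q)) * ?j u * indicator {0..} u) * (ennreal (exp (- (t - u) * (q + \<phi> m))) * indicator {p. snd p \<le> fst p} (t, u)) \<partial>lborel)
      = (ennreal (exp (- u * q)) * ?j u * indicator {0..} u) * ennreal (1 / (q + \<phi> m))" .
  qed
  also have "\<dots> = ennreal (fact n / (\<Prod>k=Suc m..Suc m+n. q + \<phi> k)) * ennreal (1 / (q + \<phi> m))"
    by (subst nn_integral_multc, measurable, subst Suc.IH) (use pos[of "Suc m"] in simp_all)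
  also have "of_nat (Suc n) * \<dots> = ennreal (real (Suc n) * (fact n / (\<Prod>k=Suc m..Suc m+n. q + \<phi> k) * (1 / (q + \<phi> m))))"
  proof -
    have "0 \<le> fact n / (\<Prod>k=Suc m..Suc m+n. q + \<phi> k)" "0 \<le> 1 / (q + \<phi> m)"
      using pos by (auto intro!: divide_nonneg_nonneg prod_nonneg intro: less_imp_le simp del: prod.cl_ivl_Suc)
    then show ?thesis
      by (simp only: ennreal_of_nat_eq_real_of_nat ennreal_mult mult_nonneg_nonneg of_nat_0_le_iff)
  qed
  also have "real (Suc n) * (fact n / (\<Prod>k=Suc m..Suc m+n. q + \<phi> k) * (1 / (q + \<phi> m))) = fact (Suc n) / (\<Prod>k=m..m+Suc n. q + \<phi> k)"
    by (subst prod.atLeast_Suc_atMost[of m "m + Suc n"]) (auto simp: mult_ac)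
  finally show ?case .
qed

text \<open>The functional with values in the extended half-line. It avoids the default value 0 of a divergent
Bochner integral, so that its moments can be computed before it is known to be finite.\<close>
definition nn_functional :: "('a \<Rightarrow> ereal) \<Rightarrow> 'a \<Rightarrow> ennreal" where
  "nn_functional T \<omega> = (\<integral>\<^sup>+s. discount s \<omega> * indicator {s. ereal s < T \<omega>} s \<partial>lborel)"

lemma nn_functional_power_Suc:
  assumes \<omega>[measurable]: "\<omega> \<in> space M"
  shows "nn_functional T \<omega> ^ Suc n = of_nat (Suc n) * (\<integral>\<^sup>+s. discount s \<omega> * indicator {s. ereal s < T \<omega>} s * partial_functional s \<omega> ^ n \<partial>lborel)"
proof -
  have "nn_functional T \<omega> ^ Suc n = of_nat (Suc n) * (\<integral>\<^sup>+s. (discount s \<omega> * indicator {s. ereal s < T \<omega>} s) *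
      (\<integral>\<^sup>+u\<in>{..s}. (discount u \<omega> * indicator {s. ereal s < T \<omega>} u) \<partial>lborel) ^ n \<partial>lborel)"
    unfolding nn_functional_def by (rule nn_integral_power_Suc_eq_iterated) measurable
  also have "(\<integral>\<^sup>+s. (discount s \<omega> * indicator {s. ereal s < T \<omega>} s) *
      (\<integral>\<^sup>+u\<in>{..s}. (discount u \<omega> * indicator {s. ereal s < T \<omega>} u) \<partial>lborel) ^ n \<partial>lborel)
    = (\<integral>\<^sup>+s. discount s \<omega> * indicator {s. ereal s < T \<omega>} s * partial_functional s \<omega> ^ n \<partial>lborel)"
  proof (rule nn_integral_cong)
    fix s
    show "(discount s \<omega> * indicator {s. ereal s < T \<omega>} s) * (\<integral>\<^sup>+u\<in>{..s}. (discount u \<omega> * indicator {s. ereal s < T \<omega>} u) \<partial>lborel) ^ n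
      = discount s \<omega> * indicator {s. ereal s < T \<omega>} s * partial_functional s \<omega> ^ n"
    proof (cases "ereal s < T \<omega>")
      case True
      have "(\<integral>\<^sup>+u\<in>{..s}. (discount u \<omega> * indicator {s. ereal s < T \<omega>} u) \<partial>lborel) = partial_functional s \<omega>"
        unfolding partial_functional_def
      proof (rule nn_integral_cong)
        fix u show "discount u \<omega> * indicator {s. ereal s < T \<omega>} u * indicator {..s} u = discount u \<omega> * indicator {..s} u"
          using le_less_trans[of "ereal u" "ereal s" "T \<omega>"] True by (auto simp: indicator_def)
      qed
      then show ?thesis by simp
    qed simp
  qed
  finally show ?thesis .
qed

lemma exponential_time_tail:
  assumes q: "0 \<le> q" and T: "exponential_time M q T" and s: "0 \<le> s"
  shows "emeasure M {\<omega>\<in>space M. ereal s < T \<omega>} = ennreal (exp (- s * q))"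
proof (cases "q = 0")
  case True
  then have "{\<omega>\<in>space M. ereal s < T \<omega>} = space M"
    using T by (auto simp: exponential_time_def)
  then show ?thesis using True by (simp add: emeasure_space_1)
next
  case False
  then have D: "distributed M lborel (\<lambda>\<omega>. real_of_ereal (T \<omega>)) (exponential_density q)"
    and fin: "\<forall>\<omega>\<in>space M. \<bar>T \<omega>\<bar> \<noteq> \<infinity>"
    using T by (auto simp: exponential_time_def)
  have "{\<omega>\<in>space M. ereal s < T \<omega>} = {\<omega>\<in>space M. s < real_of_ereal (T \<omega>)}"
  proof (rule Collect_cong, rule conj_cong[OF refl])
    fix \<omega> assume "\<omega> \<in> space M"
    then obtain r where "T \<omega> = ereal r" using fin by (metis ereal_real)
    then show "(ereal s < T \<omega>) = (s < real_of_ereal (T \<omega>))" by simp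
  qed
  then show ?thesis
    using exponential_distributedD_gt[OF D s] q False by (simp add: emeasure_eq_measure)
qed

lemma measurable_nn_functional[measurable]:
  assumes [measurable]: "T \<in> borel_measurable M"
  shows "nn_functional T \<in> borel_measurable M"
proof -
  have "nn_functional T = (\<lambda>\<omega>. \<integral>\<^sup>+s. discount s \<omega> * indicator {p\<in>space (borel \<Otimes>\<^sub>M borel). ereal (fst p) < snd p} (s, T \<omega>) \<partial>lborel)"
    unfolding nn_functional_def by (intro ext nn_integral_cong) (auto simp: indicator_def space_pair_measure)
  also have "\<dots> \<in> borel_measurable M" by measurable
  finally show ?thesis .
qed

text \<open>The last of the \<open>n\<close> time variables is \<open>s < T\<close>. Given \<open>s\<close>, the remaining factors form a joint moment
at time \<open>s\<close>, and the event \<open>s < T\<close> contributes the independent factor \<open>exp (- s * q)\<close>; this covers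
\<open>q = 0\<close> as well, where the event is certain.\<close>
lemma nn_integral_nn_functional_power:
  assumes q: "0 \<le> q" and T: "exponential_time M q T" and ind: "independent_of_process M T \<zeta>"
    and pos: "0 < q + \<phi> 1"
  shows "(\<integral>\<^sup>+\<omega>. nn_functional T \<omega> ^ n \<partial>M) = ennreal (killed_moment q n)"
proof (cases n)
  case 0 then show ?thesis by (simp add: killed_moment_def emeasure_space_1)
next
  case (Suc n')
  have Tm[measurable]: "T \<in> borel_measurable M" using T by (simp add: exponential_time_def)
  interpret P: pair_sigma_finite lborel M ..
  have pos': "0 < q + \<phi> k" if "1 \<le> k" for k
    using laplace_exponent_mono[OF that] pos by simp
  let ?S = "{p\<in>space (borel \<Otimes>\<^sub>M borel). ereal (fst p) < snd p}"
  have S: "indicator {s. ereal s < T \<omega>} s = (indicator ?S (s, T \<omega>) :: ennreal)" for s \<omega>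
    by (auto simp: indicator_def space_pair_measure)
  have "(\<integral>\<^sup>+\<omega>. nn_functional T \<omega> ^ n \<partial>M) = (\<integral>\<^sup>+\<omega>. of_nat n * (\<integral>\<^sup>+s. discount s \<omega> * indicator ?S (s, T \<omega>) * partial_functional s \<omega> ^ n' \<partial>lborel) \<partial>M)"
    unfolding Suc S[symmetric] by (intro nn_integral_cong nn_functional_power_Suc)
  also have "\<dots> = of_nat n * (\<integral>\<^sup>+\<omega>. (\<integral>\<^sup>+s. discount s \<omega> * indicator ?S (s, T \<omega>) * partial_functional s \<omega> ^ n' \<partial>lborel) \<partial>M)"
    by (rule nn_integral_cmult) measurable
  also have "(\<integral>\<^sup>+\<omega>. (\<integral>\<^sup>+s. discount s \<omega> * indicator ?S (s, T \<omega>) * partial_functional s \<omega> ^ n' \<partial>lborel) \<partial>M)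
     = (\<integral>\<^sup>+s. (\<integral>\<^sup>+\<omega>. discount s \<omega> * indicator ?S (s, T \<omega>) * partial_functional s \<omega> ^ n' \<partial>M) \<partial>lborel)"
    by (rule P.Fubini') measurable
  also have "\<dots> = (\<integral>\<^sup>+s\<in>{0..}. (ennreal (exp (- s * q)) * joint_moment n' 1 s) \<partial>lborel)"
  proof (rule nn_integral_cong)
    fix s :: real
    show "(\<integral>\<^sup>+\<omega>. discount s \<omega> * indicator ?S (s, T \<omega>) * partial_functional s \<omega> ^ n' \<partial>M) = ennreal (exp (- s * q)) * joint_moment n' 1 s * indicator {0..} s"
    proof (cases "0 \<le> s")
      case s: True
      let ?B = "{\<omega>\<in>space M. ereal s < T \<omega>}"
      have "(\<integral>\<^sup>+\<omega>. discount s \<omega> * indicator ?S (s, T \<omega>) * partial_functional s \<omega> ^ n' \<partial>M)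
        = (\<integral>\<^sup>+\<omega>. indicator ?B \<omega> * partial_functional s \<omega> ^ n' * increment_product 0 [(1, s)] \<omega> * increment_product s [] \<omega> \<partial>M)"
        using s by (intro nn_integral_cong) (auto simp: discount_def process_0 indicator_def space_pair_measure mult_ac)
      also have "\<dots> = emeasure M ?B * joint_moment n' 1 s * laplace_product []"
        using s nn_integral_indep_increment_product[OF ind Tm] by (intro nn_integral_joint_moment) auto
      finally show ?thesis using s exponential_time_tail[OF q T s] by simp
    qed (simp add: discount_def)
  qed
  also have "\<dots> = ennreal (fact n' / (\<Prod>k=1..1+n'. q + \<phi> k))"
    by (rule nn_integral_exp_joint_moment) fact
  also have "of_nat n * \<dots> = ennreal (killed_moment q n)"
  proof -
    have "0 \<le> fact n' / (\<Prod>k=1..n. q + \<phi> k)"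
      using pos' by (intro divide_nonneg_nonneg prod_nonneg) (auto intro: less_imp_le)
    then have "of_nat n * ennreal (fact n' / (\<Prod>k=1..n. q + \<phi> k)) = ennreal (real n * (fact n' / (\<Prod>k=1..n. q + \<phi> k)))"
      by (simp only: ennreal_of_nat_eq_real_of_nat ennreal_mult of_nat_0_le_iff)
    then show ?thesis by (simp add: killed_moment_def Suc del: prod.cl_ivl_Suc)
  qed
  finally show ?thesis .
qed

lemma exponential_functional_eq_enn2real:
  assumes \<omega>[measurable]: "\<omega> \<in> space M"
  shows "exponential_functional (\<lambda>t \<omega>. - \<zeta> t \<omega>) T \<omega> = enn2real (nn_functional T \<omega>)"
proof -
  have [measurable]: "(\<lambda>s. enn2real (discount s \<omega>)) \<in> borel_measurable borel" by measurable
  have "exponential_functional (\<lambda>t \<omega>. - \<zeta> t \<omega>) T \<omega> = (\<integral>s. enn2real (discount s \<omega>) * indicator {s. ereal s < T \<omega>} s \<partial>lborel)"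
    unfolding exponential_functional_def set_lebesgue_integral_def
    by (intro Bochner_Integration.integral_cong) (auto simp: discount_def indicator_def)
  also have "\<dots> = enn2real (\<integral>\<^sup>+s. ennreal (enn2real (discount s \<omega>) * indicator {s. ereal s < T \<omega>} s) \<partial>lborel)"
    by (rule integral_eq_nn_integral) auto
  also have "(\<integral>\<^sup>+s. ennreal (enn2real (discount s \<omega>) * indicator {s. ereal s < T \<omega>} s) \<partial>lborel) = nn_functional T \<omega>"
    unfolding nn_functional_def by (intro nn_integral_cong) (auto simp: discount_def indicator_def)
  finally show ?thesis .
qed

lemma measurable_exponential_functional:
  assumes [measurable]: "T \<in> borel_measurable M"
  shows "exponential_functional (\<lambda>t \<omega>. - \<zeta> t \<omega>) T \<in> borel_measurable M"
proof -
  have "(\<lambda>\<omega>. enn2real (nn_functional T \<omega>)) \<in> borel_measurable M" by measurable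
  then show ?thesis
    by (subst measurable_cong[OF exponential_functional_eq_enn2real])
qed

text \<open>Finiteness of the first moment shows that the functional is almost surely finite, hence agrees almost
surely with its extended version.\<close>
lemma nn_integral_exponential_functional_power:
  assumes q: "0 \<le> q" and T: "exponential_time M q T" and ind: "independent_of_process M T \<zeta>"
    and pos: "0 < q + \<phi> 1"
  shows "(\<integral>\<^sup>+\<omega>. ennreal (exponential_functional (\<lambda>t \<omega>. - \<zeta> t \<omega>) T \<omega> ^ n) \<partial>M) = ennreal (killed_moment q n)"
proof -
  have Tm[measurable]: "T \<in> borel_measurable M" using T by (simp add: exponential_time_def)
  have "(\<integral>\<^sup>+\<omega>. nn_functional T \<omega> \<partial>M) \<noteq> \<infinity>"
    using nn_integral_nn_functional_power[OF assms, of 1] by simp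
  then have "AE \<omega> in M. nn_functional T \<omega> \<noteq> \<infinity>"
    by (intro nn_integral_noteq_infinite) measurable
  then have "(\<integral>\<^sup>+\<omega>. ennreal (exponential_functional (\<lambda>t \<omega>. - \<zeta> t \<omega>) T \<omega> ^ n) \<partial>M) = (\<integral>\<^sup>+\<omega>. nn_functional T \<omega> ^ n \<partial>M)"
    using AE_space by (intro nn_integral_cong_AE, eventually_elim)
      (simp add: exponential_functional_eq_enn2real ennreal_power[symmetric] less_top)
  then show ?thesis using nn_integral_nn_functional_power[OF assms] by simp
qed

section \<open>The equation and the law of the functional\<close>

lemma levy_measure: "subordinator_levy_measure \<nu>" and drift_nonneg: "0 \<le> c"
  using subordinator_with by (auto simp: subordinator_with_def)

lemma laplace_exponent_ennreal:
  "ennreal (\<phi> n) = ennreal (c * real n) + (\<integral>\<^sup>+s. ennreal (1 - exp (- real n * s)) \<partial>\<nu>)"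
  and laplace_exponent_ge_drift: "c * real n \<le> \<phi> n"
proof -
  have [measurable_cong]: "sets \<nu> = sets borel" using levy_measure by (auto simp: subordinator_levy_measure_def)
  let ?E = "\<integral>\<^sup>+s. ennreal (1 - exp (- real n * s)) \<partial>\<nu>"
  have "?E \<le> (\<integral>\<^sup>+s. ennreal (min 1 (s * real n)) \<partial>\<nu>)"
  proof (intro nn_integral_mono ennreal_leI)
    fix s show "1 - exp (- real n * s) \<le> min 1 (s * real n)"
      using exp_ge_add_one_self[of "- real n * s"] by (auto simp: mult.commute)
  qed
  also have "\<dots> < \<infinity>" by (intro nn_integral_min_levy_measure_finite levy_measure) auto
  finally have fin: "?E < \<infinity>" .
  have "\<phi> n = c * real n + (LINT x:{0<..}|\<nu>. 1 - exp (- real n * x))"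
    using subordinator_with by (simp add: subordinator_with_def)
  also have "(LINT x:{0<..}|\<nu>. 1 - exp (- real n * x)) = enn2real (\<integral>\<^sup>+x. ennreal (indicator {0<..} x *\<^sub>R (1 - exp (- real n * x))) \<partial>\<nu>)"
    unfolding set_lebesgue_integral_def
    by (rule integral_eq_nn_integral) (auto simp: indicator_def)
  also have "(\<integral>\<^sup>+x. ennreal (indicator {0<..} x *\<^sub>R (1 - exp (- real n * x))) \<partial>\<nu>) = ?E"
    by (rule nn_integral_cong_AE, use AE_levy_measure_pos[OF levy_measure] in eventually_elim) simp
  finally have eq: "\<phi> n = c * real n + enn2real ?E" .
  then show "c * real n \<le> \<phi> n" by simp
  show "ennreal (\<phi> n) = ennreal (c * real n) + ?E"
    unfolding eq using fin drift_nonneg by (subst ennreal_plus) auto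
qed

text \<open>The difference is the integral of \<open>1 - exp (- n * s)\<close> against the Levy measure.\<close>
lemma laplace_exponent_minus_drift_mono:
  assumes "m \<le> n" shows "\<phi> m - c * real m \<le> \<phi> n - c * real n"
proof -
  have E: "ennreal (\<phi> k - c * real k) = (\<integral>\<^sup>+s. ennreal (1 - exp (- real k * s)) \<partial>\<nu>)" for k
  proof -
    have "ennreal (c * real k) + ennreal (\<phi> k - c * real k) = ennreal (\<phi> k)"
      using laplace_exponent_ge_drift[of k] drift_nonneg by (subst ennreal_plus[symmetric]) auto
    then show ?thesis
      using laplace_exponent_ennreal[of k] by (simp add: ennreal_add_left_cancel)
  qed
  have "ennreal (\<phi> m - c * real m) \<le> ennreal (\<phi> n - c * real n)"
    unfolding E by (rule nn_integral_mono_AE, use AE_levy_measure_pos[OF levy_measure] in eventually_elim)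
      (use assms in \<open>auto intro!: ennreal_leI mult_right_mono\<close>)
  then show ?thesis using laplace_exponent_ge_drift[of n] by (subst (asm) ennreal_le_iff) auto
qed

text \<open>This is where the case of a pure drift without killing, whose functional is the constant \<open>1 / c\<close>, is
excluded.\<close>
lemma killed_laplace_exponent_gt_drift:
  assumes q: "0 \<le> q" and nontriv: "\<not> (q = 0 \<and> emeasure \<nu> {0<..} = 0)"
  shows "c < q + \<phi> 1"
proof (cases "q = 0")
  case False then show ?thesis using q laplace_exponent_ge_drift[of 1] by simp
next
  case True
  have sn[measurable_cong]: "sets \<nu> = sets borel" using levy_measure by (auto simp: subordinator_levy_measure_def)
  have "\<phi> 1 \<noteq> c"
  proof
    assume "\<phi> 1 = c"
    then have "ennreal c + (\<integral>\<^sup>+s. ennreal (1 - exp (- s)) \<partial>\<nu>) = ennreal c + 0"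
      using laplace_exponent_ennreal[of 1] by simp
    then have "(\<integral>\<^sup>+s. ennreal (1 - exp (- s)) \<partial>\<nu>) = 0"
      by (subst (asm) ennreal_add_left_cancel) simp
    then have "AE s in \<nu>. ennreal (1 - exp (- s)) = 0" by (subst (asm) nn_integral_0_iff_AE) auto
    then have "AE s in \<nu>. s \<notin> {0<..}" by eventually_elim (auto simp: ennreal_eq_0_iff)
    then have "emeasure \<nu> {0<..} = 0" by (subst (asm) AE_iff_measurable[of "{0<..}"]) (auto simp: sets_eq_imp_space_eq[OF sn])
    then show False using nontriv True by simp
  qed
  then show ?thesis using laplace_exponent_ge_drift[of 1] True by simp
qed

text \<open>The left-hand side is the moment of order \<open>n\<close> of \<open>c x \<mu>(dx) + R(x) dx\<close>. In the factor of the moment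
of order \<open>n + 1\<close> the drift term \<open>c\<close> complements the jump term \<open>(\<phi>(n+1) - c(n+1)) / (n+1)\<close>.\<close>
lemma moment_balance:
  assumes q: "0 \<le> q" and \<mu>: "finite_measure \<mu>" "sets \<mu> = sets borel" and pos: "AE y in \<mu>. 0 \<le> y"
  shows "ennreal c * (\<integral>\<^sup>+y. ennreal (y ^ Suc n) \<partial>\<mu>) + (\<integral>\<^sup>+x\<in>{0<..}. (ennreal (x ^ n) * density_rhs q \<nu> \<mu> x) \<partial>lborel)
     = ennreal ((q + \<phi> (Suc n)) / real (Suc n)) * (\<integral>\<^sup>+y. ennreal (y ^ Suc n) \<partial>\<mu>)"
proof -
  let ?E = "\<integral>\<^sup>+s. ennreal (1 - exp (- real (Suc n) * s)) \<partial>\<nu>"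
  have "ennreal c + ennreal (1 / real (Suc n)) * (?E + ennreal q)
     = ennreal (1 / real (Suc n)) * (ennreal (c * real (Suc n)) + ?E + ennreal q)"
    using drift_nonneg by (simp add: distrib_left ennreal_mult[symmetric] add.assoc del: of_nat_Suc)
  also have "\<dots> = ennreal ((q + \<phi> (Suc n)) / real (Suc n))"
    unfolding laplace_exponent_ennreal[symmetric] using q laplace_exponent_nonneg[of "Suc n"]
    by (simp add: ennreal_plus[symmetric] ennreal_mult[symmetric] add.commute del: of_nat_Suc ennreal_plus)
  finally show ?thesis
    unfolding nn_integral_power_density_rhs[OF levy_measure \<mu> pos q] by (simp only: distrib_right[symmetric])
qed

lemma killed_moment_0: "killed_moment q 0 = 1"
  by (simp add: killed_moment_def)

lemma killed_moment_Suc: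
  assumes q: "0 < q + \<phi> 1"
  shows "killed_moment q n = (q + \<phi> (Suc n)) / real (Suc n) * killed_moment q (Suc n)"
proof -
  have "q + \<phi> (Suc n) \<noteq> 0" using laplace_exponent_mono[of 1 "Suc n"] q by simp
  then show ?thesis by (simp add: killed_moment_def del: of_nat_Suc)
qed

lemma killed_moment_bounds:
  assumes q: "0 < q + \<phi> 1"
  shows "0 \<le> killed_moment q n" "killed_moment q n \<le> fact n / (q + \<phi> 1) ^ n"
proof -
  have ge: "q + \<phi> 1 \<le> q + \<phi> k" if "1 \<le> k" for k using laplace_exponent_mono[OF that] by simp
  have "(\<Prod>k=1..n. q + \<phi> 1) \<le> (\<Prod>k=1..n. q + \<phi> k)"
    using q ge by (intro prod_mono) auto
  then have le: "(q + \<phi> 1) ^ n \<le> (\<Prod>k=1..n. q + \<phi> k)" by simp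
  moreover have "0 < (q + \<phi> 1) ^ n" using q by simp
  ultimately show "0 \<le> killed_moment q n" "killed_moment q n \<le> fact n / (q + \<phi> 1) ^ n"
    unfolding killed_moment_def by (auto intro!: divide_left_mono divide_nonneg_nonneg)
qed

lemma measure_eq_of_killed_moments:
  assumes q: "0 < q + \<phi> 1"
    and M1: "prob_space M1" "sets M1 = sets borel" "AE x in M1. 0 \<le> x" "\<And>n. (\<integral>\<^sup>+x. ennreal (x ^ n) \<partial>M1) = ennreal (killed_moment q n)"
    and M2: "prob_space M2" "sets M2 = sets borel" "AE x in M2. 0 \<le> x" "\<And>n. (\<integral>\<^sup>+x. ennreal (x ^ n) \<partial>M2) = ennreal (killed_moment q n)"
  shows "M1 = M2"
  using M1 M2 killed_moment_bounds[OF q] by (intro moments_determine_measure[OF _ _ _ _ _ _ q]) (auto intro!: ennreal_leI)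

lemma support_interval_iff: "x \<in> support_interval c \<longleftrightarrow> 0 < x \<and> c * x < 1"
  using drift_nonneg by (auto simp: support_interval_def field_simps)

lemma density_rhs_density:
  assumes [measurable]: "k \<in> borel_measurable borel"
  shows "density_rhs q \<nu> (density lborel k) x
     = (\<integral>\<^sup>+y\<in>{x<..}. (levy_tail \<nu> (ln (y / x)) * k y) \<partial>lborel) + ennreal q * (\<integral>\<^sup>+y\<in>{x<..}. k y \<partial>lborel)"
proof -
  note [measurable] = borel_measurable_levy_tail[OF levy_measure]
  show ?thesis unfolding density_rhs_def
    by (subst nn_integral_density, measurable, subst emeasure_density, measurable) (simp add: mult_ac)
qed

text \<open>Beyond \<open>1 / c\<close> both \<open>k\<close> and the right-hand side vanish, so \<open>k(x) = c x k(x) + R(x)\<close> holds at all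
positive \<open>x\<close>. Integrating against \<open>x ^ n\<close> gives the recursion of \<open>killed_moment\<close>, with the same
initial value 1. Here the equation itself shows successively that the moments are finite.\<close>
lemma moments_of_solution:
  assumes q: "0 \<le> q" "0 < q + \<phi> 1"
    and k: "prob_density_on (support_interval c) k" "solves_density_equation q c \<nu> k"
  shows "(\<integral>\<^sup>+x. ennreal (x ^ n) \<partial>density lborel (\<lambda>x. ennreal (k x))) = ennreal (killed_moment q n)"
proof -
  define \<mu> where "\<mu> = density lborel (\<lambda>x. ennreal (k x))"
  have [measurable]: "k \<in> borel_measurable borel" and k0: "\<And>x. 0 \<le> k x" "\<And>x. x \<notin> support_interval c \<Longrightarrow> k x = 0"
    and int: "(\<integral>\<^sup>+x. ennreal (k x) \<partial>lborel) = 1"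
    using k by (auto simp: prob_density_on_def)
  have "emeasure \<mu> UNIV = 1" using int by (simp add: \<mu>_def emeasure_density)
  then interpret mu: prob_space \<mu> by (intro prob_spaceI) (simp add: \<mu>_def)
  have s[measurable_cong]: "sets \<mu> = sets borel" by (simp add: \<mu>_def)
  note [measurable] = borel_measurable_density_rhs[OF levy_measure mu.finite_measure_axioms s]
  have pos: "AE y in \<mu>. 0 \<le> y"
    unfolding \<mu>_def by (subst AE_density, measurable, rule AE_I2) (use k0(2) support_interval_iff in fastforce)
  have eq: "ennreal (k x) * indicator {0<..} x = ennreal (c * x) * ennreal (k x) * indicator {0<..} x + density_rhs q \<nu> \<mu> x * indicator {0<..} x" for x
  proof (cases "0 < x")
    case True
    show ?thesis
    proof (cases "x \<in> support_interval c")
      case S: True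
      then have "density_rhs q \<nu> \<mu> x = ennreal ((1 - c * x) * k x)"
        using k(2) by (simp add: solves_density_equation_def \<mu>_def density_rhs_density)
      moreover have "ennreal (k x) = ennreal (c * x * k x) + ennreal ((1 - c * x) * k x)"
      proof -
        have "0 \<le> c * x * k x" "0 \<le> (1 - c * x) * k x"
          using S k0(1)[of x] drift_nonneg by (auto simp: support_interval_iff)
        moreover have "k x = c * x * k x + (1 - c * x) * k x" by (simp add: algebra_simps)
        ultimately show ?thesis by (metis ennreal_plus)
      qed
      ultimately show ?thesis using True k0(1)[of x] drift_nonneg by (simp add: ennreal_mult)
    next
      case nS: False
      have "k y = 0" if "x < y" for y
      proof -
        have "1 \<le> c * x" using nS True by (simp add: support_interval_iff)
        also have "\<dots> \<le> c * y" using that drift_nonneg by (intro mult_left_mono) auto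
        finally show ?thesis by (intro k0(2)) (auto simp: support_interval_iff)
      qed
      then have z: "levy_tail \<nu> (ln (y / x)) * ennreal (k y) * indicator {x<..} y = 0" "ennreal (k y) * indicator {x<..} y = 0" for y
        by (auto simp: indicator_def)
      have "(\<lambda>x. ennreal (k x)) \<in> borel_measurable borel" by measurable
      from density_rhs_density[OF this, of q x] have "density_rhs q \<nu> \<mu> x = 0"
        unfolding \<mu>_def z by simp
      then show ?thesis using k0(2)[OF nS] by simp
    qed
  qed simp
  have mom: "(\<integral>\<^sup>+y. f y \<partial>\<mu>) = (\<integral>\<^sup>+x. ennreal (k x) * indicator {0<..} x * f x \<partial>lborel)"
    if [measurable]: "f \<in> borel_measurable borel" for f
    unfolding \<mu>_def by (subst nn_integral_density, measurable)
      (intro nn_integral_cong, use k0(2) in \<open>auto simp: indicator_def support_interval_iff\<close>)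
  have step: "(\<integral>\<^sup>+x. ennreal (x ^ n) \<partial>\<mu>) = ennreal ((q + \<phi> (Suc n)) / real (Suc n)) * (\<integral>\<^sup>+x. ennreal (x ^ Suc n) \<partial>\<mu>)" for n
  proof -
    have "(\<integral>\<^sup>+x. ennreal (x ^ n) \<partial>\<mu>) = (\<integral>\<^sup>+x. (ennreal (c * x) * ennreal (k x) * indicator {0<..} x + density_rhs q \<nu> \<mu> x * indicator {0<..} x) * ennreal (x ^ n) \<partial>lborel)"
      by (subst mom, measurable) (simp only: eq)
    also have "\<dots> = (\<integral>\<^sup>+x. ennreal c * (ennreal (k x) * indicator {0<..} x * ennreal (x ^ Suc n)) + ennreal (x ^ n) * density_rhs q \<nu> \<mu> x * indicator {0<..} x \<partial>lborel)"
      using drift_nonneg by (intro nn_integral_cong) (auto simp: indicator_def distrib_left distrib_right ennreal_mult mult_ac)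
    also have "\<dots> = ennreal c * (\<integral>\<^sup>+x. ennreal (x ^ Suc n) \<partial>\<mu>) + (\<integral>\<^sup>+x\<in>{0<..}. (ennreal (x ^ n) * density_rhs q \<nu> \<mu> x) \<partial>lborel)"
      by (subst mom, measurable, subst nn_integral_add, measurable, subst nn_integral_cmult, measurable)
    also have "\<dots> = ennreal ((q + \<phi> (Suc n)) / real (Suc n)) * (\<integral>\<^sup>+x. ennreal (x ^ Suc n) \<partial>\<mu>)"
      by (rule moment_balance[OF q(1) mu.finite_measure_axioms s pos])
    finally show ?thesis .
  qed
  have "(\<integral>\<^sup>+x. ennreal (x ^ n) \<partial>\<mu>) = ennreal (killed_moment q n)" for n
  proof (induction n)
    case 0 then show ?case using mu.emeasure_space_1 by (simp add: killed_moment_0)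
  next
    case (Suc n)
    define r where "r = (q + \<phi> (Suc n)) / real (Suc n)"
    have r: "0 < r" using laplace_exponent_mono[of 1 "Suc n"] q by (simp add: r_def)
    have "ennreal (1 / r) * (\<integral>\<^sup>+x. ennreal (x ^ n) \<partial>\<mu>) = ennreal (1 / r) * ennreal r * (\<integral>\<^sup>+x. ennreal (x ^ Suc n) \<partial>\<mu>)"
      unfolding step[of n] r_def[symmetric] by (simp only: mult.assoc)
    also have "ennreal (1 / r) * ennreal r = 1" using r by (simp add: ennreal_mult[symmetric])
    finally have "(\<integral>\<^sup>+x. ennreal (x ^ Suc n) \<partial>\<mu>) = ennreal (1 / r) * ennreal (killed_moment q n)" using Suc by simp
    also have "\<dots> = ennreal (killed_moment q (Suc n))"
      using r killed_moment_bounds(1)[OF q(2)] unfolding killed_moment_Suc[OF q(2), of n] r_def[symmetric]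
      by (simp add: ennreal_mult[symmetric])
    finally show ?case .
  qed
  then show ?thesis by (simp add: \<mu>_def)
qed

text \<open>The measure \<open>c x \<mu>(dx) + R(x) dx\<close> has the moments of \<open>\<mu>\<close>, in particular total mass 1, and is
carried by the half-line. The term \<open>c x \<mu>(dx)\<close> stays on the right because
\<open>(1 - c x) \<mu>(dx)\<close> is a positive measure only once \<open>\<mu>\<close> is known to be carried by \<open>[0, 1/c]\<close>,
which is itself a consequence of the balance.\<close>
lemma law_balance:
  assumes q: "0 \<le> q" "0 < q + \<phi> 1"
    and \<mu>: "prob_space \<mu>" "sets \<mu> = sets borel" "AE x in \<mu>. 0 \<le> x"
    and mom: "\<And>n. (\<integral>\<^sup>+x. ennreal (x ^ n) \<partial>\<mu>) = ennreal (killed_moment q n)"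
    and f[measurable]: "f \<in> borel_measurable borel"
  shows "(\<integral>\<^sup>+x. f x \<partial>\<mu>) = (\<integral>\<^sup>+x. ennreal (c * x) * f x \<partial>\<mu>) + (\<integral>\<^sup>+x\<in>{0<..}. (density_rhs q \<nu> \<mu> x * f x) \<partial>lborel)"
proof -
  interpret mu: prob_space \<mu> by fact
  note [measurable_cong] = \<mu>(2) and [measurable] = borel_measurable_density_rhs[OF levy_measure mu.finite_measure_axioms \<mu>(2)]
  obtain C where C: "sets C = sets (density \<mu> (\<lambda>x. ennreal (c * x)))"
    "\<And>f. f \<in> borel_measurable (density \<mu> (\<lambda>x. ennreal (c * x))) \<Longrightarrow>
      (\<integral>\<^sup>+x. f x \<partial>C) = (\<integral>\<^sup>+x. f x \<partial>density \<mu> (\<lambda>x. ennreal (c * x))) + (\<integral>\<^sup>+x. f x \<partial>density lborel (\<lambda>x. density_rhs q \<nu> \<mu> x * indicator {0<..} x))"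
    using exists_sum_measure[of "density lborel (\<lambda>x. density_rhs q \<nu> \<mu> x * indicator {0<..} x)" "density \<mu> (\<lambda>x. ennreal (c * x))"] \<mu>(2)
    by auto
  have sC[measurable_cong]: "sets C = sets borel" using C(1) \<mu>(2) by simp
  have intC: "(\<integral>\<^sup>+x. f x \<partial>C) = (\<integral>\<^sup>+x. ennreal (c * x) * f x \<partial>\<mu>) + (\<integral>\<^sup>+x\<in>{0<..}. (density_rhs q \<nu> \<mu> x * f x) \<partial>lborel)"
    if [measurable]: "f \<in> borel_measurable borel" for f
  proof -
    have "f \<in> borel_measurable (density \<mu> (\<lambda>x. ennreal (c * x)))" by measurable
    from C(2)[OF this] show ?thesis
      by (simp add: nn_integral_density mult_ac)
  qed
  have momC: "(\<integral>\<^sup>+x. ennreal (x ^ n) \<partial>C) = ennreal (killed_moment q n)" for n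
  proof -
    have "(\<integral>\<^sup>+x. ennreal (x ^ n) \<partial>C) = ennreal c * (\<integral>\<^sup>+y. ennreal (y ^ Suc n) \<partial>\<mu>) + (\<integral>\<^sup>+x\<in>{0<..}. (ennreal (x ^ n) * density_rhs q \<nu> \<mu> x) \<partial>lborel)"
    proof (subst intC, measurable, rule arg_cong2[where f="(+)"])
      have "(\<integral>\<^sup>+x. ennreal (c * x) * ennreal (x ^ n) \<partial>\<mu>) = (\<integral>\<^sup>+x. ennreal c * ennreal (x ^ Suc n) \<partial>\<mu>)"
        by (rule nn_integral_cong_AE, use \<mu>(3) in eventually_elim) (use drift_nonneg in \<open>auto simp: ennreal_mult mult_ac\<close>)
      also have "\<dots> = ennreal c * (\<integral>\<^sup>+x. ennreal (x ^ Suc n) \<partial>\<mu>)" by (rule nn_integral_cmult) measurable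
      finally show "(\<integral>\<^sup>+x. ennreal (c * x) * ennreal (x ^ n) \<partial>\<mu>) = ennreal c * (\<integral>\<^sup>+x. ennreal (x ^ Suc n) \<partial>\<mu>)" .
    qed (simp add: mult_ac)
    also have "\<dots> = ennreal ((q + \<phi> (Suc n)) / real (Suc n)) * ennreal (killed_moment q (Suc n))"
      by (subst mom[symmetric], rule moment_balance[OF q(1) mu.finite_measure_axioms \<mu>(2,3)])
    also have "\<dots> = ennreal (killed_moment q n)"
      using killed_moment_bounds(1)[OF q(2)] killed_moment_Suc[OF q(2), of n] q(1) laplace_exponent_nonneg[of "Suc n"]
      by (simp add: ennreal_mult[symmetric] del: of_nat_Suc)
    finally show ?thesis .
  qed
  have "emeasure C (space C) = 1" using momC[of 0] by (simp add: killed_moment_0)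
  then have pC: "prob_space C" by (rule prob_spaceI)
  have "emeasure C {..<0} = (\<integral>\<^sup>+x. indicator {..<0} x \<partial>C)" by simp
  also have "\<dots> = 0"
  proof (subst intC, measurable)
    have e1: "ennreal (c * x) * indicator {..<0} x = 0" for x
      using drift_nonneg by (auto simp: indicator_def ennreal_eq_0_iff mult_le_0_iff)
    have e2: "density_rhs q \<nu> \<mu> x * indicator {..<0} x * indicator {0<..} x = 0" for x
      by (auto simp: indicator_def)
    show "(\<integral>\<^sup>+x. ennreal (c * x) * indicator {..<0} x \<partial>\<mu>) + (\<integral>\<^sup>+x\<in>{0<..}. (density_rhs q \<nu> \<mu> x * indicator {..<0} x) \<partial>lborel) = 0"
      unfolding e1 e2 by simp
  qed
  finally have "AE x in C. 0 \<le> x"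
    by (intro AE_I[of _ _ "{..<0}"]) auto
  then have "C = \<mu>"
    by (intro measure_eq_of_killed_moments[OF q(2)] pC sC \<mu> momC mom)
  then show ?thesis using intC[OF f] by simp
qed

text \<open>With an atom of mass \<open>p\<close> at \<open>1 / c\<close> the numbers \<open>a n\<close>, the \<open>n\<close>-th moment times \<open>c ^ n\<close>, would stay
above \<open>p\<close>. The recursion of the moments then makes \<open>a n - a (n+1)\<close> at least
\<open>((q + \<phi> 1 - c) / c) * p / (n+1)\<close>, which is not summable.\<close>
lemma no_atom_at_reciprocal_drift:
  assumes q: "0 \<le> q" "0 < q + \<phi> 1" "c < q + \<phi> 1" and c: "0 < c"
    and \<mu>: "prob_space \<mu>" "sets \<mu> = sets borel"
    and mom: "\<And>n. (\<integral>\<^sup>+x. ennreal (x ^ n) \<partial>\<mu>) = ennreal (killed_moment q n)"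
  shows "emeasure \<mu> {1 / c} = 0"
proof -
  interpret mu: prob_space \<mu> by fact
  note [measurable_cong] = \<mu>(2)
  define p where "p = measure \<mu> {1 / c}"
  define a where "a n = c ^ n * killed_moment q n" for n
  have a0: "0 \<le> a n" for n using killed_moment_bounds(1)[OF q(2)] c by (simp add: a_def)
  have ap: "p \<le> a n" for n
  proof -
    have "ennreal ((1 / c) ^ n) * emeasure \<mu> {1 / c} = (\<integral>\<^sup>+x. ennreal ((1 / c) ^ n) * indicator {1 / c} x \<partial>\<mu>)"
      by (simp add: nn_integral_cmult_indicator)
    also have "\<dots> \<le> (\<integral>\<^sup>+x. ennreal (x ^ n) \<partial>\<mu>)" by (intro nn_integral_mono) (auto simp: indicator_def)
    finally have "ennreal ((1 / c) ^ n * p) \<le> ennreal (killed_moment q n)"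
      using c by (simp add: mom mu.emeasure_eq_measure p_def ennreal_mult[symmetric])
    then have "(1 / c) ^ n * p \<le> killed_moment q n"
      using killed_moment_bounds(1)[OF q(2)] by simp
    then show ?thesis using c by (simp add: a_def power_divide field_simps)
  qed
  define t where "t = (q + \<phi> 1 - c) / c"
  have t: "0 < t" using q c by (simp add: t_def)
  have "t * p / real (Suc n) \<le> a n - a (Suc n)" for n
  proof -
    have "a n = c ^ n * ((q + \<phi> (Suc n)) / real (Suc n) * killed_moment q (Suc n))"
      unfolding a_def killed_moment_Suc[OF q(2), of n] ..
    also have "\<dots> = (q + \<phi> (Suc n)) / (c * real (Suc n)) * a (Suc n)"
      using c by (simp add: a_def)
    finally have "a n - a (Suc n) = (q + \<phi> (Suc n) - c * real (Suc n)) / (c * real (Suc n)) * a (Suc n)"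
      using c by (simp add: field_simps del: of_nat_Suc)
    moreover have "(q + \<phi> 1 - c) / (c * real (Suc n)) * p \<le> (q + \<phi> (Suc n) - c * real (Suc n)) / (c * real (Suc n)) * a (Suc n)"
      using laplace_exponent_minus_drift_mono[of 1 "Suc n"] c q ap
      by (intro mult_mono divide_right_mono divide_nonneg_nonneg) (auto simp: p_def)
    ultimately show ?thesis by (simp add: t_def mult.commute del: of_nat_Suc)
  qed
  then have "t * p = 0"
    using t a0 by (intro zero_of_harmonic_decrements[of a]) (auto simp: p_def)
  then show ?thesis using t by (simp add: mu.emeasure_eq_measure p_def)
qed

text \<open>On a Lebesgue null set the term \<open>R(x) dx\<close> disappears and the balance reads \<open>\<mu>(dx) = c x \<mu>(dx)\<close>, which
leaves only the point where \<open>c x = 1\<close>.\<close>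
lemma law_absolutely_continuous:
  assumes q: "0 \<le> q" "0 < q + \<phi> 1" "c < q + \<phi> 1"
    and \<mu>: "prob_space \<mu>" "sets \<mu> = sets borel" "AE x in \<mu>. 0 \<le> x"
    and mom: "\<And>n. (\<integral>\<^sup>+x. ennreal (x ^ n) \<partial>\<mu>) = ennreal (killed_moment q n)"
  shows "absolutely_continuous lborel \<mu>"
  unfolding absolutely_continuous_def
proof
  interpret mu: prob_space \<mu> by fact
  note [measurable_cong] = \<mu>(2)
  fix N :: "real set" assume N: "N \<in> null_sets lborel"
  then have [measurable]: "N \<in> sets borel" by auto
  have "AE x in \<mu>. indicator N x = ennreal (c * x) * indicator N x"
  proof (rule mu.density_unique_finite_measure)
    fix A assume "A \<in> sets \<mu>"
    then have [measurable]: "A \<in> sets borel" using \<mu> by simp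
    have "(\<integral>\<^sup>+x\<in>{0<..}. (density_rhs q \<nu> \<mu> x * (indicator N x * indicator A x)) \<partial>lborel) = (\<integral>\<^sup>+x. 0 \<partial>(lborel :: real measure))"
      by (rule nn_integral_cong_AE, use AE_not_in[OF N] in eventually_elim) simp
    then show "(\<integral>\<^sup>+x. indicator N x * indicator A x \<partial>\<mu>) = (\<integral>\<^sup>+x. ennreal (c * x) * indicator N x * indicator A x \<partial>\<mu>)"
      using law_balance[OF q(1,2) \<mu> mom, of "\<lambda>x. indicator N x * indicator A x"] by (simp add: mult.assoc)
  qed auto
  then have "AE x in \<mu>. x \<in> N \<longrightarrow> c * x = 1"
  proof eventually_elim
    case (elim x)
    show ?case
    proof
      assume "x \<in> N"
      then have "ennreal (c * x) = 1" using elim by simp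
      then show "c * x = 1" by (metis ennreal_eq_1)
    qed
  qed
  moreover have "AE x in \<mu>. c * x \<noteq> 1"
  proof (cases "c = 0")
    case False
    then have "emeasure \<mu> {1 / c} = 0"
      using drift_nonneg by (intro no_atom_at_reciprocal_drift[OF q _ \<mu>(1,2) mom]) auto
    then show ?thesis using False by (intro AE_I[of _ _ "{1 / c}"]) (auto simp: field_simps)
  qed simp
  ultimately have "AE x in \<mu>. x \<notin> N" by eventually_elim auto
  then show "N \<in> null_sets \<mu>" by (subst (asm) AE_iff_null_sets[symmetric]) (auto simp: \<mu>(2))
qed

text \<open>A Radon-Nikodym density satisfies \<open>k0(x) = c x k0(x) + R(x)\<close> almost everywhere, which also forces it
to vanish outside the support interval. The version defined pointwise from \<open>R\<close> solves the equation
everywhere, since \<open>R\<close> depends on the density only through the measure.\<close>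
lemma law_has_solving_density:
  assumes q: "0 \<le> q" "0 < q + \<phi> 1" "c < q + \<phi> 1"
    and \<mu>: "prob_space \<mu>" "sets \<mu> = sets borel" "AE x in \<mu>. 0 \<le> x"
    and mom: "\<And>n. (\<integral>\<^sup>+x. ennreal (x ^ n) \<partial>\<mu>) = ennreal (killed_moment q n)"
  shows "\<exists>k. prob_density_on (support_interval c) k \<and> \<mu> = density lborel (\<lambda>x. ennreal (k x)) \<and> solves_density_equation q c \<nu> k"
proof -
  interpret mu: prob_space \<mu> by fact
  note [measurable_cong] = \<mu>(2) and [measurable] = borel_measurable_density_rhs[OF levy_measure mu.finite_measure_axioms \<mu>(2)]
  let ?R = "density_rhs q \<nu> \<mu>"
  obtain k0 where k0[measurable]: "k0 \<in> borel_measurable lborel" and \<mu>k0: "density lborel k0 = \<mu>"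
    using sigma_finite_measure.Radon_Nikodym[OF sigma_finite_lborel law_absolutely_continuous[OF assms]] \<mu>(2) by auto
  have "density lborel k0 = density lborel (\<lambda>x. k0 x * ennreal (c * x) + ?R x * indicator {0<..} x)"
  proof (rule measure_eqI)
    fix A assume "A \<in> sets (density lborel k0)"
    then have [measurable]: "A \<in> sets borel" by simp
    have "emeasure (density lborel k0) A = (\<integral>\<^sup>+x. indicator A x \<partial>\<mu>)" by (simp add: \<mu>k0 \<mu>(2))
    also have "\<dots> = (\<integral>\<^sup>+x. ennreal (c * x) * indicator A x \<partial>\<mu>) + (\<integral>\<^sup>+x\<in>{0<..}. (?R x * indicator A x) \<partial>lborel)"
      by (rule law_balance[OF q(1,2) \<mu> mom]) measurable
    also have "(\<integral>\<^sup>+x. ennreal (c * x) * indicator A x \<partial>\<mu>) = (\<integral>\<^sup>+x. k0 x * (ennreal (c * x) * indicator A x) \<partial>lborel)"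
      unfolding \<mu>k0[symmetric] by (rule nn_integral_density) measurable
    also have "\<dots> + (\<integral>\<^sup>+x\<in>{0<..}. (?R x * indicator A x) \<partial>lborel) = (\<integral>\<^sup>+x. (k0 x * ennreal (c * x) + ?R x * indicator {0<..} x) * indicator A x \<partial>lborel)"
      by (subst nn_integral_add[symmetric]) (auto intro!: nn_integral_cong simp: distrib_right distrib_left mult_ac)
    also have "\<dots> = emeasure (density lborel (\<lambda>x. k0 x * ennreal (c * x) + ?R x * indicator {0<..} x)) A"
      by (subst emeasure_density) auto
    finally show "emeasure (density lborel k0) A = emeasure (density lborel (\<lambda>x. k0 x * ennreal (c * x) + ?R x * indicator {0<..} x)) A" .
  qed simp
  then have eq: "AE x in lborel. k0 x = k0 x * ennreal (c * x) + ?R x * indicator {0<..} x"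
    by (subst (asm) sigma_finite_measure.density_unique_iff[OF sigma_finite_lborel]) auto
  have int: "(\<integral>\<^sup>+x. k0 x \<partial>lborel) = 1"
    using mu.emeasure_space_1 unfolding \<mu>k0[symmetric] by (simp add: emeasure_density)
  then have fin: "AE x in lborel. k0 x \<noteq> \<infinity>"
    by (intro nn_integral_noteq_infinite) auto
  define k where "k x = (if x \<in> support_interval c then enn2real (?R x) / (1 - c * x) else 0)" for x
  have "{x. 0 < x \<and> c * x < 1} \<in> sets borel" by measurable
  then have [measurable]: "support_interval c \<in> sets borel" by (simp add: support_interval_def)
  have [measurable]: "k \<in> borel_measurable borel" unfolding k_def by measurable
  have k_nonneg: "0 \<le> k x" for x by (auto simp: k_def support_interval_iff)
  have "AE x in lborel. x \<noteq> 1 / c" by (rule AE_lborel_singleton)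
  with eq fin have k0k: "AE x in lborel. k0 x = ennreal (k x)"
  proof eventually_elim
    case (elim x)
    obtain r where r: "k0 x = ennreal r" "0 \<le> r" using elim(2) by (cases "k0 x") auto
    \<comment> \<open>in the last case \<open>c x > 1\<close>, as \<open>x = 1 / c\<close> is excluded, and \<open>k0 x \<ge> c x k0 x\<close> forces 0\<close>
    consider "x \<le> 0" | "x \<in> support_interval c" | "0 < x" "1 \<le> c * x" by (force simp: support_interval_iff)
    then show ?case
    proof cases
      case 1
      then have "c * x \<le> 0" using drift_nonneg by (simp add: mult_le_0_iff)
      then have "k0 x = 0" using elim(1) 1 by (simp add: ennreal_neg)
      then show ?thesis using 1 by (simp add: k_def support_interval_iff)
    next
      case 2
      then have x: "0 < x" "c * x < 1" by (auto simp: support_interval_iff)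
      have e: "ennreal r = ennreal (r * (c * x)) + ?R x"
        using elim(1) x r drift_nonneg by (simp add: ennreal_mult)
      obtain s where s: "?R x = ennreal s" "0 \<le> s"
        using e by (cases "?R x") auto
      have "r = r * (c * x) + s"
        using e x r s drift_nonneg by (simp add: ennreal_plus[symmetric] del: ennreal_plus)
      then have "s / (1 - c * x) = r" using x by (simp add: field_simps)
      then show ?thesis using 2 s r by (simp add: k_def)
    next
      case 3
      then have cx: "1 < c * x" using elim(3) drift_nonneg by (cases "c = 0") (auto simp: field_simps order.strict_iff_order)
      have "k0 x * ennreal (c * x) \<le> k0 x * ennreal (c * x) + ?R x * indicator {0<..} x" by simp
      also have "\<dots> = k0 x" by (rule elim(1)[symmetric])
      finally have "ennreal (r * (c * x)) \<le> ennreal r" using r cx by (simp add: ennreal_mult)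
      then have "r * (c * x) \<le> r * 1" using r cx by simp
      then have "r = 0" using cx r by (metis mult_le_cancel_left_pos order.strict_iff_order not_less)
      then show ?thesis using 3 r by (simp add: k_def support_interval_iff)
    qed
  qed
  then have \<mu>k: "\<mu> = density lborel (\<lambda>x. ennreal (k x))"
    unfolding \<mu>k0[symmetric] by (intro density_cong) auto
  have R_fin: "?R x < \<infinity>" if x: "x \<in> support_interval c" for x
  proof -
    have x': "0 < x" "c * x < 1" using x by (auto simp: support_interval_iff)
    obtain b where b: "x < b" "c * b < 1"
    proof (cases "c = 0")
      case True then show ?thesis by (intro that[of "x + 1"]) auto
    next
      case False
      then have c: "0 < c" using drift_nonneg by simp
      show ?thesis using x' c by (intro that[of "(x + 1 / c) / 2"]) (auto simp: field_simps)
    qed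
    show ?thesis
    proof (rule density_rhs_finite[OF levy_measure q(1) _ \<mu>(1) \<mu>k x'(1) b(1)])
      show "AE u in lborel. x < u \<longrightarrow> u < b \<longrightarrow> ennreal (k u) \<le> ennreal (1 / (1 - c * b)) * ?R u"
      proof (intro AE_I2 impI)
        fix u assume u: "x < u" "u < b"
        have cu: "c * u \<le> c * b" using u drift_nonneg by (intro mult_left_mono) auto
        then have uS: "u \<in> support_interval c" using u x' b by (auto simp: support_interval_iff)
        show "ennreal (k u) \<le> ennreal (1 / (1 - c * b)) * ?R u"
        proof (cases "?R u = \<infinity>")
          case True then show ?thesis using b by (simp add: ennreal_mult_top)
        next
          case False
          then obtain s where s: "?R u = ennreal s" "0 \<le> s" by (cases "?R u") auto
          have "s / (1 - c * u) \<le> 1 / (1 - c * b) * s" using cu b s by (auto intro!: divide_left_mono)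
          then show ?thesis using uS s b by (simp add: k_def ennreal_mult[symmetric] ennreal_leI)
        qed
      qed
    qed (use b in auto)
  qed
  have "prob_density_on (support_interval c) k"
    using k_nonneg int nn_integral_cong_AE[OF k0k] by (auto simp: prob_density_on_def k_def)
  moreover have "solves_density_equation q c \<nu> k"
    unfolding solves_density_equation_def
  proof
    fix x assume x: "x \<in> support_interval c"
    have "ennreal ((1 - c * x) * k x) = ?R x"
      using x R_fin[OF x] by (auto simp: k_def support_interval_iff)
    then show "ennreal ((1 - c * x) * k x) = (\<integral>\<^sup>+y\<in>{x<..}. (levy_tail \<nu> (ln (y / x)) * ennreal (k y)) \<partial>lborel)
            + ennreal q * (\<integral>\<^sup>+y\<in>{x<..}. ennreal (k y) \<partial>lborel)"
      unfolding \<mu>k by (subst (asm) density_rhs_density) auto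
  qed
  ultimately show ?thesis using \<mu>k by blast
qed

end

theorem theorem2p4:
  fixes M :: "'a measure" and \<zeta> :: "real \<Rightarrow> 'a \<Rightarrow> real" and T :: "'a \<Rightarrow> ereal"
    and q c :: real and \<nu> :: "real measure"
  assumes "0 \<le> q"
    and "subordinator_with M \<zeta> c \<nu>"
    and "exponential_time M q T"
    and "independent_of_process M T \<zeta>"
    and "q = 0 \<Longrightarrow> drifts_to_minus_infinity M (\<lambda>t \<omega>. - \<zeta> t \<omega>)"
  shows "(\<not> (q = 0 \<and> emeasure \<nu> {0<..} = 0) \<longrightarrow>
            (\<exists>k. prob_density_on (support_interval c) k \<and>
                 distributed M lborel (exponential_functional (\<lambda>t \<omega>. - \<zeta> t \<omega>) T) (\<lambda>x. ennreal (k x)) \<and>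
                 solves_density_equation q c \<nu> k)) \<and>
         (\<forall>k. prob_density_on (support_interval c) k \<and> solves_density_equation q c \<nu> k \<longrightarrow>
              distributed M lborel (exponential_functional (\<lambda>t \<omega>. - \<zeta> t \<omega>) T) (\<lambda>x. ennreal (k x)))"
proof -
  interpret subordinator_process M \<zeta> c \<nu> by standard fact
  have q1: "0 < q + laplace_exponent M \<zeta> (real 1)"
    using laplace_exponent_1_pos_of_drift laplace_exponent_nonneg[of 1] assms(1,5) by (cases "q = 0") auto
  let ?I = "exponential_functional (\<lambda>t \<omega>. - \<zeta> t \<omega>) T"
  have [measurable]: "?I \<in> borel_measurable M"
    using assms(3) by (intro measurable_exponential_functional) (simp add: exponential_time_def)
  define \<mu> where "\<mu> = distr M borel ?I"
  have \<mu>: "prob_space \<mu>" "sets \<mu> = sets borel"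
    by (auto simp: \<mu>_def intro!: prob_space_distr)
  have \<mu>_nonneg: "AE x in \<mu>. 0 \<le> x"
    unfolding \<mu>_def by (subst AE_distr_iff) (auto simp: exponential_functional_eq_enn2real)
  have mom: "(\<integral>\<^sup>+x. ennreal (x ^ n) \<partial>\<mu>) = ennreal (killed_moment q n)" for n
    unfolding \<mu>_def using nn_integral_exponential_functional_power[OF assms(1,3,4) q1]
    by (subst nn_integral_distr) auto
  have distributed_iff: "distributed M lborel ?I (\<lambda>x. ennreal (k x))"
    if "\<mu> = density lborel (\<lambda>x. ennreal (k x))" "prob_density_on (support_interval c) k" for k
  proof -
    have "distr M lborel ?I = \<mu>" unfolding \<mu>_def by (rule distr_cong) auto
    then show ?thesis using that unfolding distributed_def prob_density_on_def by simp
  qed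
  show ?thesis
  proof (intro conjI impI allI)
    assume "\<not> (q = 0 \<and> emeasure \<nu> {0<..} = 0)"
    from law_has_solving_density[OF assms(1) q1 killed_laplace_exponent_gt_drift[OF assms(1) this] \<mu> \<mu>_nonneg mom]
    show "\<exists>k. prob_density_on (support_interval c) k \<and> distributed M lborel ?I (\<lambda>x. ennreal (k x)) \<and> solves_density_equation q c \<nu> k"
      using distributed_iff by blast
  next
    fix k assume k: "prob_density_on (support_interval c) k \<and> solves_density_equation q c \<nu> k"
    let ?\<kappa> = "density lborel (\<lambda>x. ennreal (k x))"
    have "prob_space ?\<kappa>"
      using k by (intro prob_spaceI) (simp add: emeasure_density prob_density_on_def)
    moreover have "AE x in ?\<kappa>. 0 \<le> x"
    proof (subst AE_density)
      have "k x = 0" if "x < 0" for x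
        using k that by (auto simp: prob_density_on_def support_interval_iff)
      then show "AE x in lborel. 0 < ennreal (k x) \<longrightarrow> 0 \<le> x"
        by (intro AE_I2) (metis ennreal_0 less_irrefl not_less)
    qed (use k in \<open>simp add: prob_density_on_def\<close>)
    ultimately have "\<mu> = ?\<kappa>"
      using k by (intro measure_eq_of_killed_moments[OF q1] \<mu> \<mu>_nonneg mom moments_of_solution[OF assms(1) q1]) auto
    then show "distributed M lborel ?I (\<lambda>x. ennreal (k x))"
      using distributed_iff k by blast
  qed
qed

end
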